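(* Let $N \ge 3$ be an integer, let $a > 0$, $1 < p < 2^*$, $1 \le q < \infty$, $2 < pq < 2^*$, and $1 < b < b_* := 1 + Nq\,(1 - p/2^* )$. Then the equation $$-\Delta u + \Phi_u(|x|)\, |u|^{p-2} u = |u|^{2^* - 2} u \quad \text{in } \mathbb{R}^N$$ has no nontrivial weak radial solution.
   Context: $2^* = 2N/(N-2)$. $B_\rho = \{x \in \mathbb{R}^N : |x| < \rho\}$, $h_u(\rho) = \int_{B_\rho} |u|^p\, dy$, and $\Phi_u(r) = a \int_r^\infty \rho^{-b}\, h_u^{q-1}(\rho)\, d\rho$ for $r > 0$. $E^{p,q}_b(\mathbb{R}^N)$ is the space of all weakly differentiable functions $u : \mathbb{R}^N \to \mathbb{R}$ such that $\int_{\mathbb{R}^N} |\nabla u|^2\, dx + \int_0^\infty \rho^{-b}\, h_u^q(\rho)\, d\rho < \infty$, and $E^{p,q}_{b,\mathrm{rad}}(\mathbb{R}^N)$ is its subspace of radially symmetric functions. A weak radial solution is a function $u \in E^{p,q}_{b,\mathrm{rad}}(\mathbb{R}^N)$ satisfying $$\int_{\mathbb{R}^N} \nabla u \cdot \nabla v\, dx + \int_{\mathbb{R}^N} \Phi_u(|x|)\, |u|^{p-2} u v\, dx = \int_{\mathbb{R}^N} |u|^{2^*-2} u v\, dx \quad \forall v \in E^{p,q}_{b,\mathrm{rad}}(\mathbb{R}^N).$$ *)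

theory Defs
  imports "HOL-Analysis.Analysis"
begin

definition crit_exp :: "nat \<Rightarrow> real" where
  "crit_exp N = 2 * real N / (real N - 2)"

text \<open>Powers of a nonnegative base, with the convention that the zeroth power is 1 also at 0
  (whereas \<open>0 powr 0 = 0\<close>). It is needed for the exponent \<open>q - 1\<close> when \<open>q = 1\<close>.\<close>

definition rpow :: "real \<Rightarrow> real \<Rightarrow> real" where
  "rpow x s = (if s = 0 then 1 else x powr s)"

definition partial_deriv :: "'n::finite \<Rightarrow> (real^'n \<Rightarrow> real) \<Rightarrow> real^'n \<Rightarrow> real" where
  "partial_deriv i f x = frechet_derivative f (at x) (axis i 1)"

primrec C_diff :: "nat \<Rightarrow> (real^'n::finite \<Rightarrow> real) \<Rightarrow> bool" where
  "C_diff 0 f \<longleftrightarrow> continuous_on UNIV f"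
| "C_diff (Suc k) f \<longleftrightarrow>
     (\<forall>x. f differentiable (at x)) \<and> (\<forall>i. C_diff k (partial_deriv i f))"

definition test_function :: "(real^'n::finite \<Rightarrow> real) \<Rightarrow> bool" where
  "test_function \<phi> \<longleftrightarrow> (\<forall>k. C_diff k \<phi>) \<and> compact (closure {x. \<phi> x \<noteq> 0})"

definition locally_integrable ::
    "(real^'n::finite \<Rightarrow> 'b::{banach, second_countable_topology}) \<Rightarrow> bool" where
  "locally_integrable f \<longleftrightarrow> (\<forall>K. compact K \<longrightarrow> set_integrable lebesgue K f)"

definition has_weak_gradient ::
    "(real^'n::finite \<Rightarrow> real) \<Rightarrow> (real^'n \<Rightarrow> real^'n) \<Rightarrow> bool" where
  "has_weak_gradient u G \<longleftrightarrow>
     locally_integrable u \<and> locally_integrable G \<and>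
     (\<forall>\<phi>. test_function \<phi> \<longrightarrow>
       (\<forall>i. (LINT x|lebesgue. u x * partial_deriv i \<phi> x) = - (LINT x|lebesgue. G x $ i * \<phi> x)))"

definition weakly_differentiable :: "(real^'n::finite \<Rightarrow> real) \<Rightarrow> bool" where
  "weakly_differentiable u \<longleftrightarrow> (\<exists>G. has_weak_gradient u G)"

text \<open>The weak gradient is unique only up to null sets; below it occurs only under integrals.\<close>

definition weak_grad :: "(real^'n::finite \<Rightarrow> real) \<Rightarrow> real^'n \<Rightarrow> real^'n" where
  "weak_grad u = (SOME G. has_weak_gradient u G)"

definition ball_mass :: "real \<Rightarrow> (real^'n::finite \<Rightarrow> real) \<Rightarrow> real \<Rightarrow> real" where
  "ball_mass p u \<rho> = (LINT y:ball 0 \<rho>|lebesgue. \<bar>u y\<bar> powr p)"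

definition potential ::
    "real \<Rightarrow> real \<Rightarrow> real \<Rightarrow> real \<Rightarrow> (real^'n::finite \<Rightarrow> real) \<Rightarrow> real \<Rightarrow> real" where
  "potential a b p q u r =
     a * (LINT \<rho>:{r<..}|lebesgue. \<rho> powr (- b) * rpow (ball_mass p u \<rho>) (q - 1))"

text \<open>Integrability of \<open>\<bar>u\<bar> powr p\<close> on balls is part of the finiteness of the second energy
  term: the mass, read as an extended real, is nondecreasing in the radius, so an infinite value
  would make that term infinite. It is listed separately because the integral in \<open>ball_mass\<close> is
  real-valued and takes the value 0 for non-integrable functions.\<close>

definition E_space :: "real \<Rightarrow> real \<Rightarrow> real \<Rightarrow> (real^'n::finite \<Rightarrow> real) set" where
  "E_space b p q = {u.
     weakly_differentiable u \<and>
     (\<forall>\<rho>>0. set_integrable lebesgue (ball 0 \<rho>) (\<lambda>y. \<bar>u y\<bar> powr p)) \<and>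
     (\<integral>\<^sup>+x. ennreal ((norm (weak_grad u x))\<^sup>2) \<partial>lebesgue)
       + (\<integral>\<^sup>+\<rho>\<in>{0<..}. ennreal (\<rho> powr (- b) * ball_mass p u \<rho> powr q) \<partial>lebesgue) < \<infinity>}"

text \<open>Elements of the space are identified when they agree almost everywhere, so radial symmetry
  is understood up to a null set.\<close>

definition radially_symmetric :: "(real^'n::finite \<Rightarrow> real) \<Rightarrow> bool" where
  "radially_symmetric u \<longleftrightarrow> (\<exists>f :: real \<Rightarrow> real. AE x in lebesgue. u x = f (norm x))"

definition E_rad :: "real \<Rightarrow> real \<Rightarrow> real \<Rightarrow> (real^'n::finite \<Rightarrow> real) set" where
  "E_rad b p q = {u \<in> E_space b p q. radially_symmetric u}"

definition weak_radial_solution ::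
    "real \<Rightarrow> real \<Rightarrow> real \<Rightarrow> real \<Rightarrow> (real^'n::finite \<Rightarrow> real) \<Rightarrow> bool" where
  "weak_radial_solution a b p q u \<longleftrightarrow>
     u \<in> E_rad b p q \<and>
     (\<forall>v \<in> E_rad b p q.
        (LINT x|lebesgue. weak_grad u x \<bullet> weak_grad v x)
          + (LINT x|lebesgue. potential a b p q u (norm x) * \<bar>u x\<bar> powr (p - 2) * u x * v x)
        = (LINT x|lebesgue. \<bar>u x\<bar> powr (crit_exp CARD('n) - 2) * u x * v x))"

end

theory Submission
  imports Defs
begin

text \<open>Write \<open>N = CARD('n)\<close>, \<open>s\<close> for the critical exponent, \<open>m = (N - 2) / 2\<close>, and let \<open>u\<close> be a solution with weak
gradient \<open>G\<close>. The dilates \<open>u\<^sub>t x = t powr m * u (t x)\<close> belong to the space again; they have the same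
Dirichlet energy and the same integral of \<open>\<bar>u\<bar> powr s\<close>, while \<open>M = \<integral> \<rho> powr (- b) * h \<rho> powr q\<close>, where \<open>h \<rho>\<close>
is the integral of \<open>\<bar>u\<bar> powr p\<close> over the ball of radius \<open>\<rho>\<close>, is multiplied by \<open>t powr (- \<delta>)\<close>, where
\<open>\<delta> = b\<^sub>* - b > 0\<close> and \<open>b\<^sub>*\<close> is the upper bound for \<open>b\<close>. The Pohozaev identity is formally the derivative at
\<open>t = 1\<close> of the equation tested with \<open>u\<^sub>t\<close>. The argument below uses finite differences in \<open>t\<close> instead, so that
no regularity of \<open>u\<close> has to be established.

Let \<open>A t + D t = K t\<close> be the equation tested with \<open>u\<^sub>t\<close>, the three terms being the gradient term, the
nonlocal term and the critical term. Then \<open>A t \<le> A 1\<close> by the Cauchy-Schwarz inequality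
(\<open>gradient_term_le\<close>). Two applications of Young's inequality, to \<open>\<bar>u\<bar> powr (p - 1) * \<bar>u\<^sub>t\<bar>\<close> and to the
masses of balls, give \<open>D 1 - D t \<ge> a * M * (1 - t powr (- \<delta>)) / (p * q)\<close> (\<open>potential_term_bound\<close>,
\<open>energy_dil\<close>). Subtracting the equations for \<open>t\<close> and for \<open>1\<close>,
\<open>K 1 - K t \<ge> a * M * (1 - t powr (- \<delta>)) / (p * q)\<close>, whose right-hand side is of first order in \<open>t - 1\<close> unless \<open>M = 0\<close>.

On the other hand \<open>K 1 - K t\<close> is at most of second order for \<open>t > 1\<close> (\<open>critical_term_bound\<close>). With
\<open>f y = \<bar>y\<bar> powr (s - 2) * y\<close>, Young's inequality gives
\<open>K 1 - K t \<le> \<integral> (f u - f u\<^sub>t) * (u - u\<^sub>t) \<le> (s - 1) * \<integral> max \<bar>u\<bar> \<bar>u\<^sub>t\<bar> powr (s - 2) * (u - u\<^sub>t)\<^sup>2\<close>.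
A radial function with finite Dirichlet energy and finite integral of \<open>\<bar>u\<bar> powr s\<close> satisfies
\<open>\<bar>u x\<bar> \<le> C * norm x powr (- m)\<close> almost everywhere
(\<open>radial_bound\<close>), and so do its dilates; hence the weight is at most a multiple of \<open>1 / (norm x)\<^sup>2\<close>; and
\<open>\<bar>u (t x) - u x\<bar>\<close> is at most the integral of \<open>norm x * norm (G (r x))\<close> over \<open>1 \<le> r \<le> t\<close>
(\<open>ray_bound\<close>), while the remaining part \<open>(t powr m - 1) * u (t x)\<close> of \<open>u\<^sub>t - u\<close> is controlled by the
integral of \<open>\<bar>u\<bar> powr s\<close>, so that the whole integral is \<open>O ((t - 1)\<^sup>2)\<close>. Hence \<open>M = 0\<close>, and \<open>u = 0\<close>.

If \<open>\<bar>u\<bar> powr s\<close> is not integrable, the integral \<open>K 1\<close> has the value \<open>0\<close> by convention, and the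
equation tested with \<open>u\<close> itself, whose left-hand side is at least \<open>a * M\<close>, yields \<open>M = 0\<close> directly.\<close>

section \<open>Smooth compactly supported functions\<close>

text \<open>For \<open>s > 0\<close> the function \<open>exp (- 1 / s) / s ^ k\<close>, and \<open>0\<close> otherwise. The family is closed under
differentiation up to linear combinations, which is why the powers of \<open>s\<close> are included.\<close>

definition bump :: "nat \<Rightarrow> real \<Rightarrow> real" where
  "bump k s = (if s > 0 then exp (- 1 / s) / s ^ k else 0)"

lemma bump_tendsto_0_right: "(bump k \<longlongrightarrow> 0) (at_right 0)"
proof -
  have "((\<lambda>x::real. x ^ k / exp x) \<longlongrightarrow> 0) at_top"
    by (rule tendsto_power_div_exp_0)
  then have "((\<lambda>s::real. inverse s ^ k / exp (inverse s)) \<longlongrightarrow> 0) (at_right 0)"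
    by (rule filterlim_compose[OF _ filterlim_inverse_at_top_right])
  moreover have "\<forall>\<^sub>F s in at_right 0. inverse s ^ k / exp (inverse s) = bump k s"
    unfolding eventually_at_filter
    by (intro always_eventually) (simp add: bump_def field_simps exp_minus inverse_eq_divide)
  ultimately show ?thesis
    by (rule Lim_transform_eventually)
qed

lemma bump_has_deriv:
  "(bump k has_real_derivative (bump (k + 2) s - real k * bump (k + 1) s)) (at s)"
proof -
  consider "s > 0" | "s < 0" | "s = 0" by linarith
  then show ?thesis
  proof cases
    case 1
    have "((\<lambda>s. exp (- 1 / s) / s ^ k) has_real_derivative
        (bump (k + 2) s - real k * bump (k + 1) s)) (at s)"
      using 1 by (auto intro!: derivative_eq_intros simp: bump_def field_simps power2_eq_square)
        (cases k; simp add: field_simps)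
    then show ?thesis
      by (rule has_field_derivative_transform_within_open[where S = "{0<..}"])
        (use 1 in \<open>auto simp: bump_def\<close>)
  next
    case 2
    have "((\<lambda>s. 0) has_real_derivative (bump (k + 2) s - real k * bump (k + 1) s)) (at s)"
      using 2 by (auto intro!: derivative_eq_intros simp: bump_def)
    then show ?thesis
      by (rule has_field_derivative_transform_within_open[where S = "{..<0}"])
        (use 2 in \<open>auto simp: bump_def\<close>)
  next
    case 3
    have "((\<lambda>h. (bump k (0 + h) - bump k 0) / h) \<longlongrightarrow> 0) (at 0)"
    proof -
      have "((\<lambda>h. (bump k (0 + h) - bump k 0) / h) \<longlongrightarrow> 0) (at_right 0)"
        by (rule Lim_transform_eventually[OF bump_tendsto_0_right[of "k + 1"]])
          (auto simp: eventually_at_filter bump_def field_simps)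
      moreover have "((\<lambda>h. (bump k (0 + h) - bump k 0) / h) \<longlongrightarrow> 0) (at_left 0)"
        by (rule Lim_transform_eventually[OF tendsto_const])
          (auto simp: eventually_at_filter bump_def)
      ultimately show ?thesis
        by (simp add: filterlim_split_at)
    qed
    then show ?thesis
      using 3 by (simp add: DERIV_def bump_def)
  qed
qed

lemma bump_nonneg: "bump k s \<ge> 0"
  by (simp add: bump_def)

lemma bump_0_le_1: "bump 0 s \<le> 1"
  by (simp add: bump_def)

lemma bump_0_tendsto: "s > 0 \<Longrightarrow> (\<lambda>n. bump 0 (real n * s)) \<longlonglongrightarrow> 1"
proof -
  assume s: "s > 0"
  have "(\<lambda>n. (- 1 / s) * (1 / real n)) \<longlonglongrightarrow> (- 1 / s) * 0"
    by (intro tendsto_intros lim_1_over_n)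
  then have "(\<lambda>n. exp ((- 1 / s) * (1 / real n))) \<longlonglongrightarrow> exp 0"
    by (intro tendsto_exp) simp
  moreover have "\<forall>\<^sub>F n in sequentially. exp ((- 1 / s) * (1 / real n)) = bump 0 (real n * s)"
    using eventually_gt_at_top[of 0] by eventually_elim (use s in \<open>auto simp: bump_def field_simps\<close>)
  ultimately show ?thesis
    using Lim_transform_eventually by fastforce
qed

text \<open>An algebra of smooth functions that is closed under partial derivatives. It contains all test
functions that the argument constructs, and membership is easier to check than \<open>C_diff\<close> of every order.\<close>

inductive_set smooth_alg :: "(real^'n::finite \<Rightarrow> real) set" where
  const: "(\<lambda>x. c) \<in> smooth_alg"
| coord: "(\<lambda>x. x $ i) \<in> smooth_alg"
| bump: "(\<lambda>x. bump k (\<alpha> * x $ i + \<beta>)) \<in> smooth_alg"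
| add: "f \<in> smooth_alg \<Longrightarrow> g \<in> smooth_alg \<Longrightarrow> (\<lambda>x. f x + g x) \<in> smooth_alg"
| mult: "f \<in> smooth_alg \<Longrightarrow> g \<in> smooth_alg \<Longrightarrow> (\<lambda>x. f x * g x) \<in> smooth_alg"

lemma smooth_alg_prod:
  "finite I \<Longrightarrow> (\<And>i. i \<in> I \<Longrightarrow> f i \<in> smooth_alg) \<Longrightarrow> (\<lambda>x. \<Prod>i\<in>I. f i x) \<in> smooth_alg"
  by (induction I rule: finite_induct) (auto intro: smooth_alg.intros)

lemma smooth_alg_dilate:
  "f \<in> smooth_alg \<Longrightarrow> (\<lambda>x. f (c *\<^sub>R x)) \<in> smooth_alg"
proof (induction rule: smooth_alg.induct)
  case (bump k \<alpha> i \<beta>)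
  then show ?case
    using smooth_alg.bump[of k "\<alpha> * c" i \<beta>] by (simp add: mult.assoc)
qed (auto intro: smooth_alg.intros)

lemma partial_deriv_eqI:
  assumes "(f has_derivative (\<lambda>v. \<Sum>i\<in>UNIV. D i * v $ i)) (at x)"
  shows "partial_deriv j f x = D j"
proof -
  have "partial_deriv j f x = (\<Sum>i\<in>UNIV. D i * (axis j 1 :: real^'a) $ i)"
    unfolding partial_deriv_def using frechet_derivative_at[OF assms, symmetric] by simp
  also have "\<dots> = (\<Sum>i\<in>UNIV. if i = j then D i else 0)"
    by (intro sum.cong) (auto simp: axis_def)
  finally show ?thesis by simp
qed

lemma smooth_alg_deriv:
  "f \<in> smooth_alg \<Longrightarrow>
    \<exists>D. (\<forall>i. D i \<in> smooth_alg) \<and> (\<forall>x. (f has_derivative (\<lambda>v. \<Sum>i\<in>UNIV. D i x * v $ i)) (at x))"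
proof (induction rule: smooth_alg.induct)
  case (const c)
  show ?case
    by (rule exI[of _ "\<lambda>i x. 0"]) (auto intro: smooth_alg.intros)
next
  case (coord j)
  show ?case
  proof (intro exI[of _ "\<lambda>i x. if i = j then 1 else 0"] conjI allI)
    fix i :: 'a show "(\<lambda>x. if i = j then 1 else 0) \<in> smooth_alg"
      by (cases "i = j") (auto intro: smooth_alg.intros)
  next
    fix x :: "real^'a"
    have "(\<lambda>v::real^'a. \<Sum>i\<in>UNIV. (if i = j then 1 else 0) * v $ i) = (\<lambda>v. v $ j)"
      by (auto intro!: ext simp: if_distrib[where f = "\<lambda>c. c * _"] cong: if_cong)
    then show "((\<lambda>x. x $ j) has_derivative (\<lambda>v. \<Sum>i\<in>UNIV. (if i = j then 1 else 0) * v $ i)) (at x)"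
      by (simp add: bounded_linear.has_derivative[OF bounded_linear_vec_nth])
  qed
next
  case (bump k \<alpha> j \<beta>)
  let ?d = "\<lambda>x::real^'a. \<alpha> * (bump (k + 2) (\<alpha> * x $ j + \<beta>) + (- real k) * bump (k + 1) (\<alpha> * x $ j + \<beta>))"
  have mem: "?d \<in> smooth_alg"
    by (intro smooth_alg.intros)
  show ?case
  proof (intro exI[of _ "\<lambda>i x. if i = j then ?d x else 0"] conjI allI)
    fix i :: 'a show "(\<lambda>x. if i = j then ?d x else 0) \<in> smooth_alg"
      using mem by (cases "i = j") (auto intro: smooth_alg.intros)
  next
    fix x :: "real^'a"
    have eq: "(\<lambda>v::real^'a. \<Sum>i\<in>UNIV. (if i = j then ?d x else 0) * v $ i) = (\<lambda>v. ?d x * v $ j)"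
      by (auto intro!: ext simp: if_distrib[where f = "\<lambda>c. c * _"] cong: if_cong)
    have "((\<lambda>x. \<alpha> * x $ j + \<beta>) has_derivative (\<lambda>v. \<alpha> * v $ j)) (at x)"
      by (auto intro!: derivative_eq_intros bounded_linear.has_derivative[OF bounded_linear_vec_nth])
    from has_derivative_compose[OF this bump_has_deriv[of k, unfolded has_field_derivative_def]]
    have "((\<lambda>x. bump k (\<alpha> * x $ j + \<beta>)) has_derivative
       (\<lambda>v. (bump (k + 2) (\<alpha> * x $ j + \<beta>) - real k * bump (k + 1) (\<alpha> * x $ j + \<beta>)) * (\<alpha> * v $ j))) (at x)"
      .
    then show "((\<lambda>x. bump k (\<alpha> * x $ j + \<beta>)) has_derivative
        (\<lambda>v. \<Sum>i\<in>UNIV. (if i = j then ?d x else 0) * v $ i)) (at x)"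
      unfolding eq by (simp add: mult_ac)
  qed
next
  case (add f g)
  then obtain Df Dg where D: "\<And>i. Df i \<in> smooth_alg" "\<And>i. Dg i \<in> smooth_alg"
    "\<And>x. (f has_derivative (\<lambda>v. \<Sum>i\<in>UNIV. Df i x * v $ i)) (at x)"
    "\<And>x. (g has_derivative (\<lambda>v. \<Sum>i\<in>UNIV. Dg i x * v $ i)) (at x)" by blast
  show ?case
  proof (intro exI[of _ "\<lambda>i x. Df i x + Dg i x"] conjI allI)
    fix x
    show "((\<lambda>x. f x + g x) has_derivative (\<lambda>v. \<Sum>i\<in>UNIV. (Df i x + Dg i x) * v $ i)) (at x)"
      using has_derivative_add[OF D(3)[of x] D(4)[of x]] by (simp add: sum.distrib algebra_simps)
  qed (use D in \<open>auto intro: smooth_alg.intros\<close>)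
next
  case (mult f g)
  then obtain Df Dg where D: "\<And>i. Df i \<in> smooth_alg" "\<And>i. Dg i \<in> smooth_alg"
    "\<And>x. (f has_derivative (\<lambda>v. \<Sum>i\<in>UNIV. Df i x * v $ i)) (at x)"
    "\<And>x. (g has_derivative (\<lambda>v. \<Sum>i\<in>UNIV. Dg i x * v $ i)) (at x)" by blast
  show ?case
  proof (intro exI[of _ "\<lambda>i x. f x * Dg i x + Df i x * g x"] conjI allI)
    fix x
    show "((\<lambda>x. f x * g x) has_derivative
        (\<lambda>v. \<Sum>i\<in>UNIV. (f x * Dg i x + Df i x * g x) * v $ i)) (at x)"
      using has_derivative_mult[OF D(3)[of x] D(4)[of x]]
      by (simp add: sum.distrib sum_distrib_left sum_distrib_right algebra_simps)
  next
    fix i show "(\<lambda>x. f x * Dg i x + Df i x * g x) \<in> smooth_alg"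
      by (intro smooth_alg.intros mult.hyps D)
  qed
qed

lemma smooth_alg_partial_deriv:
  assumes "f \<in> smooth_alg"
  shows "partial_deriv i f \<in> smooth_alg"
    and "(f has_derivative (\<lambda>v. \<Sum>i\<in>UNIV. partial_deriv i f x * v $ i)) (at x)"
proof -
  from smooth_alg_deriv[OF assms] obtain D where D: "\<forall>i. D i \<in> smooth_alg"
    "\<forall>x. (f has_derivative (\<lambda>v. \<Sum>i\<in>UNIV. D i x * v $ i)) (at x)" by blast
  then have "partial_deriv i f = D i" for i
    by (intro ext partial_deriv_eqI) auto
  with D show "partial_deriv i f \<in> smooth_alg"
    "(f has_derivative (\<lambda>v. \<Sum>i\<in>UNIV. partial_deriv i f x * v $ i)) (at x)" by auto
qed

lemma smooth_alg_continuous: "f \<in> smooth_alg \<Longrightarrow> continuous_on S f"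
  by (meson continuous_at_imp_continuous_on has_derivative_continuous smooth_alg_partial_deriv(2))

lemma smooth_alg_C_diff: "f \<in> smooth_alg \<Longrightarrow> C_diff k f"
proof (induction k arbitrary: f)
  case (Suc k)
  then show ?case
    using smooth_alg_partial_deriv[of f] by (auto simp: differentiable_def)
qed (simp add: smooth_alg_continuous)

lemma test_functionI:
  assumes "f \<in> smooth_alg" "\<And>x. f x \<noteq> 0 \<Longrightarrow> norm x \<le> R"
  shows "test_function f"
  unfolding test_function_def compact_closure bounded_iff
  using assms smooth_alg_C_diff by blast

text \<open>Test functions that are positive exactly on the box from \<open>l\<close> to \<open>r\<close> (for \<open>n > 0\<close>) and increase to its indicator
function as \<open>n\<close> tends to infinity.\<close>

definition box_bump :: "real^'n::finite \<Rightarrow> real^'n \<Rightarrow> nat \<Rightarrow> real^'n \<Rightarrow> real" where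
  "box_bump l r n x =
    (\<Prod>i\<in>UNIV. bump 0 (real n * (x $ i - l $ i)) * bump 0 (real n * (r $ i - x $ i)))"

lemma box_bump_smooth: "box_bump l r n \<in> smooth_alg"
proof -
  have "(\<lambda>x. \<Prod>i\<in>UNIV. bump 0 (real n * x $ i + - (real n * l $ i)) *
     bump 0 ((- real n) * x $ i + real n * r $ i)) \<in> smooth_alg"
    by (intro smooth_alg_prod smooth_alg.intros) auto
  also have "(\<lambda>x. \<Prod>i\<in>UNIV. bump 0 (real n * x $ i + - (real n * l $ i)) *
     bump 0 ((- real n) * x $ i + real n * r $ i)) = box_bump l r n"
    by (auto simp: box_bump_def fun_eq_iff algebra_simps)
  finally show ?thesis .
qed

lemma box_bump_outside: "x \<notin> box l r \<Longrightarrow> box_bump l r n x = 0"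
  unfolding box_bump_def prod_zero_iff[OF finite] mem_box_cart
  by (auto simp: bump_def zero_less_mult_iff)

lemma box_bump_bounds: "box_bump l r n x \<in> {0..1}"
  unfolding box_bump_def atLeastAtMost_iff
  by (intro conjI prod_nonneg prod_le_1) (auto simp: bump_nonneg bump_0_le_1 mult_le_one)

lemma box_bump_tendsto: "(\<lambda>n. box_bump l r n x) \<longlonglongrightarrow> indicator (box l r) x"
proof (cases "x \<in> box l r")
  case True
  then have "(\<lambda>n. box_bump l r n x) \<longlonglongrightarrow> (\<Prod>i\<in>(UNIV::'a set). 1 * 1)"
    unfolding box_bump_def by (intro tendsto_intros bump_0_tendsto) (auto simp: mem_box_cart)
  then show ?thesis using True by simp
qed (simp add: box_bump_outside)

section \<open>Dilations of Lebesgue measure and the fundamental lemma\<close>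

lemma lborel_dilate:
  fixes t :: real
  assumes "t > 0"
  shows "lborel = density (distr lborel borel ((*\<^sub>R) t :: 'a::euclidean_space \<Rightarrow> 'a)) (\<lambda>_. ennreal (t ^ DIM('a)))"
  using lborel_affine[of t "0 :: 'a"] assms by simp

lemma nn_integral_dilate:
  fixes f :: "'a::euclidean_space \<Rightarrow> ennreal"
  assumes "t > 0" and [measurable]: "f \<in> borel_measurable borel"
  shows "(\<integral>\<^sup>+x. f x \<partial>lborel) = ennreal (t ^ DIM('a)) * (\<integral>\<^sup>+x. f (t *\<^sub>R x) \<partial>lborel)"
  by (subst lborel_dilate[OF assms(1)])
    (simp add: nn_integral_density nn_integral_distr nn_integral_cmult)

lemma integral_dilate:
  fixes f :: "'a::euclidean_space \<Rightarrow> real"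
  assumes "t > 0" and [measurable]: "f \<in> borel_measurable borel"
  shows "(LBINT x. f x) = t ^ DIM('a) * (LBINT x. f (t *\<^sub>R x))"
  using assms(1) by (subst lborel_dilate[OF assms(1)]) (simp add: integral_density integral_distr)

lemma integrable_dilate_iff:
  fixes f :: "'a::euclidean_space \<Rightarrow> 'b::{banach, second_countable_topology}"
  assumes "t > 0" and [measurable]: "f \<in> borel_measurable borel"
  shows "integrable lborel (\<lambda>x. f (t *\<^sub>R x)) \<longleftrightarrow> integrable lborel f"
proof -
  have "integrable lborel f \<longleftrightarrow> integrable lborel (\<lambda>x. t ^ DIM('a) *\<^sub>R f (t *\<^sub>R x))"
    using assms(1) by (subst lborel_dilate[OF assms(1)]) (simp add: integrable_density integrable_distr_eq)
  also have "\<dots> \<longleftrightarrow> integrable lborel (\<lambda>x. f (t *\<^sub>R x))"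
  proof
    assume "integrable lborel (\<lambda>x. t ^ DIM('a) *\<^sub>R f (t *\<^sub>R x))"
    then have "integrable lborel (\<lambda>x. inverse (t ^ DIM('a)) *\<^sub>R (t ^ DIM('a) *\<^sub>R f (t *\<^sub>R x)))"
      by (rule integrable_scaleR_right)
    then show "integrable lborel (\<lambda>x. f (t *\<^sub>R x))"
      using assms(1) by simp
  qed (rule integrable_scaleR_right)
  finally show ?thesis ..
qed

lemma AE_dilate:
  fixes P :: "'a::euclidean_space \<Rightarrow> bool"
  assumes "t > 0" and ae: "AE x in lborel. P x"
  shows "AE x in lborel. P (t *\<^sub>R x)"
proof -
  have "AE x in distr lborel borel ((*\<^sub>R) t :: 'a \<Rightarrow> 'a). P x"
    using ae assms(1) by (subst (asm) lborel_dilate[OF assms(1)]) (simp add: AE_density)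
  then show ?thesis
    by (rule AE_distrD[rotated]) simp
qed

text \<open>Local integrability for Borel functions and the Lebesgue-Borel measure; it suffices to consider balls
around the origin. See \<open>locally_integrable_borel_iff\<close> for the relation to \<open>locally_integrable\<close>.\<close>

definition loc_int :: "('a::euclidean_space \<Rightarrow> 'b::{banach, second_countable_topology}) \<Rightarrow> bool" where
  "loc_int g \<longleftrightarrow> (\<forall>R. set_integrable lborel (cball 0 R) g)"

lemma measurable_of_cballs:
  fixes g :: "'a::euclidean_space \<Rightarrow> 'b::{banach, second_countable_topology}"
  assumes "\<And>n. (\<lambda>x. indicator (cball 0 (real n)) x *\<^sub>R g x) \<in> borel_measurable M"
  shows "g \<in> borel_measurable M"
  using assms
proof (rule borel_measurable_LIMSEQ_metric)
  fix x :: 'a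
  have "\<forall>\<^sub>F n in sequentially. g x = indicator (cball 0 (real n)) x *\<^sub>R g x"
    using eventually_ge_at_top[of "nat \<lceil>norm x\<rceil>"]
    by eventually_elim (auto simp: indicator_def nat_ceiling_le_eq)
  then show "(\<lambda>n. indicator (cball 0 (real n)) x *\<^sub>R g x) \<longlonglongrightarrow> g x"
    by (rule Lim_transform_eventually[OF tendsto_const])
qed

lemma loc_int_measurable: "loc_int g \<Longrightarrow> g \<in> borel_measurable borel"
  by (rule measurable_of_cballs)
    (simp add: loc_int_def set_integrable_def borel_measurable_integrable[where M = lborel, simplified])

lemma loc_int_scaleR_bounded:
  fixes g :: "'a::euclidean_space \<Rightarrow> 'b::{banach, second_countable_topology}"
  assumes "loc_int g" and [measurable]: "c \<in> borel_measurable borel"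
    and "\<And>x. \<bar>c x\<bar> \<le> B" "\<And>x. c x \<noteq> 0 \<Longrightarrow> norm x \<le> R"
  shows "integrable lborel (\<lambda>x. c x *\<^sub>R g x)"
proof (rule Bochner_Integration.integrable_bound)
  show "integrable lborel (\<lambda>x. B *\<^sub>R (indicator (cball 0 R) x *\<^sub>R g x))"
    using assms(1) by (intro integrable_scaleR_right) (auto simp: loc_int_def set_integrable_def)
  show "(\<lambda>x. c x *\<^sub>R g x) \<in> borel_measurable lborel"
    using loc_int_measurable[OF assms(1)] by simp
  have "norm (c x *\<^sub>R g x) \<le> norm (B *\<^sub>R (indicator (cball 0 R) x *\<^sub>R g x))" for x
  proof (cases "c x = 0")
    case False
    then have "norm x \<le> R" "\<bar>c x\<bar> \<le> \<bar>B\<bar>" using assms(3)[of x] assms(4) by auto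
    then show ?thesis by (auto intro!: mult_right_mono)
  qed auto
  then show "AE x in lborel. norm (c x *\<^sub>R g x) \<le> norm (B *\<^sub>R (indicator (cball 0 R) x *\<^sub>R g x))"
    by simp
qed

lemma loc_int_diff: "loc_int f \<Longrightarrow> loc_int g \<Longrightarrow> loc_int (\<lambda>x. f x - g x)"
  unfolding loc_int_def by (auto intro: set_integral_diff)

lemma smooth_alg_measurable: "f \<in> smooth_alg \<Longrightarrow> f \<in> borel_measurable borel"
  by (intro borel_measurable_continuous_onI smooth_alg_continuous)

lemma box_bump_support:
  "\<exists>R>0. \<forall>n x. box_bump l r n x \<noteq> 0 \<longrightarrow> norm x \<le> R"
proof -
  obtain R where "R > 0" "\<And>x. x \<in> box l r \<Longrightarrow> norm x \<le> R"
    using bounded_box[of l r] unfolding bounded_pos by blast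
  then show ?thesis using box_bump_outside by blast
qed

text \<open>The fundamental lemma of the calculus of variations: the integrals of \<open>g\<close> over all boxes vanish by
dominated convergence, so the positive and the negative part of \<open>g\<close> are densities of the same measure.\<close>

lemma AE_zero_of_box_bumps:
  fixes g :: "real^'n::finite \<Rightarrow> real"
  assumes g: "loc_int g"
    and 0: "\<And>l r n. (LBINT x. box_bump l r n x * g x) = 0"
  shows "AE x in lborel. g x = 0"
proof -
  note [measurable] = loc_int_measurable[OF g] smooth_alg_measurable[OF box_bump_smooth]
  have box_int: "integrable lborel (\<lambda>x. indicator (box l r) x * g x)" for l r
  proof -
    obtain R where R: "\<And>x. x \<in> box l r \<Longrightarrow> norm x \<le> R"
      using bounded_box[of l r] unfolding bounded_pos by blast
    show ?thesis
      using loc_int_scaleR_bounded[OF g, of "indicator (box l r)" 1 R] R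
      by (auto simp: indicator_def split: if_splits)
  qed
  have box0: "(LBINT x. indicator (box l r) x * g x) = 0" for l r
  proof -
    have "(\<lambda>n. \<integral>x. box_bump l r n x * g x \<partial>lborel) \<longlonglongrightarrow> (LBINT x. indicator (box l r) x * g x)"
    proof (rule integral_dominated_convergence)
      show "integrable lborel (\<lambda>x. \<bar>indicator (box l r) x * g x\<bar>)"
        using box_int by (rule integrable_abs)
      show "AE x in lborel. (\<lambda>n. box_bump l r n x * g x) \<longlonglongrightarrow> indicator (box l r) x * g x"
        by (intro AE_I2 tendsto_mult_right box_bump_tendsto)
      show "AE x in lborel. norm (box_bump l r n x * g x) \<le> \<bar>indicator (box l r) x * g x\<bar>" for n
      proof (intro AE_I2)
        fix x
        show "norm (box_bump l r n x * g x) \<le> \<bar>indicator (box l r) x * g x\<bar>"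
          using box_bump_bounds[of l r n x] box_bump_outside[of x l r n]
          by (auto simp: abs_mult indicator_def mult_left_le_one_le)
      qed
    qed simp_all
    then show ?thesis using 0 by (simp add: LIMSEQ_const_iff)
  qed
  have eq_box: "(\<integral>\<^sup>+x. ennreal (g x) * indicator (box l r) x \<partial>lborel)
      = (\<integral>\<^sup>+x. ennreal (- g x) * indicator (box l r) x \<partial>lborel)"
    and fin_box: "(\<integral>\<^sup>+x. ennreal (g x) * indicator (box l r) x \<partial>lborel) \<noteq> \<infinity>" for l r
  proof -
    have *: "(\<integral>\<^sup>+x. ennreal (s * g x) * indicator (box l r) x \<partial>lborel)
        = ennreal (LBINT x. max 0 (indicator (box l r) x * (s * g x)))" for s
    proof -
      have "integrable lborel (\<lambda>x. max 0 (indicator (box l r) x * (s * g x)))"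
        using box_int[of l r] by (intro integrable_max) (auto simp: mult.left_commute)
      then show ?thesis
        by (subst nn_integral_eq_integral[symmetric])
          (auto intro!: nn_integral_cong simp: indicator_def max_def ennreal_neg)
    qed
    let ?p = "\<lambda>s::real. \<integral>x. max 0 (indicator (box l r) x * (s * g x)) \<partial>lborel"
    have "?p 1 - ?p (-1) = (LBINT x. indicator (box l r) x * g x)"
    proof -
      have "integrable lborel (\<lambda>x. max 0 (indicator (box l r) x * (s * g x)))" for s
        using box_int[of l r] by (intro integrable_max) (auto simp: mult.left_commute)
      from Bochner_Integration.integral_diff[OF this this, of 1 "-1"]
      have "?p 1 - ?p (-1) = (LBINT x. max 0 (indicator (box l r) x * (1 * g x)) -
          max 0 (indicator (box l r) x * (-1 * g x)))"
        by simp
      also have "\<dots> = (LBINT x. indicator (box l r) x * g x)"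
        by (rule Bochner_Integration.integral_cong) (auto simp: max_def)
      finally show ?thesis .
    qed
    then show "(\<integral>\<^sup>+x. ennreal (g x) * indicator (box l r) x \<partial>lborel)
      = (\<integral>\<^sup>+x. ennreal (- g x) * indicator (box l r) x \<partial>lborel)"
      "(\<integral>\<^sup>+x. ennreal (g x) * indicator (box l r) x \<partial>lborel) \<noteq> \<infinity>"
      using *[of 1] *[of "-1"] box0[of l r] by auto
  qed
  have "density lborel (\<lambda>x. ennreal (g x)) = density lborel (\<lambda>x. ennreal (- g x))"
  proof (rule measure_eqI_generator_eq)
    let ?E = "range (\<lambda>(a, b). box a b :: (real^'n) set)"
    show "Int_stable ?E"
      by (auto simp: Int_stable_def box_Int_box)
    show "?E \<subseteq> Pow UNIV" "sets (density lborel (\<lambda>x. ennreal (g x))) = sigma_sets UNIV ?E"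
      "sets (density lborel (\<lambda>x. ennreal (- g x))) = sigma_sets UNIV ?E"
      by (simp_all add: borel_eq_box)
    let ?A = "\<lambda>n::nat. box (- (real n *\<^sub>R One)) (real n *\<^sub>R One) :: (real^'n) set"
    show "range ?A \<subseteq> ?E" "(\<Union>i. ?A i) = UNIV"
      unfolding UN_box_eq_UNIV by auto
    show "emeasure (density lborel (\<lambda>x. ennreal (g x))) (?A i) \<noteq> \<infinity>" for i
      using fin_box by (simp add: emeasure_density)
    show "emeasure (density lborel (\<lambda>x. ennreal (g x))) X = emeasure (density lborel (\<lambda>x. ennreal (- g x))) X"
      if "X \<in> ?E" for X
      using that eq_box by (auto simp: emeasure_density)
  qed
  then have "AE x in lborel. ennreal (g x) = ennreal (- g x)"
    by (rule sigma_finite_measure.density_unique[OF sigma_finite_lborel, rotated 2]) simp_all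
  then show ?thesis
  proof eventually_elim
    case (elim x)
    then show ?case
      using ennreal_neg[of "g x"] ennreal_neg[of "- g x"] ennreal_eq_0_iff[of "g x"] ennreal_eq_0_iff[of "- g x"]
      by (cases "g x \<le> 0") auto
  qed
qed

lemma lebesgue_ex_borel_real:
  fixes u :: "'a::euclidean_space \<Rightarrow> real"
  assumes "u \<in> borel_measurable lebesgue"
  obtains v where "v \<in> borel_measurable borel" "AE x in lebesgue. u x = v x"
  using completion_ex_borel_measurable_real[of u lborel] assms AE_completion by fastforce

lemma lebesgue_ex_borel_vec:
  fixes G :: "'a::euclidean_space \<Rightarrow> real^'n::finite"
  assumes "G \<in> borel_measurable lebesgue"
  obtains H where "H \<in> borel_measurable borel" "AE x in lebesgue. G x = H x"
proof -
  have "\<exists>h. h \<in> borel_measurable borel \<and> (AE x in lebesgue. G x $ i = h x)" for i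
    using lebesgue_ex_borel_real[OF measurable_compose[OF assms borel_measurable_nth]] by metis
  then obtain h where h: "\<And>i. h i \<in> borel_measurable borel" "\<And>i. AE x in lebesgue. G x $ i = h i x"
    by metis
  show ?thesis
  proof
    show "(\<lambda>x. \<Sum>i\<in>UNIV. h i x *\<^sub>R (axis i 1 :: real^'n)) \<in> borel_measurable borel"
      by (rule borel_measurable_sum, rule borel_measurable_scaleR) (use h(1) in simp_all)
    have "AE x in lebesgue. \<forall>i. G x $ i = h i x"
      using h(2) by (simp add: AE_all_countable)
    then show "AE x in lebesgue. G x = (\<Sum>i\<in>UNIV. h i x *\<^sub>R (axis i 1 :: real^'n))"
      by eventually_elim (simp add: vec_eq_iff axis_def if_distrib cong: if_cong)
  qed
qed

section \<open>Weak gradients\<close>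

lemma locally_integrable_measurable:
  fixes g :: "real^'n::finite \<Rightarrow> 'b::{banach, second_countable_topology}"
  shows "locally_integrable g \<Longrightarrow> g \<in> borel_measurable lebesgue"
  by (rule measurable_of_cballs)
    (simp add: locally_integrable_def set_integrable_def borel_measurable_integrable)

lemma locally_integrable_borel_iff:
  fixes g :: "real^'n::finite \<Rightarrow> 'b::{banach, second_countable_topology}"
  assumes [measurable]: "g \<in> borel_measurable borel"
  shows "locally_integrable g \<longleftrightarrow> loc_int g"
proof -
  have *: "set_integrable lebesgue K g \<longleftrightarrow> set_integrable lborel K g" if "compact K" for K
  proof -
    have [measurable]: "K \<in> sets borel" using that by (simp add: borel_closed compact_imp_closed)
    show ?thesis unfolding set_integrable_def by (rule integrable_completion) simp
  qed
  show ?thesis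
  proof
    assume g: "loc_int g"
    show "locally_integrable g"
      unfolding locally_integrable_def
    proof (intro allI impI)
      fix K :: "(real^'n) set" assume K: "compact K"
      then obtain R where KR: "K \<subseteq> cball 0 R"
        using compact_imp_bounded[OF K] by (auto simp: bounded_iff subset_iff)
      have "set_integrable lborel (cball 0 R) g"
        using g by (simp add: loc_int_def)
      moreover have "K \<in> sets lborel"
        using K by (simp add: borel_closed compact_imp_closed)
      ultimately have "set_integrable lborel K g"
        using KR by (rule set_integrable_subset)
      then show "set_integrable lebesgue K g" using * K by simp
    qed
  qed (auto simp: locally_integrable_def loc_int_def *)
qed

lemma test_function_measurable:
  assumes "test_function \<phi>"
  shows "\<phi> \<in> borel_measurable borel" "partial_deriv i \<phi> \<in> borel_measurable borel"
proof -
  have "C_diff 0 \<phi>" "C_diff (Suc 0) \<phi>" using assms unfolding test_function_def by blast+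
  then show "\<phi> \<in> borel_measurable borel" "partial_deriv i \<phi> \<in> borel_measurable borel"
    by (auto intro: borel_measurable_continuous_onI)
qed

lemma has_weak_gradient_cong_AE:
  assumes "has_weak_gradient u G" "AE x in lebesgue. u x = u' x" "AE x in lebesgue. G x = G' x"
    and "u' \<in> borel_measurable lebesgue" "G' \<in> borel_measurable lebesgue"
  shows "has_weak_gradient u' G'"
  unfolding has_weak_gradient_def
proof (intro conjI allI impI)
  have loc: "locally_integrable u" "locally_integrable G"
    using assms(1) by (auto simp: has_weak_gradient_def)
  note [measurable] = assms(4,5) loc[THEN locally_integrable_measurable]
  have *: "set_integrable lebesgue K u \<longleftrightarrow> set_integrable lebesgue K u'"
    "set_integrable lebesgue K G \<longleftrightarrow> set_integrable lebesgue K G'" if "compact K" for K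
  proof -
    have [measurable]: "K \<in> sets lebesgue" using that by (simp add: borel_closed compact_imp_closed)
    show "set_integrable lebesgue K u \<longleftrightarrow> set_integrable lebesgue K u'"
      unfolding set_integrable_def
      by (rule integrable_cong_AE) (use assms(2) in \<open>auto elim!: eventually_mono\<close>)
    show "set_integrable lebesgue K G \<longleftrightarrow> set_integrable lebesgue K G'"
      unfolding set_integrable_def
      by (rule integrable_cong_AE) (use assms(3) in \<open>auto elim!: eventually_mono\<close>)
  qed
  show "locally_integrable u'" "locally_integrable G'"
    using loc * by (auto simp: locally_integrable_def)
  fix \<phi> :: "real^'a \<Rightarrow> real" and i assume \<phi>: "test_function \<phi>"
  have [measurable]: "\<phi> \<in> borel_measurable lebesgue" "partial_deriv i \<phi> \<in> borel_measurable lebesgue"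
    by (rule measurable_completion, simp add: test_function_measurable[OF \<phi>])+
  have [measurable]: "(\<lambda>x. G x $ i) \<in> borel_measurable lebesgue" "(\<lambda>x. G' x $ i) \<in> borel_measurable lebesgue"
    by (auto intro: measurable_compose[OF _ borel_measurable_nth])
  have "(LINT x|lebesgue. u' x * partial_deriv i \<phi> x) = (LINT x|lebesgue. u x * partial_deriv i \<phi> x)"
    by (rule integral_cong_AE) (use assms(2) in \<open>auto elim!: eventually_mono\<close>)
  also have "\<dots> = - (LINT x|lebesgue. G x $ i * \<phi> x)"
    using assms(1) \<phi> by (simp add: has_weak_gradient_def)
  also have "(LINT x|lebesgue. G x $ i * \<phi> x) = (LINT x|lebesgue. G' x $ i * \<phi> x)"
    by (rule integral_cong_AE) (use assms(3) in \<open>auto elim!: eventually_mono\<close>)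
  finally show "(LINT x|lebesgue. u' x * partial_deriv i \<phi> x) = - (LINT x|lebesgue. G' x $ i * \<phi> x)" .
qed

lemma has_weak_gradient_borel_iff:
  fixes u :: "real^'n::finite \<Rightarrow> real"
  assumes [measurable]: "u \<in> borel_measurable borel" "G \<in> borel_measurable borel"
  shows "has_weak_gradient u G \<longleftrightarrow> loc_int u \<and> loc_int G \<and>
    (\<forall>\<phi>. test_function \<phi> \<longrightarrow> (\<forall>i.
       (LBINT x. u x * partial_deriv i \<phi> x) = - (LBINT x. G x $ i * \<phi> x)))"
proof -
  have "(LINT x|lebesgue. u x * partial_deriv i \<phi> x) = (LBINT x. u x * partial_deriv i \<phi> x)"
    "(LINT x|lebesgue. G x $ i * \<phi> x) = (LBINT x. G x $ i * \<phi> x)"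
    if \<phi>: "test_function \<phi>" for \<phi> i
  proof -
    note [measurable] = test_function_measurable[OF \<phi>]
    have [measurable]: "(\<lambda>x. G x $ i) \<in> borel_measurable borel"
      by (rule measurable_compose[OF assms(2) borel_measurable_nth])
    show "(LINT x|lebesgue. u x * partial_deriv i \<phi> x) = (LBINT x. u x * partial_deriv i \<phi> x)"
      "(LINT x|lebesgue. G x $ i * \<phi> x) = (LBINT x. G x $ i * \<phi> x)"
      by (intro integral_completion; measurable)+
  qed
  then show ?thesis
    unfolding has_weak_gradient_def by (auto simp: locally_integrable_borel_iff)
qed

lemma test_function_box_bump: "test_function (box_bump l r n)"
proof -
  obtain R where "\<And>x. box_bump l r n x \<noteq> 0 \<Longrightarrow> norm x \<le> R"
    using box_bump_support[of l r] by auto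
  then show ?thesis by (rule test_functionI[OF box_bump_smooth])
qed

lemma loc_int_nth:
  fixes G :: "'a::euclidean_space \<Rightarrow> real^'n::finite"
  assumes "loc_int G" shows "loc_int (\<lambda>x. G x $ i)"
proof -
  have "integrable lborel (\<lambda>x. (indicator (cball 0 R) x *\<^sub>R G x) $ i)" for R
    using assms unfolding loc_int_def set_integrable_def
    by (intro integrable_bounded_linear[OF bounded_linear_vec_nth]) auto
  then show ?thesis by (simp add: loc_int_def set_integrable_def)
qed

lemma has_weak_gradient_unique:
  fixes u :: "real^'n::finite \<Rightarrow> real"
  assumes [measurable]: "u \<in> borel_measurable borel" "G \<in> borel_measurable borel" "H \<in> borel_measurable borel"
    and G: "has_weak_gradient u G" and H: "has_weak_gradient u H"
  shows "AE x in lborel. G x = H x"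
proof -
  have "AE x in lborel. G x $ i - H x $ i = 0" for i
  proof (rule AE_zero_of_box_bumps)
    have loc: "loc_int (\<lambda>x. G x $ i)" "loc_int (\<lambda>x. H x $ i)"
      using G H by (auto simp: has_weak_gradient_borel_iff intro: loc_int_nth)
    then show "loc_int (\<lambda>x. G x $ i - H x $ i)"
      by (rule loc_int_diff)
    fix l r :: "real^'n" and n
    obtain R where R: "\<And>x. box_bump l r n x \<noteq> 0 \<Longrightarrow> norm x \<le> R"
      using box_bump_support[of l r] by blast
    have int: "integrable lborel (\<lambda>x. box_bump l r n x * G x $ i)" "integrable lborel (\<lambda>x. box_bump l r n x * H x $ i)"
      using loc_int_scaleR_bounded[OF loc(1), of "box_bump l r n" 1 R] loc_int_scaleR_bounded[OF loc(2), of "box_bump l r n" 1 R]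
        R box_bump_bounds[of l r n] smooth_alg_measurable[OF box_bump_smooth[of l r n]]
      by auto
    have "(LBINT x. G x $ i * box_bump l r n x) = (LBINT x. H x $ i * box_bump l r n x)"
      using G H test_function_box_bump[of l r n] by (simp add: has_weak_gradient_borel_iff)
    then show "(LBINT x. box_bump l r n x * (G x $ i - H x $ i)) = 0"
      using int by (simp add: right_diff_distrib mult.commute)
  qed
  then have "AE x in lborel. \<forall>i. G x $ i - H x $ i = 0"
    by (simp add: AE_all_countable)
  then show ?thesis
    by eventually_elim (simp add: vec_eq_iff)
qed

lemma has_weak_gradient_weak_grad:
  "weakly_differentiable u \<Longrightarrow> has_weak_gradient u (weak_grad u)"
  unfolding weak_grad_def using someI_ex[of "has_weak_gradient u"] by (simp add: weakly_differentiable_def)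

lemma weak_grad_borel_rep:
  fixes u :: "real^'n::finite \<Rightarrow> real"
  assumes u: "u \<in> borel_measurable borel" and "weakly_differentiable u"
  obtains G where "G \<in> borel_measurable borel" "has_weak_gradient u G" "AE x in lebesgue. weak_grad u x = G x"
proof -
  have wg: "has_weak_gradient u (weak_grad u)"
    using assms(2) by (rule has_weak_gradient_weak_grad)
  then have "weak_grad u \<in> borel_measurable lebesgue"
    by (intro locally_integrable_measurable) (simp add: has_weak_gradient_def)
  then obtain G where G: "G \<in> borel_measurable borel" "AE x in lebesgue. weak_grad u x = G x"
    by (rule lebesgue_ex_borel_vec)
  moreover have "has_weak_gradient u G"
    using G u by (intro has_weak_gradient_cong_AE[OF wg]) (auto simp: measurable_completion)
  ultimately show ?thesis using that by blast
qed

text \<open>Since weak gradients are unique almost everywhere, the one selected by \<open>weak_grad\<close> may be replaced by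
any Borel weak gradient under integrals.\<close>

lemma weak_grad_AE_eq:
  fixes u :: "real^'n::finite \<Rightarrow> real"
  assumes "u \<in> borel_measurable borel" "G \<in> borel_measurable borel" "has_weak_gradient u G"
  shows "AE x in lebesgue. weak_grad u x = G x"
proof -
  obtain H where H: "H \<in> borel_measurable borel" "has_weak_gradient u H" "AE x in lebesgue. weak_grad u x = H x"
    using weak_grad_borel_rep[OF assms(1)] assms(3) unfolding weakly_differentiable_def by blast
  have "AE x in lebesgue. H x = G x"
    using has_weak_gradient_unique[OF assms(1) H(1) assms(2) H(2) assms(3)] by (rule AE_completion)
  with H(3) show ?thesis by eventually_elim simp
qed

text \<open>Functions that agree almost everywhere have the same weak gradients, so the choice operator selects
literally the same function for both.\<close>

lemma weak_grad_cong_AE: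
  assumes "AE x in lebesgue. u x = v x" "u \<in> borel_measurable lebesgue" "v \<in> borel_measurable lebesgue"
  shows "weak_grad u = weak_grad v" "weakly_differentiable u \<longleftrightarrow> weakly_differentiable v"
proof -
  have "has_weak_gradient u G \<longleftrightarrow> has_weak_gradient v G" for G
  proof
    assume G: "has_weak_gradient u G"
    then show "has_weak_gradient v G"
      by (rule has_weak_gradient_cong_AE)
        (use G assms in \<open>auto simp: has_weak_gradient_def intro: locally_integrable_measurable\<close>)
  next
    assume G: "has_weak_gradient v G"
    then show "has_weak_gradient u G"
      by (rule has_weak_gradient_cong_AE)
        (use G assms in \<open>auto simp: has_weak_gradient_def intro: locally_integrable_measurable elim!: eventually_mono\<close>)
  qed
  then show "weak_grad u = weak_grad v" "weakly_differentiable u \<longleftrightarrow> weakly_differentiable v"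
    by (auto simp: weak_grad_def weakly_differentiable_def)
qed

lemma partial_deriv_dilate:
  assumes "f differentiable (at (c *\<^sub>R x))"
  shows "partial_deriv i (\<lambda>x. d * f (c *\<^sub>R x)) x = d * c * partial_deriv i f (c *\<^sub>R x)"
    and "(\<lambda>x. d * f (c *\<^sub>R x)) differentiable (at x)"
proof -
  let ?f' = "frechet_derivative f (at (c *\<^sub>R x))"
  have f': "(f has_derivative ?f') (at (c *\<^sub>R x))"
    using assms frechet_derivative_works by blast
  have "((\<lambda>x. c *\<^sub>R x) has_derivative (\<lambda>v. c *\<^sub>R v)) (at x)"
    by (auto intro!: derivative_eq_intros)
  from has_derivative_mult_right[OF has_derivative_compose[OF this f'], of d]
  have D: "((\<lambda>x. d * f (c *\<^sub>R x)) has_derivative (\<lambda>v. d * ?f' (c *\<^sub>R v))) (at x)" .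
  then show "(\<lambda>x. d * f (c *\<^sub>R x)) differentiable (at x)"
    by (auto simp: differentiable_def)
  have "linear ?f'" using f' has_derivative_linear by blast
  then show "partial_deriv i (\<lambda>x. d * f (c *\<^sub>R x)) x = d * c * partial_deriv i f (c *\<^sub>R x)"
    unfolding partial_deriv_def frechet_derivative_at[OF D, symmetric] by (simp add: linear_cmul)
qed

lemma C_diff_dilate: "C_diff k f \<Longrightarrow> C_diff k (\<lambda>x. d * f (c *\<^sub>R x))"
proof (induction k arbitrary: f d)
  case 0
  then have "continuous_on UNIV f" by simp
  then have "continuous_on UNIV (\<lambda>x. f (c *\<^sub>R x))"
    by (rule continuous_on_compose2) (auto intro!: continuous_intros)
  then show ?case by (auto intro!: continuous_intros)
next
  case (Suc k)
  then have d: "f differentiable at x" for x by simp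
  have "partial_deriv i (\<lambda>x. d * f (c *\<^sub>R x)) = (\<lambda>x. (d * c) * partial_deriv i f (c *\<^sub>R x))" for i
    by (intro ext partial_deriv_dilate(1) d)
  then show ?case using Suc partial_deriv_dilate(2)[OF d] by simp
qed

lemma test_function_dilate:
  assumes "test_function \<phi>" "c > 0"
  shows "test_function (\<lambda>x. \<phi> (c *\<^sub>R x))"
proof -
  have "bounded {x. \<phi> x \<noteq> 0}"
    using assms(1) unfolding test_function_def compact_closure by blast
  then obtain R where "\<And>x. \<phi> x \<noteq> 0 \<Longrightarrow> norm x \<le> R"
    unfolding bounded_iff by blast
  then have "\<And>x. \<phi> (c *\<^sub>R x) \<noteq> 0 \<Longrightarrow> norm x \<le> R / c"
    using assms(2) by (fastforce simp: field_simps)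
  then have "bounded {x. \<phi> (c *\<^sub>R x) \<noteq> 0}"
    unfolding bounded_iff by blast
  moreover have "C_diff k (\<lambda>x. \<phi> (c *\<^sub>R x))" for k
    using C_diff_dilate[of k \<phi> 1 c] assms(1) by (simp add: test_function_def)
  ultimately show ?thesis unfolding test_function_def compact_closure by blast
qed

lemma loc_int_dilate:
  fixes g :: "'a::euclidean_space \<Rightarrow> 'b::{banach, second_countable_topology}"
  assumes g: "loc_int g" and t: "t > 0"
  shows "loc_int (\<lambda>x. k *\<^sub>R g (t *\<^sub>R x))"
  unfolding loc_int_def set_integrable_def
proof
  fix R
  note [measurable] = loc_int_measurable[OF g]
  have "integrable lborel (\<lambda>x. indicator (cball 0 (t * R)) x *\<^sub>R g x)"
    using g by (simp add: loc_int_def set_integrable_def)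
  then have "integrable lborel (\<lambda>x. indicator (cball 0 (t * R)) (t *\<^sub>R x) *\<^sub>R g (t *\<^sub>R x))"
    by (subst integrable_dilate_iff[OF t]) auto
  moreover have "indicator (cball 0 (t * R)) (t *\<^sub>R x) = (indicator (cball 0 R) x :: real)" for x :: 'a
    using t by (auto simp: indicator_def)
  ultimately have "integrable lborel (\<lambda>x. k *\<^sub>R (indicator (cball 0 R) x *\<^sub>R g (t *\<^sub>R x)))"
    by (intro integrable_scaleR_right) simp
  then show "integrable lborel (\<lambda>x. indicator (cball 0 R) x *\<^sub>R k *\<^sub>R g (t *\<^sub>R x))"
    by (simp add: mult.commute)
qed

lemma has_weak_gradient_dilate:
  fixes u :: "real^'n::finite \<Rightarrow> real"
  assumes [measurable]: "u \<in> borel_measurable borel" "G \<in> borel_measurable borel"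
    and G: "has_weak_gradient u G" and t: "t > 0"
  shows "has_weak_gradient (\<lambda>x. k * u (t *\<^sub>R x)) (\<lambda>x. (k * t) *\<^sub>R G (t *\<^sub>R x))"
proof -
  have loc: "loc_int u" "loc_int G"
    and eq: "\<And>\<phi> i. test_function \<phi> \<Longrightarrow>
       (LBINT x. u x * partial_deriv i \<phi> x) = - (LBINT x. G x $ i * \<phi> x)"
    using G by (auto simp: has_weak_gradient_borel_iff)
  have "(LBINT x. k * u (t *\<^sub>R x) * partial_deriv i \<phi> x)
      = - (LBINT x. ((k * t) *\<^sub>R G (t *\<^sub>R x)) $ i * \<phi> x)" if \<phi>: "test_function \<phi>" for \<phi> i
  proof -
    define \<psi> where "\<psi> = (\<lambda>y. \<phi> ((1 / t) *\<^sub>R y))"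
    have \<psi>: "test_function \<psi>"
      unfolding \<psi>_def using \<phi> t by (intro test_function_dilate) auto
    note [measurable] = test_function_measurable[OF \<phi>] test_function_measurable[OF \<psi>]
    have [measurable]: "(\<lambda>x. G x $ i) \<in> borel_measurable borel"
      by (rule measurable_compose[OF assms(2) borel_measurable_nth])
    have "C_diff (Suc 0) \<phi>" using \<phi> unfolding test_function_def by blast
    then have "\<phi> differentiable at x" for x by simp
    then have d\<psi>: "partial_deriv i \<psi> (t *\<^sub>R x) = (1 / t) * partial_deriv i \<phi> x" for x
      using partial_deriv_dilate(1)[of \<phi> "1 / t" "t *\<^sub>R x" i 1] t by (simp add: \<psi>_def)
    have scaled: "t ^ CARD('n) * (LBINT x. u (t *\<^sub>R x) * partial_deriv i \<psi> (t *\<^sub>R x))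
      = t ^ CARD('n) * - (LBINT x. G (t *\<^sub>R x) $ i * \<psi> (t *\<^sub>R x))"
      using eq[OF \<psi>, of i] integral_dilate[OF t, of "\<lambda>x. u x * partial_deriv i \<psi> x"]
        integral_dilate[OF t, of "\<lambda>x. G x $ i * \<psi> x"] by simp
    have *: "(LBINT x. u (t *\<^sub>R x) * partial_deriv i \<psi> (t *\<^sub>R x))
      = - (LBINT x. G (t *\<^sub>R x) $ i * \<psi> (t *\<^sub>R x))"
      using mult_left_cancel[THEN iffD1, OF _ scaled] t by simp
    have "(LBINT x. k * u (t *\<^sub>R x) * partial_deriv i \<phi> x)
        = (LBINT x. (k * t) * (u (t *\<^sub>R x) * partial_deriv i \<psi> (t *\<^sub>R x)))"
      using t by (intro Bochner_Integration.integral_cong) (auto simp: d\<psi>)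
    also have "\<dots> = - (LBINT x. (k * t) * (G (t *\<^sub>R x) $ i * \<psi> (t *\<^sub>R x)))"
      using * by simp
    finally show ?thesis using t by (simp add: \<psi>_def mult_ac)
  qed
  moreover have "loc_int (\<lambda>x. k * u (t *\<^sub>R x))"
    using loc_int_dilate[OF loc(1) t, of k] by simp
  moreover have "loc_int (\<lambda>x. (k * t) *\<^sub>R G (t *\<^sub>R x))"
    by (rule loc_int_dilate[OF loc(2) t])
  ultimately show ?thesis
    by (subst has_weak_gradient_borel_iff) auto
qed

section \<open>Variation along rays\<close>

lemma lborel_Fubini:
  fixes f :: "'a::euclidean_space \<Rightarrow> 'b::euclidean_space \<Rightarrow> real"
  assumes [measurable]: "(\<lambda>(x, y). f x y) \<in> borel_measurable (borel \<Otimes>\<^sub>M borel)"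
    and fin: "(\<integral>\<^sup>+x. \<integral>\<^sup>+y. ennreal \<bar>f x y\<bar> \<partial>lborel \<partial>lborel) < \<infinity>"
  shows "(LBINT x. LBINT y. f x y) = (LBINT y. LBINT x. f x y)"
    and "integrable lborel (\<lambda>y. \<integral>x. f x y \<partial>lborel)"
proof -
  have "integrable (lborel \<Otimes>\<^sub>M lborel) (\<lambda>(x, y). f x y)"
  proof (rule integrableI_bounded)
    show "(\<integral>\<^sup>+z. ennreal (norm (case z of (x, y) \<Rightarrow> f x y)) \<partial>(lborel \<Otimes>\<^sub>M lborel)) < \<infinity>"
      using fin by (subst lborel.nn_integral_fst[symmetric]) (auto simp: split_beta')
  qed simp
  then show "(LBINT x. LBINT y. f x y) = (LBINT y. LBINT x. f x y)"
    "integrable lborel (\<lambda>y. \<integral>x. f x y \<partial>lborel)"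
    by (rule lborel_pair.Fubini_integral[symmetric], rule lborel_pair.integrable_snd)
qed

text \<open>The case \<open>f s x = \<eta> x * (x \<bullet> G (s x))\<close> of Fubini's theorem for \<open>1 \<le> s \<le> t\<close>. It also shows that
the integral of \<open>x \<bullet> G (s x)\<close> over \<open>s\<close> is locally integrable in \<open>x\<close>.\<close>

lemma ray_Fubini:
  fixes G :: "'a::euclidean_space \<Rightarrow> 'a" and \<eta> :: "'a \<Rightarrow> real" and t :: real
  assumes G: "loc_int G" and [measurable]: "\<eta> \<in> borel_measurable borel"
    and B: "\<And>x. \<bar>\<eta> x\<bar> \<le> B" and R: "\<And>x. \<eta> x \<noteq> 0 \<Longrightarrow> norm x \<le> R" and "R \<ge> 0"
  defines "f \<equiv> \<lambda>s x. indicator {1..t} s * (\<eta> x * (x \<bullet> G (s *\<^sub>R x)))"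
  shows "(LBINT s. LBINT x. f s x) = (LBINT x. LBINT s. f s x)"
    and "integrable lborel (\<lambda>x. \<integral>s. f s x \<partial>lborel)"
proof -
  note [measurable] = loc_int_measurable[OF G]
  have "B \<ge> 0" using B[of 0] by linarith
  have m: "(\<lambda>(s, x). f s x) \<in> borel_measurable (borel \<Otimes>\<^sub>M borel)"
    unfolding f_def by measurable
  have [measurable]: "cball (0::'a) r \<in> sets borel" for r by simp
  define h where "h y = ennreal (B * R * norm (indicator (cball 0 (t * R)) y *\<^sub>R G y))" for y
  have [measurable]: "h \<in> borel_measurable borel"
    unfolding h_def by measurable
  have "(\<integral>\<^sup>+y. h y \<partial>lborel) = ennreal (B * R) * (\<integral>\<^sup>+y. ennreal (norm (indicator (cball 0 (t * R)) y *\<^sub>R G y)) \<partial>lborel)"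
    unfolding h_def using \<open>B \<ge> 0\<close> \<open>R \<ge> 0\<close>
    by (subst nn_integral_cmult[symmetric]) (auto simp: ennreal_mult')
  also have "\<dots> < \<infinity>"
    using G by (auto simp: loc_int_def set_integrable_def integrable_iff_bounded ennreal_mult_less_top)
  finally have h_fin: "(\<integral>\<^sup>+y. h y \<partial>lborel) < \<infinity>" .
  have inner: "(\<integral>\<^sup>+x. ennreal \<bar>f s x\<bar> \<partial>lborel) \<le> (\<integral>\<^sup>+y. h y \<partial>lborel) * indicator {1..t} s" for s
  proof (cases "s \<in> {1..t}")
    case True
    then have s: "1 \<le> s" "s \<le> t" "s > 0" by auto
    have "(\<integral>\<^sup>+x. ennreal \<bar>f s x\<bar> \<partial>lborel) \<le> (\<integral>\<^sup>+x. h (s *\<^sub>R x) \<partial>lborel)"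
    proof (intro nn_integral_mono)
      fix x
      show "ennreal \<bar>f s x\<bar> \<le> h (s *\<^sub>R x)"
      proof (cases "\<eta> x = 0")
        case False
        then have x: "norm x \<le> R" by (rule R)
        then have "norm (s *\<^sub>R x) \<le> t * R" using s \<open>R \<ge> 0\<close> by (auto intro: mult_mono)
        moreover have "\<bar>\<eta> x * (x \<bullet> G (s *\<^sub>R x))\<bar> \<le> B * (R * norm (G (s *\<^sub>R x)))"
          unfolding abs_mult
        proof (rule mult_mono)
          show "\<bar>x \<bullet> G (s *\<^sub>R x)\<bar> \<le> R * norm (G (s *\<^sub>R x))"
            using Cauchy_Schwarz_ineq2[of x "G (s *\<^sub>R x)"] mult_right_mono[OF x norm_ge_zero, of "G (s *\<^sub>R x)"]
            by linarith
        qed (use B \<open>B \<ge> 0\<close> in auto)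
        ultimately show ?thesis
          using s by (auto simp: f_def h_def intro!: ennreal_leI)
      qed (simp add: f_def)
    qed
    also have "\<dots> \<le> ennreal (s ^ DIM('a)) * (\<integral>\<^sup>+x. h (s *\<^sub>R x) \<partial>lborel)"
      using s mult_right_mono[of 1 "ennreal (s ^ DIM('a))"] by (auto simp: one_le_power)
    also have "\<dots> = (\<integral>\<^sup>+y. h y \<partial>lborel)"
      using nn_integral_dilate[OF s(3), of h] by simp
    finally show ?thesis using True by simp
  qed (simp add: f_def)
  have "(\<integral>\<^sup>+s. \<integral>\<^sup>+x. ennreal \<bar>f s x\<bar> \<partial>lborel \<partial>lborel) \<le> (\<integral>\<^sup>+s. (\<integral>\<^sup>+y. h y \<partial>lborel) * indicator {1..t} s \<partial>lborel)"
    by (intro nn_integral_mono inner)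
  also have "\<dots> < \<infinity>"
    using h_fin by (subst nn_integral_cmult_indicator) (auto simp: ennreal_mult_less_top emeasure_lborel_Icc_eq)
  finally have "(\<integral>\<^sup>+s. \<integral>\<^sup>+x. ennreal \<bar>f s x\<bar> \<partial>lborel \<partial>lborel) < \<infinity>" .
  from lborel_Fubini[OF m this]
  show "(LBINT s. LBINT x. f s x) = (LBINT x. LBINT s. f s x)"
    and "integrable lborel (\<lambda>x. \<integral>s. f s x \<partial>lborel)" .
qed

lemma smooth_alg_sum:
  "finite I \<Longrightarrow> (\<And>i. i \<in> I \<Longrightarrow> f i \<in> smooth_alg) \<Longrightarrow> (\<lambda>x. \<Sum>i\<in>I. f i x) \<in> smooth_alg"
  by (induction I rule: finite_induct) (auto intro: smooth_alg.intros)

lemma smooth_alg_bounded: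
  assumes "f \<in> smooth_alg" and supp: "\<And>x. f x \<noteq> 0 \<Longrightarrow> norm x \<le> R"
  shows "\<exists>B\<ge>0. \<forall>x. \<bar>f x\<bar> \<le> B"
proof -
  have "compact (f ` cball 0 R)"
    by (intro compact_continuous_image smooth_alg_continuous assms compact_cball)
  then obtain B where "\<And>y. y \<in> f ` cball 0 R \<Longrightarrow> norm y \<le> B"
    using compact_imp_bounded[of "f ` cball 0 R"] by (auto simp add: bounded_iff)
  then have B: "norm z \<le> R \<Longrightarrow> \<bar>f z\<bar> \<le> B" for z by force
  have "\<bar>f z\<bar> \<le> max B 0" for z
    using B[of z] supp[of z] by (cases "f z = 0") auto
  then show ?thesis by (intro exI[of _ "max B 0"]) simp
qed

lemma partial_deriv_support:
  assumes "\<And>x. f x \<noteq> 0 \<Longrightarrow> norm x \<le> R" and "partial_deriv i f z \<noteq> 0"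
  shows "norm z \<le> R"
proof (rule ccontr)
  assume z: "\<not> norm z \<le> R"
  have "((\<lambda>_. 0) has_derivative (\<lambda>_. 0)) (at z)" by simp
  then have "(f has_derivative (\<lambda>_. 0)) (at z)"
  proof (rule has_derivative_transform_within_open)
    show "open (- cball 0 R :: (real^'a) set)" by auto
  qed (use z assms(1) in force)+
  from frechet_derivative_at[OF this, symmetric] assms(2) show False
    by (simp add: partial_deriv_def)
qed

lemma loc_int_smooth_integrable:
  fixes g :: "real^'n::finite \<Rightarrow> real"
  assumes "loc_int g" "f \<in> smooth_alg" "\<And>x. f x \<noteq> 0 \<Longrightarrow> norm x \<le> R"
  shows "integrable lborel (\<lambda>x. g x * f x)"
proof -
  obtain B where "\<And>x. \<bar>f x\<bar> \<le> B"
    using smooth_alg_bounded[OF assms(2,3)] by auto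
  from loc_int_scaleR_bounded[OF assms(1) smooth_alg_measurable[OF assms(2)] this assms(3)]
  show ?thesis by (simp add: mult.commute)
qed

text \<open>The definition of the weak gradient, tested with the functions \<open>y $ i * \<phi> (y / s)\<close> and summed over
\<open>i\<close>. The left-hand side contains the divergence of \<open>y \<phi> (y / s)\<close>.\<close>

lemma dilate_integral_deriv:
  fixes u :: "real^'n::finite \<Rightarrow> real"
  assumes [measurable]: "u \<in> borel_measurable borel" "G \<in> borel_measurable borel"
    and G: "has_weak_gradient u G" and s: "s > 0" and \<phi>: "\<phi> \<in> smooth_alg"
    and R: "\<And>x. \<phi> x \<noteq> 0 \<Longrightarrow> norm x \<le> R"
  shows "(LBINT y. u y * (real CARD('n) * \<phi> ((1/s) *\<^sub>R y) +
       (\<Sum>i\<in>UNIV. ((1/s) *\<^sub>R y) $ i * partial_deriv i \<phi> ((1/s) *\<^sub>R y))))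
    = - (s ^ (CARD('n) + 1)) * (LBINT x. \<phi> x * (x \<bullet> G (s *\<^sub>R x)))"
proof -
  have loc: "loc_int u" "loc_int G"
    and eq: "\<And>\<phi> i. test_function \<phi> \<Longrightarrow>
       (LBINT x. u x * partial_deriv i \<phi> x) = - (LBINT x. G x $ i * \<phi> x)"
    using G by (auto simp: has_weak_gradient_borel_iff)
  define \<psi> where "\<psi> = (\<lambda>y. \<phi> ((1/s) *\<^sub>R y))"
  have \<psi>: "\<psi> \<in> smooth_alg" unfolding \<psi>_def by (rule smooth_alg_dilate[OF \<phi>])
  have \<psi>_supp: "\<psi> y \<noteq> 0 \<Longrightarrow> norm y \<le> s * R" for y
    using R[of "(1/s) *\<^sub>R y"] s by (auto simp: \<psi>_def field_simps)
  have d\<psi>: "partial_deriv i \<psi> y = (1/s) * partial_deriv i \<phi> ((1/s) *\<^sub>R y)" for i y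
    using partial_deriv_dilate(1)[of \<phi> "1/s" y i 1] smooth_alg_partial_deriv(2)[OF \<phi>]
    unfolding \<psi>_def differentiable_def by auto
  define \<Psi> where "\<Psi> i y = y $ i * \<psi> y" for i y
  have \<Psi>: "\<Psi> i \<in> smooth_alg" for i
    unfolding \<Psi>_def by (intro smooth_alg.intros \<psi>)
  have \<Psi>_supp: "\<Psi> i y \<noteq> 0 \<Longrightarrow> norm y \<le> s * R" for i y
    using \<psi>_supp[of y] by (auto simp: \<Psi>_def)
  have \<Psi>_test: "test_function (\<Psi> i)" for i
    by (rule test_functionI[OF \<Psi> \<Psi>_supp])
  have d\<Psi>: "partial_deriv i (\<Psi> i) y = \<psi> y + y $ i * partial_deriv i \<psi> y" for i y
  proof -
    have "((\<lambda>y. y $ i * \<psi> y) has_derivative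
        (\<lambda>v. y $ i * (\<Sum>j\<in>UNIV. partial_deriv j \<psi> y * v $ j) + v $ i * \<psi> y)) (at y)"
      by (rule has_derivative_mult[OF bounded_linear.has_derivative[OF bounded_linear_vec_nth] smooth_alg_partial_deriv(2)[OF \<psi>]])
         (auto intro: has_derivative_ident)
    also have "(\<lambda>v. y $ i * (\<Sum>j\<in>UNIV. partial_deriv j \<psi> y * v $ j) + v $ i * \<psi> y)
      = (\<lambda>v. \<Sum>j\<in>UNIV. (y $ i * partial_deriv j \<psi> y + (if j = i then \<psi> y else 0)) * v $ j)"
      by (simp add: fun_eq_iff sum_distrib_left distrib_right sum.distrib mult.assoc if_distrib[where f = "\<lambda>c. c * _"] cong: if_cong)
    finally have "((\<lambda>y. y $ i * \<psi> y) has_derivative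
        (\<lambda>v. \<Sum>j\<in>UNIV. (y $ i * partial_deriv j \<psi> y + (if j = i then \<psi> y else 0)) * v $ j)) (at y)" .
    from partial_deriv_eqI[where D = "\<lambda>j. y $ i * partial_deriv j \<psi> y + (if j = i then \<psi> y else 0)", OF this, of i]
    show ?thesis by (simp add: \<Psi>_def[abs_def])
  qed
  have int1: "integrable lborel (\<lambda>y. u y * partial_deriv i (\<Psi> i) y)" for i
    by (rule loc_int_smooth_integrable[OF loc(1) smooth_alg_partial_deriv(1)[OF \<Psi>] partial_deriv_support])
      (use \<Psi>_supp in auto)
  have int2: "integrable lborel (\<lambda>y. G y $ i * \<Psi> i y)" for i
    by (rule loc_int_smooth_integrable[OF loc_int_nth[OF loc(2)] \<Psi> \<Psi>_supp])
  have "(LBINT y. u y * (real CARD('n) * \<phi> ((1/s) *\<^sub>R y) +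
       (\<Sum>i\<in>UNIV. ((1/s) *\<^sub>R y) $ i * partial_deriv i \<phi> ((1/s) *\<^sub>R y))))
    = (LBINT y. (\<Sum>i\<in>UNIV. u y * partial_deriv i (\<Psi> i) y))"
    using s by (intro Bochner_Integration.integral_cong)
      (simp_all only: d\<Psi> d\<psi>, simp_all add: \<psi>_def sum.distrib sum_distrib_left[symmetric])
  also have "\<dots> = (\<Sum>i\<in>UNIV. - (LBINT y. G y $ i * \<Psi> i y))"
    using int1 eq[OF \<Psi>_test] by simp
  also have "\<dots> = - (LBINT y. (\<Sum>i\<in>UNIV. G y $ i * \<Psi> i y))"
    using int2 by (simp add: sum_negf)
  also have "(LBINT y. (\<Sum>i\<in>UNIV. G y $ i * \<Psi> i y)) = (LBINT y. (y \<bullet> G y) * \<psi> y)"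
    by (intro Bochner_Integration.integral_cong)
      (auto simp: \<Psi>_def inner_vec_def sum_distrib_right sum_distrib_left mult_ac)
  also have "\<dots> = s ^ CARD('n) * (LBINT x. ((s *\<^sub>R x) \<bullet> G (s *\<^sub>R x)) * \<psi> (s *\<^sub>R x))"
    using integral_dilate[OF s, of "\<lambda>y. (y \<bullet> G y) * \<psi> y"] smooth_alg_measurable[OF \<psi>] by simp
  also have "(LBINT x. ((s *\<^sub>R x) \<bullet> G (s *\<^sub>R x)) * \<psi> (s *\<^sub>R x))
      = (LBINT x. s * (\<phi> x * (x \<bullet> G (s *\<^sub>R x))))"
    using s by (intro Bochner_Integration.integral_cong) (auto simp: \<psi>_def)
  finally show ?thesis by simp
qed

text \<open>The derivative of \<open>s \<mapsto> s ^ (- N) * \<phi> (y / s)\<close> is, up to the factor \<open>- s ^ (- N - 1)\<close>, the divergence in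
\<open>dilate_integral_deriv\<close>.\<close>

lemma dilate_deriv:
  fixes \<phi> :: "real^'n::finite \<Rightarrow> real"
  assumes \<phi>: "\<phi> \<in> smooth_alg" and s: "s > 0"
  defines "\<gamma> \<equiv> \<lambda>z. real CARD('n) * \<phi> z + (\<Sum>i\<in>UNIV. z $ i * partial_deriv i \<phi> z)"
  shows "((\<lambda>s. (1/s) ^ CARD('n) * \<phi> ((1/s) *\<^sub>R y)) has_real_derivative
    - ((1/s) ^ (CARD('n) + 1) * \<gamma> ((1/s) *\<^sub>R y))) (at s)"
proof -
  let ?N = "CARD('n)" and ?z = "(1/s) *\<^sub>R y"
  have N: "?N > 0" by simp
  have inv: "((\<lambda>s. 1/s) has_real_derivative (- ((1/s)^2))) (at s)"
    using s by (auto intro!: derivative_eq_intros simp: power2_eq_square field_simps)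
  then have "((\<lambda>s. 1/s) has_derivative ((*) (- ((1/s)^2)))) (at s)"
    by (simp add: has_field_derivative_def)
  then have "((\<lambda>s. (1/s) *\<^sub>R y) has_derivative (\<lambda>h. (- ((1/s)^2) * h) *\<^sub>R y)) (at s)"
    by (rule has_derivative_scaleR_left)
  from has_derivative_compose[OF this smooth_alg_partial_deriv(2)[OF \<phi>, of ?z]]
  have "((\<lambda>s. \<phi> ((1/s) *\<^sub>R y)) has_derivative
     (\<lambda>h. \<Sum>i\<in>UNIV. partial_deriv i \<phi> ?z * ((- ((1/s)^2) * h) *\<^sub>R y) $ i)) (at s)" .
  also have "(\<lambda>h. \<Sum>i\<in>UNIV. partial_deriv i \<phi> ?z * ((- ((1/s)^2) * h) *\<^sub>R y) $ i)
      = (\<lambda>h. (- (1/s) * (\<Sum>i\<in>UNIV. ?z $ i * partial_deriv i \<phi> ?z)) * h)"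
    by (simp add: fun_eq_iff sum_distrib_left sum_distrib_right power2_eq_square mult_ac)
  finally have d1: "((\<lambda>s. \<phi> ((1/s) *\<^sub>R y)) has_real_derivative
      - (1/s) * (\<Sum>i\<in>UNIV. ?z $ i * partial_deriv i \<phi> ?z)) (at s)"
    unfolding has_field_derivative_def .
  have d2: "((\<lambda>s. (1/s) ^ ?N) has_real_derivative (real ?N * (1/s) ^ (?N - 1) * (- ((1/s)^2)))) (at s)"
    using DERIV_power[OF inv, of ?N] by (simp add: mult_ac)
  have e: "(1/s) ^ ?N = (1/s) ^ (?N - 1) * (1/s)"
    using N by (metis Suc_diff_1 power_Suc2)
  show ?thesis
    by (rule DERIV_cong[OF DERIV_mult[OF d2 d1]])
      (simp only: \<gamma>_def power_add power_one_right e, simp add: algebra_simps power2_eq_square)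
qed

text \<open>The fundamental theorem of calculus along rays. Integrated against a test function \<open>\<phi>\<close>, the left-hand
side is the integral of \<open>u y * (t ^ (- N) * \<phi> (y / t) - \<phi> y)\<close>; the bracket is the integral of its
derivative in the dilation parameter, which \<open>dilate_integral_deriv\<close> turns into the right-hand side.\<close>

lemma ray_identity:
  fixes u :: "real^'n::finite \<Rightarrow> real"
  assumes [measurable]: "u \<in> borel_measurable borel" "G \<in> borel_measurable borel"
    and G: "has_weak_gradient u G" and t: "t \<ge> 1"
  shows "AE x in lborel. u (t *\<^sub>R x) - u x = (LBINT s. indicator {1..t} s * (x \<bullet> G (s *\<^sub>R x)))"
proof -
  let ?N = "CARD('n)"
  have loc: "loc_int u" "loc_int G"
    using G by (auto simp: has_weak_gradient_borel_iff)
  define J where "J x = (LBINT s. indicator {1..t} s * (x \<bullet> G (s *\<^sub>R x)))" for x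
  have [measurable]: "J \<in> borel_measurable borel"
    unfolding J_def by measurable
  have J_mult: "(LBINT s. indicator {1..t} s * (c * (x \<bullet> G (s *\<^sub>R x)))) = c * J x" for c x
    unfolding J_def by (subst integral_mult_right_zero[symmetric]) (simp add: mult_ac)
  have J_loc: "loc_int J"
    unfolding loc_int_def set_integrable_def
  proof
    fix R :: real
    have "integrable lborel (\<lambda>x::real^'n. indicator (cball 0 (max R 0)) x * J x)"
      unfolding J_mult[symmetric]
      by (rule ray_Fubini(2)[OF loc(2), where B = 1 and R = "max R 0"]) (auto simp: indicator_def split: if_splits)
    then show "integrable lborel (\<lambda>x::real^'n. indicator (cball 0 R) x *\<^sub>R J x)"
      by (cases "R \<ge> 0") (auto simp: max_def)
  qed
  have ut_loc: "loc_int (\<lambda>x. u (t *\<^sub>R x))"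
    using loc_int_dilate[OF loc(1), of t 1] t by simp
  have "AE x in lborel. u (t *\<^sub>R x) - u x - J x = 0"
  proof (rule AE_zero_of_box_bumps)
    show "loc_int (\<lambda>x. u (t *\<^sub>R x) - u x - J x)"
      by (intro loc_int_diff ut_loc loc J_loc)
    fix l r :: "real^'n" and n
    define \<phi> where "\<phi> = box_bump l r n"
    have \<phi>: "\<phi> \<in> smooth_alg" by (simp add: \<phi>_def box_bump_smooth)
    obtain R where "R > 0" and R: "\<And>x. \<phi> x \<noteq> 0 \<Longrightarrow> norm x \<le> R"
      using box_bump_support[of l r] unfolding \<phi>_def by auto
    define \<gamma> where "\<gamma> z = real ?N * \<phi> z + (\<Sum>i\<in>UNIV. z $ i * partial_deriv i \<phi> z)" for z
    have \<gamma>: "\<gamma> \<in> smooth_alg"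
      unfolding \<gamma>_def by (intro smooth_alg.intros smooth_alg_sum \<phi> smooth_alg_partial_deriv(1)) auto
    have \<gamma>_supp: "norm z \<le> R" if "\<gamma> z \<noteq> 0" for z
    proof (rule ccontr)
      assume "\<not> norm z \<le> R"
      then have "\<phi> z = 0" "\<And>i. partial_deriv i \<phi> z = 0"
        using R partial_deriv_support[of \<phi> R _ z] by blast+
      then show False using that by (simp add: \<gamma>_def)
    qed
    obtain B where B: "B \<ge> 0" "\<And>z. \<bar>\<gamma> z\<bar> \<le> B"
      using smooth_alg_bounded[OF \<gamma> \<gamma>_supp] by auto
    note [measurable] = smooth_alg_measurable[OF \<phi>] smooth_alg_measurable[OF \<gamma>]
    \<comment> \<open>\<open>c s y\<close> is the derivative of \<open>(1/s) ^ N * \<phi> (y / s)\<close> with respect to \<open>s\<close>.\<close>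
    define c where "c s y = - ((1/s) ^ (?N + 1) * \<gamma> ((1/s) *\<^sub>R y))" for s y
    let ?\<phi> = "\<lambda>s y. (1/s) ^ ?N * \<phi> ((1/s) *\<^sub>R y)"
    let ?w = "\<lambda>s x. \<phi> x * (x \<bullet> G (s *\<^sub>R x))"
    let ?b = "\<lambda>y. norm (indicator (cball 0 (t * R)) y *\<^sub>R u y)"
    have c_deriv: "((\<lambda>s. (1/s) ^ ?N * \<phi> ((1/s) *\<^sub>R y)) has_real_derivative c s y) (at s)" if "s > 0" for s y
      using dilate_deriv[OF \<phi> that, of y] by (simp add: c_def \<gamma>_def)
    have c_bound: "\<bar>c s y\<bar> \<le> B * indicator (cball 0 (t * R)) y" if s: "s \<in> {1..t}" for s y
    proof (cases "\<gamma> ((1/s) *\<^sub>R y) = 0")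
      case False
      then have "norm ((1/s) *\<^sub>R y) \<le> R" by (rule \<gamma>_supp)
      then have "norm y \<le> s * R" using s by (auto simp: field_simps)
      also have "\<dots> \<le> t * R" using s \<open>R > 0\<close> by (auto intro: mult_right_mono)
      finally have "norm y \<le> t * R" .
      moreover have "(1/s) ^ (?N + 1) * \<bar>\<gamma> ((1/s) *\<^sub>R y)\<bar> \<le> 1 * B"
        using s B by (intro mult_mono power_le_one) auto
      ultimately show ?thesis using s by (simp add: c_def abs_mult)
    qed (use B in \<open>simp add: c_def\<close>)
    define f where "f s y = indicator {1..t} s * (u y * c s y)" for s y
    have f_meas: "(\<lambda>(s, y). f s y) \<in> borel_measurable (borel \<Otimes>\<^sub>M borel)"
      unfolding f_def c_def by measurable
    have "(\<integral>\<^sup>+s. \<integral>\<^sup>+y. ennreal \<bar>f s y\<bar> \<partial>lborel \<partial>lborel)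
      \<le> (\<integral>\<^sup>+s. (\<integral>\<^sup>+y. ennreal (B * ?b y) \<partial>lborel) * indicator {1..t} s \<partial>lborel)"
    proof (rule nn_integral_mono)
      fix s
      have "\<bar>f s y\<bar> \<le> B * ?b y" if "s \<in> {1..t}" for y
        using mult_left_mono[OF c_bound[OF that, of y], of "\<bar>u y\<bar>"] that by (simp add: f_def abs_mult mult_ac)
      then show "(\<integral>\<^sup>+y. ennreal \<bar>f s y\<bar> \<partial>lborel)
        \<le> (\<integral>\<^sup>+y. ennreal (B * ?b y) \<partial>lborel) * indicator {1..t} s"
        by (cases "s \<in> {1..t}") (auto intro!: nn_integral_mono ennreal_leI simp: f_def)
    qed
    also have "\<dots> = ennreal B * (\<integral>\<^sup>+y. ennreal (?b y) \<partial>lborel) * emeasure lborel {1..t}"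
    proof -
      have [measurable]: "cball (0::real^'n) (t * R) \<in> sets borel" by simp
      show ?thesis
        by (subst nn_integral_cmult_indicator) (use B(1) in \<open>auto simp: ennreal_mult' nn_integral_cmult\<close>)
    qed
    also have "\<dots> < \<infinity>"
      using loc(1) by (auto simp: loc_int_def set_integrable_def integrable_iff_bounded ennreal_mult_less_top emeasure_lborel_Icc_eq)
    finally have f_fin: "(\<integral>\<^sup>+s. \<integral>\<^sup>+y. ennreal \<bar>f s y\<bar> \<partial>lborel \<partial>lborel) < \<infinity>" .
    have f_s: "(LBINT s. f s y) = u y * ?\<phi> t y - u y * \<phi> y" for y
    proof -
      have cont: "continuous_on {0<..} (\<lambda>s. c s y)"
      proof -
        have "continuous_on {0<..} (\<lambda>s. \<gamma> ((1/s) *\<^sub>R y))"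
          by (rule continuous_on_compose2[OF smooth_alg_continuous[OF \<gamma>, of UNIV]]) (auto intro!: continuous_intros)
        then show ?thesis unfolding c_def by (intro continuous_intros) auto
      qed
      have "(LBINT s. c s y * indicator {1..t} s) = ?\<phi> t y - (1/1) ^ ?N * \<phi> ((1/1) *\<^sub>R y)"
        by (rule integral_FTC_Icc_real[OF t]) (use c_deriv cont in \<open>auto simp: continuous_on_eq_continuous_at\<close>)
      then have "u y * (LBINT s. c s y * indicator {1..t} s) = u y * ?\<phi> t y - u y * \<phi> y"
        by (simp add: right_diff_distrib)
      then show ?thesis
        unfolding f_def by (subst (asm) integral_mult_right_zero[symmetric]) (simp add: mult_ac)
    qed
    have f_y: "(LBINT y. f s y) = (LBINT x. indicator {1..t} s * ?w s x)" for s
    proof (cases "s \<in> {1..t}")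
      case True
      then have s: "s > 0" by auto
      have "(LBINT y. f s y) = - ((1/s) ^ (?N + 1)) * (LBINT y. u y * \<gamma> ((1/s) *\<^sub>R y))"
      proof -
        have "f s = (\<lambda>y. - ((1/s) ^ (?N + 1)) * (u y * \<gamma> ((1/s) *\<^sub>R y)))"
          using True by (simp add: f_def[abs_def] c_def fun_eq_iff)
        then show ?thesis by (simp only: integral_mult_right_zero)
      qed
      also have "(LBINT y. u y * \<gamma> ((1/s) *\<^sub>R y)) = - (s ^ (?N + 1)) * (LBINT x. ?w s x)"
        using dilate_integral_deriv[OF assms(1,2) G s \<phi> R] by (simp add: \<gamma>_def)
      also have "- ((1/s) ^ (?N + 1)) * (- (s ^ (?N + 1)) * (LBINT x. ?w s x))
          = (LBINT x. ?w s x)"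
        using s by (simp add: power_one_over)
      finally show ?thesis using True by simp
    qed (simp add: f_def)
    have \<phi>_bound: "\<bar>\<phi> x\<bar> \<le> 1" for x
      using box_bump_bounds[of l r n x] by (auto simp: \<phi>_def)
    have int_u: "integrable lborel (\<lambda>y. u y * \<phi> y)"
      by (rule loc_int_smooth_integrable[OF loc(1) \<phi> R])
    have int_ut: "integrable lborel (\<lambda>y. u (t *\<^sub>R y) * \<phi> y)"
      by (rule loc_int_smooth_integrable[OF ut_loc \<phi> R])
    have int_J: "integrable lborel (\<lambda>y. J y * \<phi> y)"
      by (rule loc_int_smooth_integrable[OF J_loc \<phi> R])
    have "(LBINT x. \<phi> x * J x) = (LBINT s. LBINT x. indicator {1..t} s * ?w s x)"
      using ray_Fubini(1)[OF loc(2) smooth_alg_measurable[OF \<phi>] \<phi>_bound R, of t] \<open>R > 0\<close> by (simp add: J_mult)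
    also have "\<dots> = (LBINT s. LBINT y. f s y)"
      by (simp add: f_y)
    also have "\<dots> = (LBINT y. LBINT s. f s y)"
      by (rule lborel_Fubini(1)[OF f_meas f_fin])
    also have "\<dots> = (LBINT y. u y * ?\<phi> t y - u y * \<phi> y)"
      by (simp add: f_s)
    also have "\<dots> = (LBINT y. u y * ?\<phi> t y) - (LBINT y. u y * \<phi> y)"
    proof (rule Bochner_Integration.integral_diff[OF _ int_u])
      have "integrable lborel (\<lambda>x. u (t *\<^sub>R x) * ((1/t) ^ ?N * \<phi> ((1/t) *\<^sub>R (t *\<^sub>R x))))"
        using integrable_mult_right[OF int_ut, of "(1/t) ^ ?N"] t by (simp add: mult_ac)
      then show "integrable lborel (\<lambda>y. u y * ?\<phi> t y)"
        using integrable_dilate_iff[of t "\<lambda>y. u y * ?\<phi> t y"] t by simp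
    qed
    also have "(LBINT y. u y * ?\<phi> t y) = (LBINT x. u (t *\<^sub>R x) * \<phi> x)"
    proof -
      have "(LBINT y. u y * ?\<phi> t y)
        = t ^ ?N * (LBINT x. u (t *\<^sub>R x) * ((1/t) ^ ?N * \<phi> ((1/t) *\<^sub>R (t *\<^sub>R x))))"
        using integral_dilate[of t "\<lambda>y. u y * ?\<phi> t y"] t by simp
      also have "\<dots> = (LBINT x. t ^ ?N * (u (t *\<^sub>R x) * ((1/t) ^ ?N * \<phi> ((1/t) *\<^sub>R (t *\<^sub>R x)))))"
        by (rule integral_mult_right_zero[symmetric])
      also have "\<dots> = (LBINT x. u (t *\<^sub>R x) * \<phi> x)"
        using t by (intro Bochner_Integration.integral_cong) (auto simp: power_one_over)
      finally show ?thesis .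
    qed
    finally show "(LBINT x. box_bump l r n x * (u (t *\<^sub>R x) - u x - J x)) = 0"
      using int_u int_ut int_J by (simp add: \<phi>_def[symmetric] right_diff_distrib mult.commute[of "\<phi> _"])
  qed
  then show ?thesis
    by eventually_elim (simp add: J_def)
qed

lemma ray_bound:
  fixes u :: "real^'n::finite \<Rightarrow> real"
  assumes "u \<in> borel_measurable borel" "G \<in> borel_measurable borel"
    and "has_weak_gradient u G" and "t \<ge> 1"
  shows "AE x in lborel. ennreal \<bar>u (t *\<^sub>R x) - u x\<bar>
      \<le> (\<integral>\<^sup>+s. indicator {1..t} s * ennreal (norm x * norm (G (s *\<^sub>R x))) \<partial>lborel)"
  using ray_identity[OF assms]
proof eventually_elim
  case (elim x)
  let ?f = "\<lambda>s. indicator {1..t} s * (x \<bullet> G (s *\<^sub>R x))"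
  have "ennreal \<bar>\<integral>s. ?f s \<partial>lborel\<bar> \<le> (\<integral>\<^sup>+s. ennreal (norm (?f s)) \<partial>lborel)"
  proof (cases "integrable lborel ?f")
    case True
    then show ?thesis using integral_norm_bound_ennreal[OF True] by simp
  qed (simp add: not_integrable_integral_eq)
  also have "\<dots> \<le> (\<integral>\<^sup>+s. indicator {1..t} s * ennreal (norm x * norm (G (s *\<^sub>R x))) \<partial>lborel)"
    by (intro nn_integral_mono) (auto simp: indicator_def intro!: ennreal_leI Cauchy_Schwarz_ineq2)
  finally show ?case using elim by simp
qed

section \<open>Decay of radial functions\<close>

abbreviation annulus :: "'a::real_normed_vector set" where
  "annulus \<equiv> {x. 1 \<le> norm x \<and> norm x \<le> 2}"

text \<open>The Dirichlet energy of a function with gradient \<open>G\<close>, as an extended real.\<close>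

abbreviation dirichlet :: "(real^'n::finite \<Rightarrow> real^'n) \<Rightarrow> ennreal" where
  "dirichlet G \<equiv> \<integral>\<^sup>+x. ennreal ((norm (G x))\<^sup>2) \<partial>lborel"

abbreviation powr_integral :: "real \<Rightarrow> (real^'n::finite \<Rightarrow> real) \<Rightarrow> ennreal" where
  "powr_integral r u \<equiv> \<integral>\<^sup>+x. ennreal (\<bar>u x\<bar> powr r) \<partial>lborel"

text \<open>The integrability condition in the definition of the space, for Borel functions.\<close>

abbreviation ball_integrable :: "real \<Rightarrow> (real^'n::finite \<Rightarrow> real) \<Rightarrow> real \<Rightarrow> bool" where
  "ball_integrable p u \<rho> \<equiv> integrable lborel (\<lambda>y. indicator {..<\<rho>} (norm y) * \<bar>u y\<bar> powr p)"

text \<open>The measure of \<open>{t > 0. 1 / t \<in> L}\<close> with respect to the dilation invariant measure \<open>dt / t\<close>. By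
invariance \<open>1 / t\<close> may be replaced by \<open>R / t\<close> for any \<open>R > 0\<close> (\<open>log_mass_dilate\<close>).\<close>

definition log_mass :: "real set \<Rightarrow> ennreal" where
  "log_mass L = (\<integral>\<^sup>+t. indicator {0<..} t * ennreal (1 / t) * indicator L (1 / t) \<partial>lborel)"

lemma log_mass_dilate:
  fixes R :: real
  assumes [measurable]: "L \<in> sets borel" and R: "R > 0"
  shows "(\<integral>\<^sup>+t. indicator {0<..} t * ennreal (1 / t) * indicator L (R / t) \<partial>lborel) = log_mass L"
proof -
  have "(\<integral>\<^sup>+t. indicator {0<..} t * ennreal (1 / t) * indicator L (R / t) \<partial>lborel)
    = ennreal R * (\<integral>\<^sup>+t. indicator {0<..} (R * t) * ennreal (1 / (R * t)) * indicator L (R / (R * t)) \<partial>lborel)"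
    by (subst nn_integral_dilate[OF R]) simp_all
  also have "\<dots> = (\<integral>\<^sup>+t. ennreal R * (indicator {0<..} (R * t) * ennreal (1 / (R * t)) * indicator L (R / (R * t))) \<partial>lborel)"
    by (rule nn_integral_cmult[symmetric]) measurable
  also have "\<dots> = log_mass L"
    unfolding log_mass_def
  proof (intro nn_integral_cong)
    fix t
    show "ennreal R * (indicator {0<..} (R * t) * ennreal (1 / (R * t)) * indicator L (R / (R * t)))
      = indicator {0<..} t * ennreal (1 / t) * indicator L (1 / t)"
    proof (cases "t > 0")
      case True
      have "ennreal R * ennreal (1 / (R * t)) = ennreal (1 / t)"
        using R True by (simp add: ennreal_mult'[symmetric])
      then show ?thesis using R True by (simp add: mult.assoc[symmetric])
    qed (use R in \<open>simp add: zero_less_mult_iff\<close>)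
  qed
  finally show ?thesis .
qed

lemma norm_vimage_borel:
  assumes "L \<in> sets borel"
  shows "{x::'a::euclidean_space. norm x \<in> L} \<in> sets borel"
  using measurable_sets[of "norm :: 'a \<Rightarrow> real" borel borel L] assms
  by (simp add: vimage_def)

text \<open>This comparison of \<open>log_mass L\<close> with the Lebesgue measure of the radial set over \<open>L\<close> takes the place of
polar coordinates. The left-hand side is the integral of \<open>1 / t\<close> over the pairs \<open>(z, t)\<close> with \<open>z\<close> in
the annulus and \<open>norm z / t \<in> L\<close>; integrating first over \<open>z = t w\<close> bounds it by the right-hand side.\<close>

lemma log_mass_le:
  fixes L :: "real set"
  assumes [measurable]: "L \<in> sets borel" and L: "L \<subseteq> {1..2}"
  shows "emeasure lborel (annulus :: 'a::euclidean_space set) * log_mass L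
    \<le> 2 ^ DIM('a) * emeasure lborel {x::'a. norm x \<in> L}"
proof -
  let ?D = "DIM('a)" and ?Z = "annulus :: 'a set"
  let ?k = "\<lambda>(z::'a) t. indicator ?Z z * (indicator {0<..} t * ennreal (1 / t) * indicator L (norm z / t))"
  let ?l = "\<lambda>(w::'a) t. indicator {0<..} t * ennreal (t ^ ?D / t) * (indicator ?Z (t *\<^sub>R w) * indicator L (norm w))"
  have [measurable]: "?Z \<in> sets borel" by measurable
  have "emeasure lborel ?Z * log_mass L
      = (\<integral>\<^sup>+(z::'a). indicator ?Z z * log_mass L \<partial>lborel)"
    by (subst nn_integral_multc) simp_all
  also have "\<dots> = (\<integral>\<^sup>+(z::'a). \<integral>\<^sup>+t. ?k z t \<partial>lborel \<partial>lborel)"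
  proof (intro nn_integral_cong)
    fix z :: 'a
    show "indicator ?Z z * log_mass L
      = (\<integral>\<^sup>+t. ?k z t \<partial>lborel)"
    proof (cases "z \<in> ?Z")
      case True
      then have z0: "norm z > 0" by auto
      show ?thesis using log_mass_dilate[OF assms(1) z0] True by simp
    qed simp
  qed
  also have "\<dots> = (\<integral>\<^sup>+t. \<integral>\<^sup>+(z::'a). ?k z t \<partial>lborel \<partial>lborel)"
    by (rule lborel_pair.Fubini') measurable
  also have "\<dots> = (\<integral>\<^sup>+t. \<integral>\<^sup>+(w::'a). ?l w t \<partial>lborel \<partial>lborel)"
  proof (rule nn_integral_cong)
    fix t :: real
    show "(\<integral>\<^sup>+(z::'a). ?k z t \<partial>lborel)
     = (\<integral>\<^sup>+(w::'a). ?l w t \<partial>lborel)"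
    proof (cases "t > 0")
      case True
      have "(\<integral>\<^sup>+(z::'a). ?k z t \<partial>lborel)
        = ennreal (t ^ ?D) * (\<integral>\<^sup>+(w::'a). ?k (t *\<^sub>R w) t \<partial>lborel)"
        by (rule nn_integral_dilate[OF True]) measurable
      also have "\<dots> = (\<integral>\<^sup>+(w::'a). ennreal (t ^ ?D) * (?k (t *\<^sub>R w) t) \<partial>lborel)"
        by (rule nn_integral_cmult[symmetric]) measurable
      also have "\<dots> = (\<integral>\<^sup>+(w::'a). ?l w t \<partial>lborel)"
      proof (intro nn_integral_cong)
        fix w :: 'a
        have "ennreal (t ^ ?D / t) = ennreal (t ^ ?D) * ennreal (1 / t)"
          using True by (simp add: ennreal_mult'[symmetric])
        then show "ennreal (t ^ ?D) * (?k (t *\<^sub>R w) t)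
          = ?l w t"
          using True by (simp add: mult_ac)
      qed
      finally show ?thesis .
    qed simp
  qed
  also have "\<dots> = (\<integral>\<^sup>+(w::'a). \<integral>\<^sup>+t. ?l w t \<partial>lborel \<partial>lborel)"
    by (rule lborel_pair.Fubini') measurable
  also have "\<dots> \<le> (\<integral>\<^sup>+(w::'a). \<integral>\<^sup>+t. indicator L (norm w) * (ennreal (2 ^ (?D - 1)) * indicator {0..2::real} t) \<partial>lborel \<partial>lborel)"
  proof (intro nn_integral_mono)
    fix w :: 'a and t :: real
    have "ennreal (t ^ ?D / t) \<le> ennreal (2 ^ (?D - 1))" "t \<le> 2"
      if "t > 0" "t *\<^sub>R w \<in> ?Z" "norm w \<in> L"
    proof -
      have "t * 1 \<le> t * norm w" using that L by (intro mult_left_mono) auto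
      also have "\<dots> \<le> 2" using that by auto
      finally show "t \<le> 2" by simp
      have "t ^ ?D / t = t ^ (?D - 1)"
        using that(1) DIM_positive[where 'a = 'a] by (simp add: power_diff)
      also have "\<dots> \<le> 2 ^ (?D - 1)"
        using that(1) \<open>t \<le> 2\<close> by (intro power_mono) auto
      finally show "ennreal (t ^ ?D / t) \<le> ennreal (2 ^ (?D - 1))" by (rule ennreal_leI)
    qed
    then show "?l w t
        \<le> indicator L (norm w) * (ennreal (2 ^ (?D - 1)) * indicator {0..2::real} t)"
      by (cases "t > 0 \<and> t *\<^sub>R w \<in> ?Z \<and> norm w \<in> L") (auto simp: indicator_def)
  qed
  also have "\<dots> = (\<integral>\<^sup>+(w::'a). 2 ^ ?D * indicator {x::'a. norm x \<in> L} w \<partial>lborel)"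
  proof (intro nn_integral_cong)
    fix w :: 'a
    have "(2::ennreal) ^ ?D = ennreal (2 ^ (?D - 1)) * 2"
      using power_Suc2[of "2::ennreal" "?D - 1"] DIM_positive[where 'a = 'a]
      by (simp add: ennreal_power[symmetric] del: ennreal_power)
    then show "(\<integral>\<^sup>+t. indicator L (norm w) * (ennreal (2 ^ (?D - 1)) * indicator {0..2::real} t) \<partial>lborel)
       = 2 ^ ?D * indicator {x::'a. norm x \<in> L} w"
      by (cases "norm w \<in> L") (auto simp: nn_integral_cmult)
  qed
  also have "\<dots> = 2 ^ ?D * emeasure lborel {x::'a. norm x \<in> L}"
    using norm_vimage_borel[OF assms(1), where 'a = 'a] by (subst nn_integral_cmult_indicator) simp_all
  finally show ?thesis .
qed

text \<open>For every \<open>t\<close> between 1 and 2, \<open>\<bar>u x\<bar>\<close> is at most \<open>\<bar>u (t x)\<bar>\<close> plus an integral of \<open>G\<close> along the ray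
through \<open>x\<close>. Averaging over \<open>t\<close> spreads the thin radial set over the ball of radius 4, with a factor
proportional to its measure.\<close>

lemma radial_set_integral_le:
  fixes u :: "real^'n::finite \<Rightarrow> real"
  assumes [measurable]: "u \<in> borel_measurable borel" "G \<in> borel_measurable borel"
    and G: "has_weak_gradient u G" and [measurable]: "L \<in> sets borel" and L: "L \<subseteq> {1..2}"
  shows "(\<integral>\<^sup>+x. indicator L (norm x) * ennreal \<bar>u x\<bar> \<partial>lborel)
    \<le> 2 * log_mass L * (\<integral>\<^sup>+y. indicator (cball 0 4) y * ennreal (\<bar>u y\<bar> + 2 * norm (G y)) \<partial>lborel)"
proof -
  have [measurable]: "cball (0::real^'n) 4 \<in> sets borel" by simp
  define H where "H y = ennreal (\<bar>u y\<bar> + 2 * norm (G y))" for y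
  have [measurable]: "H \<in> borel_measurable borel" unfolding H_def by measurable
  let ?k = "\<lambda>t (y::real^'n). 2 * (indicator (cball 0 4) y * H y) * (indicator {0<..} t * ennreal (1 / t) * indicator L (norm y / t))"
  let ?U = "\<lambda>t. \<integral>\<^sup>+x. indicator L (norm x) * ennreal \<bar>u (t *\<^sub>R x)\<bar> \<partial>lborel"
  let ?U1 = "\<integral>\<^sup>+x. indicator L (norm x) * ennreal \<bar>u x\<bar> \<partial>lborel"
  let ?V = "\<lambda>t. \<integral>\<^sup>+x. indicator L (norm x) * ennreal (2 * norm (G (t *\<^sub>R x))) \<partial>lborel"
  let ?i = "\<lambda>s (x::real^'n). indicator L (norm x) * (indicator {1..2} s * ennreal (norm x * norm (G (s *\<^sub>R x))))"
  define I where "I x = (\<integral>\<^sup>+s. indicator {1..2} s * ennreal (norm x * norm (G (s *\<^sub>R x))) \<partial>lborel)" for x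
  have [measurable]: "I \<in> borel_measurable borel" unfolding I_def by measurable
  have single: "?U1
      \<le> ?U t + (\<integral>\<^sup>+x. indicator L (norm x) * I x \<partial>lborel)"
    if t: "t \<in> {1..2}" for t
  proof -
    have t1: "t \<ge> 1" using t by simp
    have "AE x in lborel. indicator L (norm x) * ennreal \<bar>u x\<bar>
        \<le> indicator L (norm x) * ennreal \<bar>u (t *\<^sub>R x)\<bar> + indicator L (norm x) * I x"
      using ray_bound[OF assms(1,2) G t1]
    proof (eventually_elim)
      case (elim x)
      then have *: "ennreal \<bar>u (t *\<^sub>R x) - u x\<bar>
         \<le> (\<integral>\<^sup>+s. indicator {1..t} s * ennreal (norm x * norm (G (s *\<^sub>R x))) \<partial>lborel)"
        by simp
      also have "\<dots> \<le> I x"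
        unfolding I_def using t by (intro nn_integral_mono mult_right_mono) (auto split: split_indicator)
      finally have "ennreal \<bar>u (t *\<^sub>R x) - u x\<bar> \<le> I x" .
      moreover have "ennreal \<bar>u x\<bar> \<le> ennreal \<bar>u (t *\<^sub>R x)\<bar> + ennreal \<bar>u (t *\<^sub>R x) - u x\<bar>"
      proof -
        have "ennreal \<bar>u x\<bar> \<le> ennreal (\<bar>u (t *\<^sub>R x)\<bar> + \<bar>u (t *\<^sub>R x) - u x\<bar>)"
          by (intro ennreal_leI) linarith
        then show ?thesis by simp
      qed
      ultimately have "ennreal \<bar>u x\<bar> \<le> ennreal \<bar>u (t *\<^sub>R x)\<bar> + I x"
        using add_left_mono order_trans by blast
      then show ?case by (simp split: split_indicator)
    qed
    then show ?thesis
      by (subst nn_integral_add[symmetric]) (auto intro!: nn_integral_mono_AE)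
  qed
  have I_le: "(\<integral>\<^sup>+x. indicator L (norm x) * I x \<partial>lborel)
      \<le> (\<integral>\<^sup>+t. indicator {1..2} t * ?V t \<partial>lborel)"
  proof -
    have "(\<integral>\<^sup>+x. indicator L (norm x) * I x \<partial>lborel)
      = (\<integral>\<^sup>+x. \<integral>\<^sup>+s. ?i s x \<partial>lborel \<partial>lborel)"
      unfolding I_def by (intro nn_integral_cong nn_integral_cmult[symmetric]) measurable
    also have "\<dots> = (\<integral>\<^sup>+s. \<integral>\<^sup>+x. ?i s x \<partial>lborel \<partial>lborel)"
      by (rule lborel_pair.Fubini') measurable
    also have "\<dots> \<le> (\<integral>\<^sup>+t. \<integral>\<^sup>+x. indicator {1..2} t * (indicator L (norm x) * ennreal (2 * norm (G (t *\<^sub>R x)))) \<partial>lborel \<partial>lborel)"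
    proof (intro nn_integral_mono)
      fix s :: real and x :: "real^'n"
      have "norm x * norm (G (s *\<^sub>R x)) \<le> 2 * norm (G (s *\<^sub>R x))" if "norm x \<in> L"
        using that L by (intro mult_right_mono) auto
      then show "?i s x
        \<le> indicator {1..2} s * (indicator L (norm x) * ennreal (2 * norm (G (s *\<^sub>R x))))"
        by (auto split: split_indicator intro: ennreal_leI)
    qed
    also have "\<dots> = (\<integral>\<^sup>+t. indicator {1..2} t * ?V t \<partial>lborel)"
      by (intro nn_integral_cong nn_integral_cmult) measurable
    finally show ?thesis .
  qed
  have "?U1
      = (\<integral>\<^sup>+t. indicator {1..2::real} t * ?U1 \<partial>lborel)"
    by (subst nn_integral_multc) auto
  also have "\<dots> \<le> (\<integral>\<^sup>+t. indicator {1..2} t * ?U t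
         + indicator {1..2} t * (\<integral>\<^sup>+x. indicator L (norm x) * I x \<partial>lborel) \<partial>lborel)"
    using single by (intro nn_integral_mono) (auto split: split_indicator)
  also have "\<dots> = (\<integral>\<^sup>+t. indicator {1..2} t * ?U t \<partial>lborel)
         + (\<integral>\<^sup>+x. indicator L (norm x) * I x \<partial>lborel)"
    by (subst nn_integral_add) (auto simp: nn_integral_multc)
  also have "\<dots> \<le> (\<integral>\<^sup>+t. indicator {1..2} t * ?U t \<partial>lborel)
         + (\<integral>\<^sup>+t. indicator {1..2} t * ?V t \<partial>lborel)"
    by (intro add_left_mono I_le)
  also have "\<dots> = (\<integral>\<^sup>+t. indicator {1..2} t * (\<integral>\<^sup>+x. indicator L (norm x) * H (t *\<^sub>R x) \<partial>lborel) \<partial>lborel)"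
    unfolding H_def
    by (subst nn_integral_add[symmetric], measurable,
        subst distrib_left[symmetric], subst nn_integral_add[symmetric], measurable)
       (simp add: distrib_left[symmetric] ennreal_plus[symmetric] del: ennreal_plus)
  also have "\<dots> \<le> (\<integral>\<^sup>+t. \<integral>\<^sup>+y. ?k t y \<partial>lborel \<partial>lborel)"
  proof (intro nn_integral_mono)
    fix t :: real
    show "indicator {1..2} t * (\<integral>\<^sup>+x. indicator L (norm x) * H (t *\<^sub>R x) \<partial>lborel)
      \<le> (\<integral>\<^sup>+y. ?k t y \<partial>lborel)"
    proof (cases "t \<in> {1..2}")
      case True
      then have t: "t > 0" "1 \<le> t" "t \<le> 2" by auto
      have "(\<integral>\<^sup>+x. indicator L (norm x) * H (t *\<^sub>R x) \<partial>lborel)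
          \<le> ennreal (t ^ CARD('n)) * (\<integral>\<^sup>+x. indicator L (norm (t *\<^sub>R x) / t) * H (t *\<^sub>R x) \<partial>lborel)"
        using t mult_right_mono[of 1 "ennreal (t ^ CARD('n))"] by (auto simp: one_le_power)
      also have "\<dots> = (\<integral>\<^sup>+y. indicator L (norm y / t) * H y \<partial>lborel)"
        using nn_integral_dilate[OF t(1), of "\<lambda>y::real^'n. indicator L (norm y / t) * H y"] by simp
      also have "\<dots> \<le> (\<integral>\<^sup>+y. ?k t y \<partial>lborel)"
      proof (intro nn_integral_mono)
        fix y :: "real^'n"
        have 1: "(1::ennreal) \<le> 2 * ennreal (1 / t)"
        proof -
          have "(1::ennreal) = ennreal 1" by simp
          also have "\<dots> \<le> ennreal (2 * (1 / t))" using t by (intro ennreal_leI) (auto simp: field_simps)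
          also have "\<dots> = 2 * ennreal (1 / t)"
            using ennreal_mult'[of "2" "1 / t"] by (simp only: ennreal_numeral zero_le_numeral)
          finally show ?thesis .
        qed
        show "indicator L (norm y / t) * H y
          \<le> ?k t y"
        proof (cases "norm y / t \<in> L")
          case True
          then have "norm y / t \<le> 2" using L by auto
          then have "norm y \<le> 4" using t by (auto simp: field_simps)
          then show ?thesis
            using True t mult_right_mono[OF 1, of "H y"] by (simp add: mult_ac)
        qed simp
      qed
      finally show ?thesis using True by simp
    qed simp
  qed
  also have "\<dots> = (\<integral>\<^sup>+y. \<integral>\<^sup>+t. ?k t y \<partial>lborel \<partial>lborel)"
    by (rule lborel_pair.Fubini') measurable
  also have "\<dots> = (\<integral>\<^sup>+y. 2 * log_mass L * (indicator (cball 0 4) y * H y) \<partial>lborel)"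
  proof (rule nn_integral_cong_AE)
    show "AE y in lborel. (\<integral>\<^sup>+t. ?k t y \<partial>lborel)
      = 2 * log_mass L * (indicator (cball 0 4) y * H y)"
      using AE_lborel_singleton[of 0]
    proof eventually_elim
      case (elim y)
      then have "norm y > 0" by simp
      from log_mass_dilate[OF assms(4) this] show ?case
        by (subst nn_integral_cmult) (auto simp: mult_ac)
    qed
  qed
  also have "\<dots> = 2 * log_mass L * (\<integral>\<^sup>+y. indicator (cball 0 4) y * H y \<partial>lborel)"
    by (rule nn_integral_cmult) measurable
  finally show ?thesis unfolding H_def .
qed

lemma annulus_measure:
  "emeasure lborel (annulus :: 'a::euclidean_space set) = ennreal (measure lborel (annulus :: 'a set))"
  "0 < measure lborel (annulus :: 'a::euclidean_space set)"
proof -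
  let ?Z = "annulus :: 'a set"
  have sets: "?Z \<in> sets borel" by measurable
  have "?Z \<subseteq> cball 0 2" by auto
  then have "emeasure lborel ?Z \<le> emeasure lborel (cball (0::'a) 2)"
    by (intro emeasure_mono) auto
  also have "\<dots> < \<infinity>" by (rule emeasure_lborel_cball_finite)
  finally have fin: "emeasure lborel ?Z < \<infinity>" .
  then show "emeasure lborel ?Z = ennreal (measure lborel ?Z)"
    by (intro emeasure_eq_ennreal_measure) auto
  obtain b :: 'a where "b \<in> Basis" using nonempty_Basis by blast
  then have "(3/2) *\<^sub>R b \<in> {x. 1 < norm x \<and> norm x < 2}" by simp
  moreover have "open {x::'a. 1 < norm x \<and> norm x < 2}"
    by (intro open_Collect_conj open_Collect_less continuous_intros)
  ultimately have "\<not> negligible {x::'a. 1 < norm x \<and> norm x < 2}"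
    using open_not_negligible by blast
  then have "\<not> negligible ?Z"
    by (rule contrapos_nn) (rule negligible_subset, auto)
  then have "emeasure lborel ?Z \<noteq> 0"
    using sets by (simp add: negligible_iff_emeasure0)
  then show "0 < measure lborel ?Z"
    using fin by (simp add: measure_def enn2real_positive_iff less_top zero_less_iff_neq_zero)
qed

text \<open>The bound for \<open>\<bar>u\<bar>\<close> on the annulus in terms of a bound \<open>A\<close> for the sum of the integrals of
\<open>\<bar>u\<bar> powr s\<close> and of the squared gradient. The summand 1 creates the slack
that makes the set where the bound fails a null set.\<close>

definition radial_const :: "'n::finite itself \<Rightarrow> real \<Rightarrow> real" where
  "radial_const _ A = 1 + 2 * 2 ^ CARD('n) *
     (2 * measure lborel (cball (0::real^'n) 4) + A) / measure lborel (annulus :: (real^'n) set)"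

text \<open>If \<open>\<bar>u\<bar>\<close> exceeded the constant on the whole radial set over \<open>L\<close>, its integral would be larger than
\<open>radial_set_integral_le\<close> permits, unless the set is null.\<close>

lemma radial_level_set_null:
  fixes u :: "real^'n::finite \<Rightarrow> real"
  assumes [measurable]: "u \<in> borel_measurable borel" "G \<in> borel_measurable borel"
    and G: "has_weak_gradient u G" and Lm: "L \<in> sets borel" and L: "L \<subseteq> {1..2}"
    and s: "s \<ge> 1" and A: "A \<ge> 0"
    and bnd: "powr_integral s u + dirichlet G \<le> ennreal A"
    and big: "AE x in lborel. norm x \<in> L \<longrightarrow> \<bar>u x\<bar> \<ge> radial_const TYPE('n) A"
  shows "emeasure lborel {x::real^'n. norm x \<in> L} = 0"
proof -
  let ?Z = "annulus :: (real^'n) set" and ?S = "{x::real^'n. norm x \<in> L}" and ?N = "CARD('n)"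
  let ?B = "cball (0::real^'n) 4"
  have [measurable]: "?S \<in> sets borel" "?B \<in> sets borel" "L \<in> sets borel"
    using norm_vimage_borel[OF Lm, where 'a = "real^'n"] Lm by auto
  define c where "c = radial_const TYPE('n) A"
  define W where "W = 2 * measure lborel ?B + A"
  have W0: "W \<ge> 0" using A by (simp add: W_def)
  have VZ: "0 < measure lborel ?Z" by (rule annulus_measure)
  have c: "c * measure lborel ?Z = measure lborel ?Z + 2 * 2 ^ ?N * W"
    using VZ by (simp add: c_def W_def radial_const_def field_simps)
  have c0: "c \<ge> 0"
    using VZ W0 by (auto simp: c_def radial_const_def W_def)
  have "?S \<subseteq> cball 0 2" using L by auto
  then have "emeasure lborel ?S \<le> emeasure lborel (cball (0::real^'n) 2)"
    by (intro emeasure_mono) auto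
  also have "\<dots> < \<infinity>" by (rule emeasure_lborel_cball_finite)
  finally have S: "emeasure lborel ?S = ennreal (measure lborel ?S)"
    by (intro emeasure_eq_ennreal_measure) auto
  have "(\<integral>\<^sup>+y. indicator ?B y * ennreal (\<bar>u y\<bar> + 2 * norm (G y)) \<partial>lborel)
     \<le> (\<integral>\<^sup>+y. 2 * indicator ?B y + (ennreal (\<bar>u y\<bar> powr s) + ennreal ((norm (G y))\<^sup>2)) \<partial>lborel)"
  proof (intro nn_integral_mono)
    fix y
    have "\<bar>u y\<bar> \<le> 1 + \<bar>u y\<bar> powr s"
    proof (cases "\<bar>u y\<bar> \<le> 1")
      case False
      then have "\<bar>u y\<bar> powr 1 \<le> \<bar>u y\<bar> powr s" using s by (intro powr_mono) auto
      then show ?thesis using False by simp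
    qed (use powr_ge_zero[of "\<bar>u y\<bar>" s] in linarith)
    moreover have "2 * norm (G y) \<le> 1 + (norm (G y))\<^sup>2"
      using sum_squares_bound[of 1 "norm (G y)"] by simp
    ultimately have "ennreal (\<bar>u y\<bar> + 2 * norm (G y)) \<le> ennreal (2 + (\<bar>u y\<bar> powr s + (norm (G y))\<^sup>2))"
      by (intro ennreal_leI) simp
    also have "\<dots> = 2 + (ennreal (\<bar>u y\<bar> powr s) + ennreal ((norm (G y))\<^sup>2))"
      by simp
    finally show "indicator ?B y * ennreal (\<bar>u y\<bar> + 2 * norm (G y))
      \<le> 2 * indicator ?B y + (ennreal (\<bar>u y\<bar> powr s) + ennreal ((norm (G y))\<^sup>2))"
      by (auto split: split_indicator)
  qed
  also have "\<dots> = 2 * emeasure lborel ?B + (powr_integral s u + dirichlet G)"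
    by (subst nn_integral_add, measurable, subst nn_integral_add, measurable, subst nn_integral_cmult_indicator) auto
  also have "\<dots> \<le> 2 * ennreal (measure lborel ?B) + ennreal A"
    using bnd emeasure_lborel_cball_finite[of "0::real^'n" 4]
    by (subst emeasure_eq_ennreal_measure) (auto intro: add_left_mono)
  also have "\<dots> = ennreal W"
    using A by (simp add: W_def ennreal_mult')
  finally have W: "(\<integral>\<^sup>+y. indicator ?B y * ennreal (\<bar>u y\<bar> + 2 * norm (G y)) \<partial>lborel) \<le> ennreal W" .
  have "ennreal c * emeasure lborel ?S = (\<integral>\<^sup>+x. ennreal c * indicator ?S x \<partial>lborel)"
    by (subst nn_integral_cmult_indicator) auto
  also have "\<dots> \<le> (\<integral>\<^sup>+x. indicator L (norm x) * ennreal \<bar>u x\<bar> \<partial>lborel)"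
  proof (rule nn_integral_mono_AE)
    show "AE x in lborel. ennreal c * indicator ?S x \<le> indicator L (norm x) * ennreal \<bar>u x\<bar>"
      using big by eventually_elim (auto simp: c_def indicator_def intro: ennreal_leI)
  qed
  also have "\<dots> \<le> 2 * log_mass L * (\<integral>\<^sup>+y. indicator ?B y * ennreal (\<bar>u y\<bar> + 2 * norm (G y)) \<partial>lborel)"
    by (rule radial_set_integral_le[OF assms(1,2) G Lm L])
  also have "\<dots> \<le> 2 * log_mass L * ennreal W"
    by (intro mult_left_mono W) auto
  finally have "emeasure lborel ?Z * (ennreal c * emeasure lborel ?S) \<le> emeasure lborel ?Z * (2 * log_mass L * ennreal W)"
    by (rule mult_left_mono) auto
  also have "\<dots> = 2 * ennreal W * (emeasure lborel ?Z * log_mass L)"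
    by (simp add: mult_ac)
  also have "\<dots> \<le> 2 * ennreal W * (2 ^ ?N * emeasure lborel ?S)"
    using log_mass_le[OF Lm L, where 'a = "real^'n"] by (intro mult_left_mono) auto
  finally have "ennreal (measure lborel ?Z * (c * measure lborel ?S)) \<le> ennreal (2 * W * (2 ^ ?N * measure lborel ?S))"
    using W0 c0 by (simp add: annulus_measure(1)[where 'a = "real^'n"] S ennreal_mult' ennreal_power[symmetric])
  then have "measure lborel ?Z * (c * measure lborel ?S) \<le> 2 * W * (2 ^ ?N * measure lborel ?S)"
    using W0 by (subst (asm) ennreal_le_iff) auto
  then have "(c * measure lborel ?Z) * measure lborel ?S \<le> 2 * 2 ^ ?N * W * measure lborel ?S"
    by (simp add: mult_ac)
  then have "measure lborel ?Z * measure lborel ?S \<le> 0"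
    unfolding c by (simp add: algebra_simps)
  then have "measure lborel ?S = 0"
    using VZ by (simp add: mult_le_0_iff order.antisym)
  then show ?thesis using S by simp
qed

text \<open>The profile \<open>f\<close> of a radial function is not known to be measurable. Therefore a compact subset \<open>K\<close> of the
exceptional set is chosen, and the bound is applied to the radial set over the compact set \<open>norm ` K\<close>,
on which \<open>\<bar>u\<bar>\<close> is large as well, almost everywhere, by symmetry.\<close>

lemma radial_bound_annulus:
  fixes u :: "real^'n::finite \<Rightarrow> real"
  assumes [measurable]: "u \<in> borel_measurable borel" "G \<in> borel_measurable borel"
    and G: "has_weak_gradient u G" and rad: "radially_symmetric u"
    and s: "s \<ge> 1" and A: "A \<ge> 0"
    and bnd: "powr_integral s u + dirichlet G \<le> ennreal A"
  shows "AE x in lborel. x \<in> annulus \<longrightarrow> \<bar>u x\<bar> \<le> radial_const TYPE('n) A"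
proof -
  let ?Z = "annulus :: (real^'n) set"
  define c where "c = radial_const TYPE('n) A"
  obtain f :: "real \<Rightarrow> real" where f: "AE x in lebesgue. u x = f (norm x)"
    using rad unfolding radially_symmetric_def by auto
  define T where "T = {x \<in> ?Z. \<bar>u x\<bar> > c} - {x. u x \<noteq> f (norm x)}"
  have null: "{x. u x \<noteq> f (norm x)} \<in> null_sets lebesgue"
    using f by (simp add: AE_iff_null_sets[symmetric] completion.AE_iff_null_sets)
  have Zc: "{x \<in> ?Z. \<bar>u x\<bar> > c} \<in> sets borel" by measurable
  have T: "T \<in> sets lebesgue"
    unfolding T_def
  proof (rule sets.Diff)
    show "{x \<in> ?Z. \<bar>u x\<bar> > c} \<in> sets lebesgue" using Zc by simp
  qed (rule null_setsD2[OF null])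
  have "emeasure lebesgue T \<le> emeasure lebesgue ?Z"
    by (intro emeasure_mono) (auto simp: T_def)
  also have "\<dots> < \<infinity>" using annulus_measure(1)[where 'a = "real^'n"] by simp
  finally have T_fin: "emeasure lebesgue T = ennreal (measure lebesgue T)"
    by (intro emeasure_eq_ennreal_measure) auto
  have "measure lebesgue T = 0"
  proof (rule ccontr)
    assume "measure lebesgue T \<noteq> 0"
    then have pos: "measure lebesgue T > 0" by (simp add: zero_less_measure_iff)
    obtain K where K: "closed K" "K \<subseteq> T" "T - K \<in> lmeasurable"
      "emeasure lebesgue (T - K) < ennreal (measure lebesgue T)"
      by (rule sets_lebesgue_inner_closed[OF T pos])
    have Kb: "K \<subseteq> cball 0 2" using K(2) by (auto simp: T_def)
    then have "compact K" using K(1) bounded_subset[OF bounded_cball Kb] by (simp add: compact_eq_bounded_closed)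
    then have "compact (norm ` K)" by (intro compact_continuous_image continuous_intros)
    then have Lm: "norm ` K \<in> sets borel" by (simp add: borel_closed compact_imp_closed)
    have L: "norm ` K \<subseteq> {1..2}" using K(2) by (auto simp: T_def)
    have "emeasure lborel {x::real^'n. norm x \<in> norm ` K} = 0"
    proof (rule radial_level_set_null[OF assms(1,2) G Lm L s A bnd])
      have "AE x in lborel. u x = f (norm x)" using f by (simp add: AE_completion_iff)
      then show "AE x in lborel. norm x \<in> norm ` K \<longrightarrow> \<bar>u x\<bar> \<ge> radial_const TYPE('n) A"
      proof eventually_elim
        case (elim x)
        have "\<bar>u x\<bar> \<ge> c" if k: "k \<in> K" "norm x = norm k" for k
        proof -
          have "u k = f (norm k)" "\<bar>u k\<bar> > c" using k(1) K(2) by (auto simp: T_def)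
          then show ?thesis using elim k(2) by simp
        qed
        then show ?case by (auto simp: c_def)
      qed
    qed
    moreover have "emeasure lborel K \<le> emeasure lborel {x::real^'n. norm x \<in> norm ` K}"
      using norm_vimage_borel[OF Lm, where 'a = "real^'n"] by (intro emeasure_mono) auto
    moreover have Km: "K \<in> sets borel" using K(1) by (rule borel_closed)
    ultimately have K0: "emeasure lebesgue K = 0" by simp
    have "emeasure lebesgue T = emeasure lebesgue (T - K)"
      using K0 Km T by (intro emeasure_Diff_null_set[symmetric]) (auto simp: null_sets_def)
    then show False using K(4) T_fin by simp
  qed
  then have "emeasure lebesgue T = 0" using T_fin by simp
  then have "T \<in> null_sets lebesgue" using T by auto
  then have "AE x in lebesgue. x \<notin> T" by (rule AE_not_in)
  with f have "AE x in lebesgue. x \<in> ?Z \<longrightarrow> \<bar>u x\<bar> \<le> c"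
    by eventually_elim (auto simp: T_def)
  then show ?thesis by (simp add: AE_completion_iff c_def)
qed

section \<open>Energy under dilations\<close>

text \<open>The exponent \<open>m\<close> for which replacing \<open>u\<close> by \<open>t powr m * u (t x)\<close> preserves the Dirichlet energy.\<close>

abbreviation hom_exp :: "'n::finite itself \<Rightarrow> real" where
  "hom_exp _ \<equiv> (real CARD('n) - 2) / 2"

text \<open>The dilate of a function, and the corresponding weak gradient.\<close>

definition dil :: "real \<Rightarrow> (real^'n::finite \<Rightarrow> real) \<Rightarrow> real^'n \<Rightarrow> real" where
  "dil t u x = t powr hom_exp TYPE('n) * u (t *\<^sub>R x)"

definition dil_grad :: "real \<Rightarrow> (real^'n::finite \<Rightarrow> real^'n) \<Rightarrow> real^'n \<Rightarrow> real^'n" where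
  "dil_grad t G x = (t powr hom_exp TYPE('n) * t) *\<^sub>R G (t *\<^sub>R x)"

lemma dil_measurable [measurable]:
  assumes [measurable]: "u \<in> borel_measurable borel"
  shows "dil t u \<in> borel_measurable borel"
  unfolding dil_def[abs_def] by measurable

lemma dil_grad_measurable [measurable]:
  assumes [measurable]: "G \<in> borel_measurable borel"
  shows "dil_grad t G \<in> borel_measurable borel"
  unfolding dil_grad_def[abs_def] by measurable

lemma has_weak_gradient_dil:
  "u \<in> borel_measurable borel \<Longrightarrow> G \<in> borel_measurable borel \<Longrightarrow> has_weak_gradient u G \<Longrightarrow> t > 0 \<Longrightarrow>
    has_weak_gradient (dil t u) (dil_grad t G)"
  unfolding dil_def[abs_def] dil_grad_def[abs_def] by (rule has_weak_gradient_dilate)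

lemma nn_integral_dil_grad:
  fixes G :: "real^'n::finite \<Rightarrow> real^'n"
  assumes [measurable]: "G \<in> borel_measurable borel" and t: "t > 0"
  shows "dirichlet (dil_grad t G) = dirichlet G"
proof -
  have "(t powr hom_exp TYPE('n) * t)\<^sup>2 = (t powr (hom_exp TYPE('n) + 1)) powr 2"
    using t by (simp add: powr_add)
  also have "\<dots> = t ^ CARD('n)"
  proof -
    have "(hom_exp TYPE('n) + 1) * 2 = real CARD('n)" by (simp add: field_simps)
    then show ?thesis using t unfolding powr_powr by (simp only: powr_realpow)
  qed
  finally have eq: "(t powr hom_exp TYPE('n) * t)\<^sup>2 = t ^ CARD('n)" .
  have "(norm (dil_grad t G x))\<^sup>2 = t ^ CARD('n) * (norm (G (t *\<^sub>R x)))\<^sup>2" for x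
    unfolding dil_grad_def eq[symmetric] by (simp add: power_mult_distrib abs_mult)
  then have "dirichlet (dil_grad t G)
    = (\<integral>\<^sup>+x. ennreal (t ^ CARD('n)) * ennreal ((norm (G (t *\<^sub>R x)))\<^sup>2) \<partial>lborel)"
    using t by (simp add: ennreal_mult')
  also have "\<dots> = ennreal (t ^ CARD('n)) * (\<integral>\<^sup>+x. ennreal ((norm (G (t *\<^sub>R x)))\<^sup>2) \<partial>lborel)"
    by (rule nn_integral_cmult) measurable
  also have "\<dots> = dirichlet G"
    using nn_integral_dilate[OF t, of "\<lambda>x. ennreal ((norm (G x))\<^sup>2)"] by simp
  finally show ?thesis .
qed

lemma hom_exp_crit:
  "CARD('n::finite) \<ge> 3 \<Longrightarrow> hom_exp TYPE('n) * crit_exp CARD('n) = real CARD('n)"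
  by (simp add: crit_exp_def)

lemma crit_exp_gt_2: "N \<ge> 3 \<Longrightarrow> crit_exp N > 2"
  by (simp add: crit_exp_def field_simps)

lemma dil_powr:
  fixes u :: "real^'n::finite \<Rightarrow> real"
  assumes "t > 0"
  shows "\<bar>dil t u x\<bar> powr r = t powr (hom_exp TYPE('n) * r) * \<bar>u (t *\<^sub>R x)\<bar> powr r"
  using assms by (simp add: dil_def abs_mult powr_mult powr_powr)

lemma dil_powr_crit:
  fixes u :: "real^'n::finite \<Rightarrow> real"
  assumes "t > 0" "CARD('n) \<ge> 3"
  shows "\<bar>dil t u x\<bar> powr crit_exp CARD('n) = t ^ CARD('n) * \<bar>u (t *\<^sub>R x)\<bar> powr crit_exp CARD('n)"
  unfolding dil_powr[OF assms(1)] hom_exp_crit[OF assms(2)] using assms(1) by (simp add: powr_realpow)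

lemma nn_integral_dil_crit:
  fixes u :: "real^'n::finite \<Rightarrow> real"
  assumes [measurable]: "u \<in> borel_measurable borel" and t: "t > 0" and N: "CARD('n) \<ge> 3"
  shows "powr_integral (crit_exp CARD('n)) (dil t u)
    = powr_integral (crit_exp CARD('n)) u"
proof -
  have "powr_integral (crit_exp CARD('n)) (dil t u)
    = (\<integral>\<^sup>+x. ennreal (t ^ CARD('n)) * ennreal (\<bar>u (t *\<^sub>R x)\<bar> powr crit_exp CARD('n)) \<partial>lborel)"
    using t by (simp add: dil_powr_crit[OF t N] ennreal_mult')
  also have "\<dots> = ennreal (t ^ CARD('n)) * (\<integral>\<^sup>+x. ennreal (\<bar>u (t *\<^sub>R x)\<bar> powr crit_exp CARD('n)) \<partial>lborel)"
    by (rule nn_integral_cmult) measurable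
  also have "\<dots> = powr_integral (crit_exp CARD('n)) u"
    using nn_integral_dilate[OF t, of "\<lambda>x. ennreal (\<bar>u x\<bar> powr crit_exp CARD('n))"] by simp
  finally show ?thesis .
qed

lemma radially_symmetric_dil:
  assumes "radially_symmetric u" "t > 0"
  shows "radially_symmetric (dil t u)"
proof -
  obtain f :: "real \<Rightarrow> real" where "AE x in lborel. u x = f (norm x)"
    using assms(1) by (auto simp: radially_symmetric_def AE_completion_iff)
  from AE_dilate[OF assms(2) this]
  have "AE x in lborel. dil t u x = t powr hom_exp TYPE('a) * f (t * norm x)"
    by eventually_elim (use assms(2) in \<open>simp add: dil_def\<close>)
  then show ?thesis
    unfolding radially_symmetric_def AE_completion_iff
    by (intro exI[of _ "\<lambda>r. t powr hom_exp TYPE('a) * f (t * r)"])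
qed

text \<open>The radial lemma. Both integrals are invariant under \<open>dil\<close>, so the bound on the annulus applies to all
dilates by powers of 2 with the same constant.\<close>

lemma radial_bound:
  fixes u :: "real^'n::finite \<Rightarrow> real"
  assumes u [measurable]: "u \<in> borel_measurable borel" and Gm: "G \<in> borel_measurable borel"
    and G: "has_weak_gradient u G" and rad: "radially_symmetric u" and N: "CARD('n) \<ge> 3"
    and fin: "powr_integral (crit_exp CARD('n)) u < \<infinity>"
      "dirichlet G < \<infinity>"
  obtains C where "C \<ge> 0" "AE x in lborel. \<bar>u x\<bar> \<le> C * norm x powr (- hom_exp TYPE('n))"
proof -
  let ?m = "hom_exp TYPE('n)"
  have m: "?m > 0" using N by simp
  obtain A where A: "A \<ge> 0" "powr_integral (crit_exp CARD('n)) u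
      + dirichlet G = ennreal A"
  proof -
    have "powr_integral (crit_exp CARD('n)) u
      + dirichlet G < \<infinity>" using fin by simp
    then show ?thesis using that
      by (cases "powr_integral (crit_exp CARD('n)) u
      + dirichlet G" rule: ennreal_cases) auto
  qed
  define c where "c = radial_const TYPE('n) A"
  have c0: "c \<ge> 0"
    using A(1) annulus_measure(2)[where 'a = "real^'n"] by (auto simp: c_def radial_const_def)
  have "AE y in lborel. \<forall>k::int. (1 / 2 powr k) *\<^sub>R y \<in> annulus \<longrightarrow> \<bar>u y\<bar> \<le> c * (2 powr k) powr (- ?m)"
    unfolding AE_all_countable
  proof
    fix k :: int
    define t :: real where "t = 2 powr k"
    have t: "t > 0" by (simp add: t_def)
    have "AE x in lborel. x \<in> annulus \<longrightarrow> \<bar>dil t u x\<bar> \<le> c"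
      unfolding c_def
    proof (rule radial_bound_annulus[OF _ _ has_weak_gradient_dil[OF u Gm G t] radially_symmetric_dil[OF rad t]])
      show "1 \<le> crit_exp CARD('n)" using crit_exp_gt_2[OF N] by simp
    qed (use A Gm in \<open>simp_all add: nn_integral_dil_crit[OF u t N] nn_integral_dil_grad[OF Gm t]\<close>)
    then have "AE y in lborel. (1 / t) *\<^sub>R y \<in> annulus \<longrightarrow> \<bar>dil t u ((1 / t) *\<^sub>R y)\<bar> \<le> c"
      by (rule AE_dilate[rotated]) (use t in simp)
    then have "AE y in lborel. (1 / t) *\<^sub>R y \<in> annulus \<longrightarrow> \<bar>u y\<bar> \<le> c * t powr (- ?m)"
    proof eventually_elim
      case (elim y)
      show ?case
      proof
        assume "(1 / t) *\<^sub>R y \<in> annulus"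
        with elim have "t powr ?m * \<bar>u y\<bar> \<le> c"
          using t by (simp add: dil_def abs_mult)
        then show "\<bar>u y\<bar> \<le> c * t powr (- ?m)"
          using t by (simp add: powr_minus field_simps)
      qed
    qed
    then show "AE y in lborel. (1 / 2 powr k) *\<^sub>R y \<in> annulus \<longrightarrow> \<bar>u y\<bar> \<le> c * (2 powr k) powr (- ?m)"
      by (simp add: t_def)
  qed
  then have "AE y in lborel. \<bar>u y\<bar> \<le> (c * 2 powr ?m) * norm y powr (- ?m)"
    using AE_lborel_singleton[of 0]
  proof eventually_elim
    case (elim y)
    \<comment> \<open>The dyadic annulus that contains \<open>y\<close>.\<close>
    define k where "k = \<lfloor>log 2 (norm y)\<rfloor>"
    define t :: real where "t = 2 powr k"
    have y: "norm y > 0" using elim(2) by simp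
    have t: "t > 0" by (simp add: t_def)
    have y2: "2 powr (log 2 (norm y)) = norm y" using y by simp
    have "2 powr real_of_int k \<le> 2 powr (log 2 (norm y))"
      unfolding k_def by (intro powr_mono) auto
    then have 1: "t \<le> norm y" unfolding t_def y2 .
    have "2 powr (log 2 (norm y)) \<le> 2 powr (real_of_int k + 1)"
      unfolding k_def by (intro powr_mono) (auto intro: less_imp_le)
    then have 2: "norm y \<le> 2 * t" unfolding y2 by (simp add: t_def powr_add)
    have "(1 / t) *\<^sub>R y \<in> annulus" using 1 2 t by (simp add: field_simps)
    then have "\<bar>u y\<bar> \<le> c * t powr (- ?m)" using elim(1) by (simp add: t_def)
    also have "t powr (- ?m) \<le> (norm y / 2) powr (- ?m)"
      using 2 y m by (intro powr_mono2') auto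
    also have "(norm y / 2) powr (- ?m) = 2 powr ?m * norm y powr (- ?m)"
      using y by (simp add: powr_divide powr_minus field_simps)
    finally show ?case using c0 by (simp add: mult_left_mono mult.assoc)
  qed
  then show ?thesis using that[of "c * 2 powr ?m"] c0 by simp
qed

text \<open>The value of \<open>ball_mass\<close> for a Borel function, as an integral for the Lebesgue-Borel measure with the ball
expressed through the norm.\<close>

definition mass :: "real \<Rightarrow> (real^'n::finite \<Rightarrow> real) \<Rightarrow> real \<Rightarrow> real" where
  "mass p u \<rho> = (LBINT y. indicator {..<\<rho>} (norm y) * \<bar>u y\<bar> powr p)"

lemma ball_mass_eq_mass:
  assumes [measurable]: "u \<in> borel_measurable borel"
  shows "ball_mass p u = mass p u"
proof
  fix \<rho>
  have [measurable]: "ball (0::real^'a) \<rho> \<in> sets borel" by simp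
  have eq: "indicator (ball 0 \<rho>) y *\<^sub>R \<bar>u y\<bar> powr p = indicator {..<\<rho>} (norm y) * \<bar>u y\<bar> powr p" for y
    by (simp split: split_indicator)
  show "ball_mass p u \<rho> = mass p u \<rho>"
    unfolding ball_mass_def mass_def set_lebesgue_integral_def eq
    by (rule integral_completion) measurable
qed

lemma mass_measurable [measurable]:
  assumes [measurable]: "u \<in> borel_measurable borel"
  shows "mass p u \<in> borel_measurable borel"
proof -
  have "mass p u = (\<lambda>\<rho>. \<integral>y. (if norm y < \<rho> then \<bar>u y\<bar> powr p else 0) \<partial>lborel)"
    unfolding mass_def by (intro ext Bochner_Integration.integral_cong) (auto simp: indicator_def)
  then show ?thesis by simp
qed

lemma mass_nonneg: "mass p u \<rho> \<ge> 0"
  unfolding mass_def by (intro integral_nonneg_AE) simp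

lemma mass_dil:
  fixes u :: "real^'n::finite \<Rightarrow> real"
  assumes [measurable]: "u \<in> borel_measurable borel" and t: "t > 0"
  shows "mass p (dil t u) \<rho> = t powr (hom_exp TYPE('n) * p - real CARD('n)) * mass p u (t * \<rho>)"
proof -
  have "mass p u (t * \<rho>) = t ^ CARD('n) * (LBINT y. indicator {..<t * \<rho>} (norm (t *\<^sub>R y)) * \<bar>u (t *\<^sub>R y)\<bar> powr p)"
    unfolding mass_def using integral_dilate[OF t, of "\<lambda>y. indicator {..<t * \<rho>} (norm y) * \<bar>u y\<bar> powr p"] by simp
  also have "(\<lambda>y. indicator {..<t * \<rho>} (norm (t *\<^sub>R y)) * \<bar>u (t *\<^sub>R y)\<bar> powr p)
      = (\<lambda>y. t powr (- (hom_exp TYPE('n) * p)) * (indicator {..<\<rho>} (norm y) * \<bar>dil t u y\<bar> powr p))"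
    using t by (auto simp: fun_eq_iff dil_powr[OF t] powr_minus indicator_def)
  also have "(LBINT y. t powr (- (hom_exp TYPE('n) * p)) * (indicator {..<\<rho>} (norm y) * \<bar>dil t u y\<bar> powr p))
      = t powr (- (hom_exp TYPE('n) * p)) * mass p (dil t u) \<rho>"
    unfolding mass_def by (rule integral_mult_right_zero)
  finally have "mass p u (t * \<rho>) = t ^ CARD('n) * (t powr (- (hom_exp TYPE('n) * p)) * mass p (dil t u) \<rho>)" .
  then have "t powr (hom_exp TYPE('n) * p - real CARD('n)) * mass p u (t * \<rho>)
     = (t powr (hom_exp TYPE('n) * p - real CARD('n)) * t powr real CARD('n) * t powr (- (hom_exp TYPE('n) * p))) * mass p (dil t u) \<rho>"
    using t by (simp add: powr_realpow)
  also have "t powr (hom_exp TYPE('n) * p - real CARD('n)) * t powr real CARD('n) * t powr (- (hom_exp TYPE('n) * p)) = 1"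
    using t by (simp add: powr_add[symmetric])
  finally show ?thesis by simp
qed

text \<open>The second energy term of the space, as an extended real.\<close>

definition energy :: "real \<Rightarrow> real \<Rightarrow> real \<Rightarrow> (real^'n::finite \<Rightarrow> real) \<Rightarrow> ennreal" where
  "energy b p q u = (\<integral>\<^sup>+\<rho>. indicator {0<..} \<rho> * ennreal (\<rho> powr (- b) * mass p u \<rho> powr q) \<partial>lborel)"

lemma energy_dil:
  fixes u :: "real^'n::finite \<Rightarrow> real"
  assumes [measurable]: "u \<in> borel_measurable borel" and t: "t > 0"
  shows "energy b p q (dil t u)
    = ennreal (t powr (b - 1 - q * (real CARD('n) - hom_exp TYPE('n) * p))) * energy b p q u"
proof -
  let ?e = "hom_exp TYPE('n) * p - real CARD('n)"
  let ?F = "\<lambda>\<rho>. indicator {0<..} \<rho> * ennreal (\<rho> powr (- b) * mass p u \<rho> powr q)"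
  let ?c = "t powr (b - 1 - q * (real CARD('n) - hom_exp TYPE('n) * p))"
  have "indicator {0<..} \<rho> * ennreal (\<rho> powr (- b) * mass p (dil t u) \<rho> powr q)
      = ennreal (t powr (?e * q + b)) * ?F (t * \<rho>)" for \<rho>
  proof (cases "\<rho> > 0")
    case True
    have "\<rho> powr (- b) * mass p (dil t u) \<rho> powr q
       = \<rho> powr (- b) * (t powr (?e * q) * mass p u (t * \<rho>) powr q)"
      using t by (simp add: mass_dil powr_mult mass_nonneg powr_powr)
    also have "\<dots> = t powr (?e * q + b) * ((t * \<rho>) powr (- b) * mass p u (t * \<rho>) powr q)"
      using t True by (simp add: powr_add powr_mult powr_minus)
    finally show ?thesis
      using True t by (simp add: ennreal_mult'[symmetric])
  qed (use t in \<open>simp add: zero_less_mult_iff\<close>)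
  then have "energy b p q (dil t u) = ennreal (t powr (?e * q + b)) *
      (\<integral>\<^sup>+\<rho>. ?F (t * \<rho>) \<partial>lborel)"
    unfolding energy_def by (simp only:) (rule nn_integral_cmult, measurable)
  also have "t powr (?e * q + b) = ?c * t"
    using t powr_add[of t "b - 1 - q * (real CARD('n) - hom_exp TYPE('n) * p)" 1] by (simp add: algebra_simps)
  also have "ennreal (?c * t) *
      (\<integral>\<^sup>+\<rho>. ?F (t * \<rho>) \<partial>lborel)
    = ennreal (?c) * (ennreal (t ^ DIM(real)) *
      (\<integral>\<^sup>+\<rho>. ?F (t *\<^sub>R \<rho>) \<partial>lborel))"
    using t by (simp add: ennreal_mult' mult.assoc)
  also have "ennreal (t ^ DIM(real)) *
      (\<integral>\<^sup>+\<rho>. ?F (t *\<^sub>R \<rho>) \<partial>lborel) = energy b p q u"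
    unfolding energy_def by (rule nn_integral_dilate[OF t, symmetric]) measurable
  finally show ?thesis .
qed

lemma E_space_borel_iff:
  fixes u :: "real^'n::finite \<Rightarrow> real"
  assumes u [measurable]: "u \<in> borel_measurable borel" and Gm [measurable]: "G \<in> borel_measurable borel"
    and G: "has_weak_gradient u G"
  shows "u \<in> E_space b p q \<longleftrightarrow>
    (\<forall>\<rho>>0. ball_integrable p u \<rho>) \<and>
    dirichlet G < \<infinity> \<and> energy b p q u < \<infinity>"
proof -
  have wd: "weakly_differentiable u" using G by (auto simp: weakly_differentiable_def)
  have 1: "set_integrable lebesgue (ball 0 \<rho>) (\<lambda>y. \<bar>u y\<bar> powr p)
      \<longleftrightarrow> ball_integrable p u \<rho>" for \<rho>
  proof -
    have eq: "indicator (ball 0 \<rho>) y *\<^sub>R \<bar>u y\<bar> powr p = indicator {..<\<rho>} (norm y) * \<bar>u y\<bar> powr p" for y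
      by (simp split: split_indicator)
    show ?thesis
      unfolding set_integrable_def eq by (rule integrable_completion) measurable
  qed
  have 2: "(\<integral>\<^sup>+x. ennreal ((norm (weak_grad u x))\<^sup>2) \<partial>lebesgue) = dirichlet G"
  proof -
    have "(\<integral>\<^sup>+x. ennreal ((norm (weak_grad u x))\<^sup>2) \<partial>lebesgue) = (\<integral>\<^sup>+x. ennreal ((norm (G x))\<^sup>2) \<partial>lebesgue)"
      by (rule nn_integral_cong_AE) (use weak_grad_AE_eq[OF u Gm G] in eventually_elim, simp)
    then show ?thesis by (simp add: nn_integral_completion)
  qed
  have 3: "(\<integral>\<^sup>+\<rho>\<in>{0<..}. ennreal (\<rho> powr (- b) * ball_mass p u \<rho> powr q) \<partial>lebesgue) = energy b p q u"
    unfolding energy_def ball_mass_eq_mass[OF u] nn_integral_completion by (simp add: mult.commute)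
  show ?thesis
    unfolding E_space_def using wd by (simp add: 1 2 3)
qed

lemma dil_in_E_rad:
  fixes u :: "real^'n::finite \<Rightarrow> real"
  assumes u [measurable]: "u \<in> borel_measurable borel" and Gm [measurable]: "G \<in> borel_measurable borel"
    and G: "has_weak_gradient u G" and E: "u \<in> E_rad b p q" and t: "t > 0"
  shows "dil t u \<in> E_rad b p q"
proof -
  have Eu: "\<And>\<rho>. \<rho> > 0 \<Longrightarrow> ball_integrable p u \<rho>"
    "dirichlet G < \<infinity>" "energy b p q u < \<infinity>"
    and rad: "radially_symmetric u"
    using E by (auto simp: E_rad_def E_space_borel_iff[OF u Gm G])
  have "ball_integrable p (dil t u) \<rho>" if "\<rho> > 0" for \<rho>
  proof -
    have "integrable lborel (\<lambda>y. indicator {..<t * \<rho>} (norm (t *\<^sub>R y)) * \<bar>u (t *\<^sub>R y)\<bar> powr p)"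
      using Eu(1)[of "t * \<rho>"] t that
        integrable_dilate_iff[OF t, of "\<lambda>y::real^'n. indicator {..<t * \<rho>} (norm y) * \<bar>u y\<bar> powr p"] by simp
    then have "integrable lborel (\<lambda>y. t powr (hom_exp TYPE('n) * p) *
        (indicator {..<t * \<rho>} (norm (t *\<^sub>R y)) * \<bar>u (t *\<^sub>R y)\<bar> powr p))"
      by (rule integrable_mult_right)
    also have "(\<lambda>y. t powr (hom_exp TYPE('n) * p) * (indicator {..<t * \<rho>} (norm (t *\<^sub>R y)) * \<bar>u (t *\<^sub>R y)\<bar> powr p))
      = (\<lambda>y. indicator {..<\<rho>} (norm y) * \<bar>dil t u y\<bar> powr p)"
      using t by (auto simp: fun_eq_iff dil_powr[OF t] indicator_def)
    finally show ?thesis .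
  qed
  then have "dil t u \<in> E_space b p q"
    using Eu t by (subst E_space_borel_iff[OF _ _ has_weak_gradient_dil[OF u Gm G t]])
      (auto simp: nn_integral_dil_grad energy_dil ennreal_mult_less_top)
  then show ?thesis
    using radially_symmetric_dil[OF rad t] by (simp add: E_rad_def)
qed

section \<open>The nonlocal term\<close>

text \<open>Young's inequality. The use of \<open>rpow\<close> makes it hold for \<open>r = 1\<close> too, where the first factor is 1.\<close>

lemma young_rpow:
  assumes "r \<ge> 1" "x \<ge> 0" "y \<ge> 0"
  shows "rpow x (r - 1) * y \<le> (1 - 1 / r) * x powr r + (1 / r) * y powr r"
proof (cases "r = 1")
  case False
  with assms have r: "r > 1" by simp
  define r' where "r' = r / (r - 1)"
  have r': "r' > 1" "1 / r' + 1 / r = 1" "1 / r' = 1 - 1 / r"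
    using r by (auto simp: r'_def field_simps)
  have "x powr (r - 1) * y \<le> (x powr (r - 1)) powr r' / r' + y powr r / r"
    by (rule Youngs_inequality) (use r r' assms in auto)
  also have "(x powr (r - 1)) powr r' = x powr r"
    using r by (simp add: powr_powr r'_def)
  finally show ?thesis
    using r r'(3) by (simp add: rpow_def divide_inverse mult.commute)
qed (use assms in \<open>simp add: rpow_def\<close>)

lemma young_pairing:
  fixes x y r :: real
  assumes "r > 1"
  shows "\<bar>\<bar>x\<bar> powr (r - 2) * x * y\<bar> \<le> (1 - 1 / r) * \<bar>x\<bar> powr r + (1 / r) * \<bar>y\<bar> powr r"
proof -
  have "\<bar>\<bar>x\<bar> powr (r - 2) * x\<bar> = rpow \<bar>x\<bar> (r - 1)"
    using assms powr_mult_base[of "\<bar>x\<bar>" "r - 2"]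
    by (cases "x = 0") (auto simp: rpow_def abs_mult mult.commute)
  then show ?thesis
    using young_rpow[of r "\<bar>x\<bar>" "\<bar>y\<bar>"] assms by (simp add: abs_mult)
qed

lemma powr_diag: "\<bar>x\<bar> powr (r - 2) * x * x = \<bar>x :: real\<bar> powr r"
proof (cases "x = 0")
  case False
  have "\<bar>x\<bar> powr r = \<bar>x\<bar> powr (r - 2) * \<bar>x\<bar> powr 2"
    using powr_add[of "\<bar>x\<bar>" "r - 2" 2] by simp
  also have "\<bar>x\<bar> powr 2 = x * x" using False by (simp add: power2_eq_square)
  finally show ?thesis by simp
qed simp

lemma weighted_pairing:
  fixes W u v :: "'a::euclidean_space \<Rightarrow> real"
  assumes [measurable]: "W \<in> borel_measurable borel" "u \<in> borel_measurable borel" "v \<in> borel_measurable borel"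
    and W: "\<And>x. W x \<ge> 0" and r: "r > 1"
    and iu: "integrable lborel (\<lambda>x. W x * \<bar>u x\<bar> powr r)" and iv: "integrable lborel (\<lambda>x. W x * \<bar>v x\<bar> powr r)"
  shows "integrable lborel (\<lambda>x. W x * (\<bar>u x\<bar> powr (r - 2) * u x * v x))"
    and "(LBINT x. W x * (\<bar>u x\<bar> powr (r - 2) * u x * v x))
      \<le> (1 - 1 / r) * (LBINT x. W x * \<bar>u x\<bar> powr r) + (1 / r) * (LBINT x. W x * \<bar>v x\<bar> powr r)"
proof -
  let ?R = "\<lambda>x. (1 - 1 / r) * (W x * \<bar>u x\<bar> powr r) + (1 / r) * (W x * \<bar>v x\<bar> powr r)"
  have iR: "integrable lborel ?R" using iu iv by simp
  have le: "\<bar>W x * (\<bar>u x\<bar> powr (r - 2) * u x * v x)\<bar> \<le> ?R x" for x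
    using mult_left_mono[OF young_pairing[OF r, of "u x" "v x"] W[of x]] W[of x]
    by (simp add: abs_mult algebra_simps)
  show i: "integrable lborel (\<lambda>x. W x * (\<bar>u x\<bar> powr (r - 2) * u x * v x))"
  proof (rule Bochner_Integration.integrable_bound[OF iR])
    show "AE x in lborel. norm (W x * (\<bar>u x\<bar> powr (r - 2) * u x * v x)) \<le> norm (?R x)"
      using le by (intro AE_I2) (metis abs_ge_self order_trans real_norm_def)
  qed simp
  have "(LBINT x. W x * (\<bar>u x\<bar> powr (r - 2) * u x * v x)) \<le> (LBINT x. ?R x)"
    by (rule integral_mono[OF i iR]) (use le abs_le_D1 in blast)
  then show "(LBINT x. W x * (\<bar>u x\<bar> powr (r - 2) * u x * v x))
      \<le> (1 - 1 / r) * (LBINT x. W x * \<bar>u x\<bar> powr r) + (1 / r) * (LBINT x. W x * \<bar>v x\<bar> powr r)"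
    using iu iv by simp
qed

lemma rpow_measurable [measurable]:
  assumes [measurable]: "f \<in> borel_measurable M"
  shows "(\<lambda>x. rpow (f x) e) \<in> borel_measurable M"
  unfolding rpow_def by measurable

lemma rpow_nonneg: "x \<ge> 0 \<Longrightarrow> rpow x e \<ge> 0"
  by (simp add: rpow_def)

lemma nn_integral_powr_tail:
  fixes r b :: real
  assumes "r > 0" "b > 1"
  shows "(\<integral>\<^sup>+\<rho>. indicator {r<..} \<rho> * ennreal (\<rho> powr (- b)) \<partial>lborel) < \<infinity>"
proof -
  have "((\<lambda>x. x powr (- b)) has_integral -(r powr (- b + 1)) / (- b + 1)) {r..}"
    using assms by (intro has_integral_powr_to_inf) auto
  then have "((\<lambda>x. if x \<in> {r..} then x powr (- b) else 0) has_integral -(r powr (- b + 1)) / (- b + 1)) UNIV"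
    by (simp only: has_integral_restrict_UNIV)
  then have "(\<integral>\<^sup>+x. ennreal (if x \<in> {r..} then x powr (- b) else 0) \<partial>lborel) = ennreal (-(r powr (- b + 1)) / (- b + 1))"
    by (rule nn_integral_has_integral_lborel[rotated 2]) auto
  moreover have "(\<integral>\<^sup>+\<rho>. indicator {r<..} \<rho> * ennreal (\<rho> powr (- b)) \<partial>lborel)
    \<le> (\<integral>\<^sup>+x. ennreal (if x \<in> {r..} then x powr (- b) else 0) \<partial>lborel)"
    by (intro nn_integral_mono) (auto split: split_indicator)
  ultimately show ?thesis
    by (simp add: ennreal_less_top le_less_trans)
qed

lemma potential_eq:
  fixes u :: "real^'n::finite \<Rightarrow> real"
  assumes u [measurable]: "u \<in> borel_measurable borel"
  shows "potential a b p q u r = a * (LBINT \<rho>. (if r < \<rho> then \<rho> powr (- b) * rpow (mass p u \<rho>) (q - 1) else 0))"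
proof -
  have "(LINT \<rho>:{r<..}|lebesgue. \<rho> powr (- b) * rpow (mass p u \<rho>) (q - 1))
     = (LINT \<rho>|lebesgue. (if r < \<rho> then \<rho> powr (- b) * rpow (mass p u \<rho>) (q - 1) else 0))"
    unfolding set_lebesgue_integral_def by (intro Bochner_Integration.integral_cong) (auto simp: indicator_def)
  also have "\<dots> = (LBINT \<rho>. (if r < \<rho> then \<rho> powr (- b) * rpow (mass p u \<rho>) (q - 1) else 0))"
    by (rule integral_completion) measurable
  finally show ?thesis
    by (simp add: potential_def ball_mass_eq_mass)
qed

lemma potential_measurable [measurable]:
  fixes u :: "real^'n::finite \<Rightarrow> real"
  assumes [measurable]: "u \<in> borel_measurable borel"
  shows "potential a b p q u \<in> borel_measurable borel"
proof -
  have "potential a b p q u = (\<lambda>r. a * (LBINT \<rho>. (if r < \<rho> then \<rho> powr (- b) * rpow (mass p u \<rho>) (q - 1) else 0)))"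
    by (intro ext potential_eq assms)
  then show ?thesis by simp
qed

lemma potential_nonneg:
  fixes u :: "real^'n::finite \<Rightarrow> real"
  assumes "u \<in> borel_measurable borel" "a \<ge> 0"
  shows "potential a b p q u r \<ge> 0"
  unfolding potential_eq[OF assms(1)]
  by (intro mult_nonneg_nonneg assms integral_nonneg_AE) (auto simp: rpow_nonneg mass_nonneg)

text \<open>The real-valued integral defining the potential is finite for \<open>r > 0\<close>, because
\<open>rpow h (q - 1) \<le> 1 + h powr q\<close>, \<open>b > 1\<close> and the energy is finite; hence no information is lost by its convention for divergent integrals.\<close>

lemma ennreal_potential:
  fixes u :: "real^'n::finite \<Rightarrow> real"
  assumes u [measurable]: "u \<in> borel_measurable borel" and a: "a \<ge> 0" and b: "b > 1" and q: "q \<ge> 1"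
    and fin: "energy b p q u < \<infinity>" and r: "r > 0"
  shows "ennreal (potential a b p q u r)
    = ennreal a * (\<integral>\<^sup>+\<rho>. indicator {r<..} \<rho> * ennreal (\<rho> powr (- b) * rpow (mass p u \<rho>) (q - 1)) \<partial>lborel)"
proof -
  let ?f = "\<lambda>\<rho>. if r < \<rho> then \<rho> powr (- b) * rpow (mass p u \<rho>) (q - 1) else 0"
  have bound: "rpow x (q - 1) \<le> 1 + x powr q" if "x \<ge> 0" for x
  proof -
    have "rpow x (q - 1) * 1 \<le> (1 - 1 / q) * x powr q + (1 / q) * 1 powr q"
      by (rule young_rpow) (use q that in auto)
    also have "\<dots> \<le> 1 * x powr q + 1"
      using q by (intro add_mono mult_right_mono) auto
    finally show ?thesis by simp
  qed
  have "(\<integral>\<^sup>+\<rho>. ennreal (?f \<rho>) \<partial>lborel)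
     \<le> (\<integral>\<^sup>+\<rho>. indicator {r<..} \<rho> * ennreal (\<rho> powr (- b)) + indicator {0<..} \<rho> * ennreal (\<rho> powr (- b) * mass p u \<rho> powr q) \<partial>lborel)"
  proof (intro nn_integral_mono)
    fix \<rho>
    have "\<rho> powr (- b) * rpow (mass p u \<rho>) (q - 1) \<le> \<rho> powr (- b) * (1 + mass p u \<rho> powr q)"
      by (intro mult_left_mono bound mass_nonneg) auto
    then show "ennreal (?f \<rho>) \<le> indicator {r<..} \<rho> * ennreal (\<rho> powr (- b)) + indicator {0<..} \<rho> * ennreal (\<rho> powr (- b) * mass p u \<rho> powr q)"
      using r by (cases "r < \<rho>") (auto simp: distrib_left simp flip: ennreal_plus intro!: ennreal_leI)
  qed
  also have "\<dots> = (\<integral>\<^sup>+\<rho>. indicator {r<..} \<rho> * ennreal (\<rho> powr (- b)) \<partial>lborel) + energy b p q u"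
    unfolding energy_def by (rule nn_integral_add) measurable
  also have "\<dots> < \<infinity>"
    using nn_integral_powr_tail[OF r b] fin by simp
  finally have "(\<integral>\<^sup>+\<rho>. ennreal (?f \<rho>) \<partial>lborel) < \<infinity>" .
  then have "integrable lborel ?f"
    by (intro integrableI_nonneg) (auto simp: rpow_nonneg mass_nonneg)
  then have "ennreal (LBINT \<rho>. ?f \<rho>) = (\<integral>\<^sup>+\<rho>. ennreal (?f \<rho>) \<partial>lborel)"
    by (intro nn_integral_eq_integral[symmetric]) (auto simp: rpow_nonneg mass_nonneg)
  also have "\<dots> = (\<integral>\<^sup>+\<rho>. indicator {r<..} \<rho> * ennreal (\<rho> powr (- b) * rpow (mass p u \<rho>) (q - 1)) \<partial>lborel)"
    by (intro nn_integral_cong) (auto simp: indicator_def)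
  finally show ?thesis
    unfolding potential_eq[OF u] using a by (simp add: ennreal_mult')
qed

text \<open>Tonelli's theorem for the region \<open>norm x < \<rho>\<close>.\<close>

lemma potential_pairing:
  fixes u w :: "real^'n::finite \<Rightarrow> real"
  assumes u [measurable]: "u \<in> borel_measurable borel" and w [measurable]: "w \<in> borel_measurable borel"
    and a: "a \<ge> 0" and b: "b > 1" and q: "q \<ge> 1" and fin: "energy b p q u < \<infinity>"
    and w0: "\<And>x. w x \<ge> 0"
  shows "(\<integral>\<^sup>+x. ennreal (potential a b p q u (norm x) * w x) \<partial>lborel)
    = ennreal a * (\<integral>\<^sup>+\<rho>. indicator {0<..} \<rho> * ennreal (\<rho> powr (- b) * rpow (mass p u \<rho>) (q - 1)) *
        (\<integral>\<^sup>+x. indicator {..<\<rho>} (norm x) * ennreal (w x) \<partial>lborel) \<partial>lborel)"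
proof -
  let ?g = "\<lambda>\<rho>. ennreal (\<rho> powr (- b) * rpow (mass p u \<rho>) (q - 1))"
  let ?k = "\<lambda>(x::real^'n) \<rho>. (if norm x < \<rho> then ?g \<rho> * ennreal (w x) else 0)"
  have "(\<integral>\<^sup>+x. ennreal (potential a b p q u (norm x) * w x) \<partial>lborel)
     = (\<integral>\<^sup>+x. ennreal a * (\<integral>\<^sup>+\<rho>. ?k x \<rho> \<partial>lborel) \<partial>lborel)"
  proof (rule nn_integral_cong_AE)
    show "AE x in lborel. ennreal (potential a b p q u (norm x) * w x) = ennreal a * (\<integral>\<^sup>+\<rho>. ?k x \<rho> \<partial>lborel)"
      using AE_lborel_singleton[of 0]
    proof eventually_elim
      case (elim x)
      then have "norm x > 0" by simp
      from ennreal_potential[OF u a b q fin this]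
      have "ennreal (potential a b p q u (norm x) * w x)
        = ennreal a * ((\<integral>\<^sup>+\<rho>. indicator {norm x<..} \<rho> * ?g \<rho> \<partial>lborel) * ennreal (w x))"
        using w0 by (simp add: ennreal_mult'' mult.assoc)
      also have "(\<integral>\<^sup>+\<rho>. indicator {norm x<..} \<rho> * ?g \<rho> \<partial>lborel) * ennreal (w x)
        = (\<integral>\<^sup>+\<rho>. indicator {norm x<..} \<rho> * ?g \<rho> * ennreal (w x) \<partial>lborel)"
        by (rule nn_integral_multc[symmetric]) measurable
      also have "\<dots> = (\<integral>\<^sup>+\<rho>. ?k x \<rho> \<partial>lborel)"
        by (intro nn_integral_cong) (auto simp: indicator_def)
      finally show ?case .
    qed
  qed
  also have "\<dots> = ennreal a * (\<integral>\<^sup>+x. \<integral>\<^sup>+\<rho>. ?k x \<rho> \<partial>lborel \<partial>lborel)"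
    by (rule nn_integral_cmult) measurable
  also have "(\<integral>\<^sup>+x. \<integral>\<^sup>+\<rho>. ?k x \<rho> \<partial>lborel \<partial>lborel) = (\<integral>\<^sup>+\<rho>. \<integral>\<^sup>+x. ?k x \<rho> \<partial>lborel \<partial>lborel)"
    by (rule lborel_pair.Fubini') measurable
  also have "\<dots> = (\<integral>\<^sup>+\<rho>. indicator {0<..} \<rho> * ?g \<rho> * (\<integral>\<^sup>+x. indicator {..<\<rho>} (norm x) * ennreal (w x) \<partial>lborel) \<partial>lborel)"
  proof (rule nn_integral_cong)
    fix \<rho> :: real
    have "(\<integral>\<^sup>+x. ?k x \<rho> \<partial>lborel)
      = (\<integral>\<^sup>+(x::real^'n). indicator {0<..} \<rho> * ?g \<rho> * (indicator {..<\<rho>} (norm x) * ennreal (w x)) \<partial>lborel)"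
    proof (rule nn_integral_cong)
      fix x :: "real^'n"
      show "?k x \<rho> = indicator {0<..} \<rho> * ?g \<rho> * (indicator {..<\<rho>} (norm x) * ennreal (w x))"
        using norm_ge_zero[of x] by (cases "norm x < \<rho>") (auto simp: indicator_def simp del: norm_ge_zero)
    qed
    also have "\<dots> = indicator {0<..} \<rho> * ?g \<rho> * (\<integral>\<^sup>+x. indicator {..<\<rho>} (norm x) * ennreal (w x) \<partial>lborel)"
      by (rule nn_integral_cmult) measurable
    finally show "(\<integral>\<^sup>+x. ?k x \<rho> \<partial>lborel)
       = indicator {0<..} \<rho> * ?g \<rho> * (\<integral>\<^sup>+x. indicator {..<\<rho>} (norm x) * ennreal (w x) \<partial>lborel)" .
  qed
  finally show ?thesis .
qed

lemma nn_integral_mass: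
  fixes v :: "real^'n::finite \<Rightarrow> real"
  assumes "ball_integrable p v \<rho>"
  shows "(\<integral>\<^sup>+x. indicator {..<\<rho>} (norm x) * ennreal (\<bar>v x\<bar> powr p) \<partial>lborel) = ennreal (mass p v \<rho>)"
proof -
  have "(\<integral>\<^sup>+x. indicator {..<\<rho>} (norm x) * ennreal (\<bar>v x\<bar> powr p) \<partial>lborel)
    = (\<integral>\<^sup>+x. ennreal (indicator {..<\<rho>} (norm x) * \<bar>v x\<bar> powr p) \<partial>lborel)"
    by (intro nn_integral_cong) (auto simp: indicator_def)
  also have "\<dots> = ennreal (mass p v \<rho>)"
    unfolding mass_def by (rule nn_integral_eq_integral[OF assms]) simp
  finally show ?thesis .
qed

lemma potential_energy:
  fixes u v :: "real^'n::finite \<Rightarrow> real"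
  assumes u [measurable]: "u \<in> borel_measurable borel" and v [measurable]: "v \<in> borel_measurable borel"
    and a: "a \<ge> 0" and b: "b > 1" and q: "q \<ge> 1" and fin: "energy b p q u < \<infinity>"
    and iv: "\<And>\<rho>. \<rho> > 0 \<Longrightarrow> ball_integrable p v \<rho>"
  shows "(\<integral>\<^sup>+x. ennreal (potential a b p q u (norm x) * \<bar>v x\<bar> powr p) \<partial>lborel)
    \<le> ennreal a * (ennreal (1 - 1 / q) * energy b p q u + ennreal (1 / q) * energy b p q v)" (is "?lhs \<le> _")
    and "u = v \<Longrightarrow> (\<integral>\<^sup>+x. ennreal (potential a b p q u (norm x) * \<bar>v x\<bar> powr p) \<partial>lborel) = ennreal a * energy b p q u"
proof -
  have vm: "(\<lambda>x. \<bar>v x\<bar> powr p) \<in> borel_measurable borel" by measurable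
  have eq: "?lhs = ennreal a * (\<integral>\<^sup>+\<rho>. indicator {0<..} \<rho> * ennreal (\<rho> powr (- b) * (rpow (mass p u \<rho>) (q - 1) * mass p v \<rho>)) \<partial>lborel)"
    unfolding potential_pairing[OF u vm a b q fin powr_ge_zero]
  proof (intro arg_cong[where f = "\<lambda>x. ennreal a * x"] nn_integral_cong)
    fix \<rho> :: real
    show "indicator {0<..} \<rho> * ennreal (\<rho> powr (- b) * rpow (mass p u \<rho>) (q - 1)) *
        (\<integral>\<^sup>+x. indicator {..<\<rho>} (norm x) * ennreal (\<bar>v x\<bar> powr p) \<partial>lborel)
      = indicator {0<..} \<rho> * ennreal (\<rho> powr (- b) * (rpow (mass p u \<rho>) (q - 1) * mass p v \<rho>))"
      using nn_integral_mass[OF iv, of \<rho>]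
      by (cases "\<rho> > 0") (auto simp: ennreal_mult'' mass_nonneg mult.assoc[symmetric])
  qed
  show "u = v \<Longrightarrow> ?lhs = ennreal a * energy b p q u"
  proof -
    assume "u = v"
    have "rpow x (q - 1) * x = x powr q" if "x \<ge> 0" for x
      using that q by (cases "x = 0") (auto simp: rpow_def powr_mult_base mult.commute)
    then show "?lhs = ennreal a * energy b p q u"
      unfolding eq energy_def using \<open>u = v\<close> by (simp add: mass_nonneg)
  qed
  have "?lhs \<le> ennreal a * (\<integral>\<^sup>+\<rho>. ennreal (1 - 1 / q) * (indicator {0<..} \<rho> * ennreal (\<rho> powr (- b) * mass p u \<rho> powr q))
       + ennreal (1 / q) * (indicator {0<..} \<rho> * ennreal (\<rho> powr (- b) * mass p v \<rho> powr q)) \<partial>lborel)"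
    unfolding eq
  proof (intro mult_left_mono nn_integral_mono)
    fix \<rho> :: real
    have "\<rho> powr (- b) * (rpow (mass p u \<rho>) (q - 1) * mass p v \<rho>)
      \<le> \<rho> powr (- b) * ((1 - 1 / q) * mass p u \<rho> powr q + (1 / q) * mass p v \<rho> powr q)"
      by (intro mult_left_mono young_rpow q mass_nonneg) auto
    also have "\<dots> = (1 - 1 / q) * (\<rho> powr (- b) * mass p u \<rho> powr q) + (1 / q) * (\<rho> powr (- b) * mass p v \<rho> powr q)"
      by (simp add: algebra_simps)
    finally have "ennreal (\<rho> powr (- b) * (rpow (mass p u \<rho>) (q - 1) * mass p v \<rho>))
      \<le> ennreal (1 - 1 / q) * ennreal (\<rho> powr (- b) * mass p u \<rho> powr q) + ennreal (1 / q) * ennreal (\<rho> powr (- b) * mass p v \<rho> powr q)"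
      using q by (simp add: ennreal_mult'[symmetric] ennreal_plus[symmetric] ennreal_leI del: ennreal_plus)
    then show "indicator {0<..} \<rho> * ennreal (\<rho> powr (- b) * (rpow (mass p u \<rho>) (q - 1) * mass p v \<rho>))
      \<le> ennreal (1 - 1 / q) * (indicator {0<..} \<rho> * ennreal (\<rho> powr (- b) * mass p u \<rho> powr q))
       + ennreal (1 / q) * (indicator {0<..} \<rho> * ennreal (\<rho> powr (- b) * mass p v \<rho> powr q))"
      by (simp split: split_indicator)
  qed simp
  also have "\<dots> = ennreal a * (ennreal (1 - 1 / q) * energy b p q u + ennreal (1 / q) * energy b p q v)"
    unfolding energy_def by (subst nn_integral_add, measurable, subst (1 2) nn_integral_cmult) auto
  finally show "?lhs \<le> ennreal a * (ennreal (1 - 1 / q) * energy b p q u + ennreal (1 / q) * energy b p q v)" .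
qed

text \<open>For \<open>v = dil t u\<close> the difference \<open>Mu - Mv\<close> is \<open>Mu * (1 - t powr (- \<delta>))\<close>.\<close>

lemma potential_term_bound:
  fixes u v :: "real^'n::finite \<Rightarrow> real"
  assumes u [measurable]: "u \<in> borel_measurable borel" and v [measurable]: "v \<in> borel_measurable borel"
    and a: "a \<ge> 0" and b: "b > 1" and q: "q \<ge> 1" and p: "p > 1"
    and iu: "\<And>\<rho>. \<rho> > 0 \<Longrightarrow> ball_integrable p u \<rho>"
    and iv: "\<And>\<rho>. \<rho> > 0 \<Longrightarrow> ball_integrable p v \<rho>"
    and Mu: "energy b p q u = ennreal Mu" "Mu \<ge> 0" and Mv: "energy b p q v = ennreal Mv" "Mv \<ge> 0"
  shows "(LBINT x. potential a b p q u (norm x) * \<bar>u x\<bar> powr p) = a * Mu"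
    and "(LBINT x. potential a b p q u (norm x) * (\<bar>u x\<bar> powr (p - 2) * u x * v x))
      \<le> a * Mu - a / (p * q) * (Mu - Mv)"
proof -
  let ?W = "\<lambda>x::real^'n. potential a b p q u (norm x)"
  have W: "?W x \<ge> 0" for x by (rule potential_nonneg[OF u a])
  have [measurable]: "?W \<in> borel_measurable borel" by measurable
  have fin: "energy b p q u < \<infinity>" using Mu by simp
  have X: "(\<integral>\<^sup>+x. ennreal (?W x * \<bar>u x\<bar> powr p) \<partial>lborel) = ennreal (a * Mu)"
    using potential_energy(2)[OF u u a b q fin iu refl] Mu a by (simp add: ennreal_mult')
  have Xi: "integrable lborel (\<lambda>x. ?W x * \<bar>u x\<bar> powr p)"
    by (intro integrableI_nonneg) (use X W in auto)
  show Xe: "(LBINT x. ?W x * \<bar>u x\<bar> powr p) = a * Mu"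
    using X a Mu W by (simp add: integral_eq_nn_integral)
  have "(\<integral>\<^sup>+x. ennreal (?W x * \<bar>v x\<bar> powr p) \<partial>lborel)
      \<le> ennreal a * (ennreal (1 - 1 / q) * energy b p q u + ennreal (1 / q) * energy b p q v)"
    by (rule potential_energy(1)[OF u v a b q fin iv])
  also have "\<dots> = ennreal (a * ((1 - 1 / q) * Mu + (1 / q) * Mv))"
  proof -
    have "ennreal (a * ((1 - 1 / q) * Mu + (1 / q) * Mv)) = ennreal a * ennreal ((1 - 1 / q) * Mu + (1 / q) * Mv)"
      using a by (rule ennreal_mult')
    also have "ennreal ((1 - 1 / q) * Mu + (1 / q) * Mv) = ennreal ((1 - 1 / q) * Mu) + ennreal ((1 / q) * Mv)"
      using q Mu Mv by (intro ennreal_plus mult_nonneg_nonneg) auto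
    also have "ennreal ((1 - 1 / q) * Mu) = ennreal (1 - 1 / q) * ennreal Mu"
      using q by (intro ennreal_mult') auto
    also have "ennreal ((1 / q) * Mv) = ennreal (1 / q) * ennreal Mv"
      using q by (intro ennreal_mult') auto
    finally show ?thesis by (simp only: Mu(1) Mv(1))
  qed
  finally have Y: "(\<integral>\<^sup>+x. ennreal (?W x * \<bar>v x\<bar> powr p) \<partial>lborel) \<le> ennreal (a * ((1 - 1 / q) * Mu + (1 / q) * Mv))" .
  have Yi: "integrable lborel (\<lambda>x. ?W x * \<bar>v x\<bar> powr p)"
    by (intro integrableI_nonneg) (use Y W in \<open>auto intro: le_less_trans\<close>)
  have nn: "a * ((1 - 1 / q) * Mu + (1 / q) * Mv) \<ge> 0"
    using a q Mu Mv by (intro mult_nonneg_nonneg add_nonneg_nonneg) auto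
  have Ye: "(LBINT x. ?W x * \<bar>v x\<bar> powr p) \<le> a * ((1 - 1 / q) * Mu + (1 / q) * Mv)"
  proof -
    have "ennreal (LBINT x. ?W x * \<bar>v x\<bar> powr p) \<le> ennreal (a * ((1 - 1 / q) * Mu + (1 / q) * Mv))"
      using Y nn_integral_eq_integral[OF Yi] W by simp
    then show ?thesis using nn by (simp add: ennreal_le_iff)
  qed
  have "(LBINT x. ?W x * (\<bar>u x\<bar> powr (p - 2) * u x * v x))
     \<le> (1 - 1 / p) * (a * Mu) + (1 / p) * (LBINT x. ?W x * \<bar>v x\<bar> powr p)"
    using weighted_pairing(2)[OF _ u v W p Xi Yi] Xe by simp
  also have "\<dots> \<le> (1 - 1 / p) * (a * Mu) + (1 / p) * (a * ((1 - 1 / q) * Mu + (1 / q) * Mv))"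
    using Ye p by (intro add_left_mono mult_left_mono) auto
  also have "\<dots> = a * Mu - a / (p * q) * (Mu - Mv)"
    using p q by (simp add: field_simps)
  finally show "(LBINT x. ?W x * (\<bar>u x\<bar> powr (p - 2) * u x * v x)) \<le> a * Mu - a / (p * q) * (Mu - Mv)" .
qed

section \<open>The critical term\<close>

text \<open>For arguments of equal sign this is the mean value theorem for \<open>y \<mapsto> \<bar>y\<bar> powr (s - 2) * y\<close>, whose derivative is
\<open>(s - 1) * \<bar>y\<bar> powr (s - 2)\<close>.\<close>

lemma powr_monotone_lipschitz:
  fixes x y s :: real
  assumes s: "s > 2"
  shows "(\<bar>x\<bar> powr (s - 2) * x - \<bar>y\<bar> powr (s - 2) * y) * (x - y)
    \<le> (s - 1) * max \<bar>x\<bar> \<bar>y\<bar> powr (s - 2) * (x - y)\<^sup>2"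
proof -
  define f where "f z = \<bar>z\<bar> powr (s - 2) * z" for z :: real
  have f_pos: "z \<ge> 0 \<Longrightarrow> f z = z powr (s - 1)" for z
    using powr_mult_base[of z "s - 2"] by (simp add: f_def mult.commute)
  have mvt: "f x - f y \<le> (s - 1) * x powr (s - 2) * (x - y)" if "0 \<le> y" "y < x" for x y
  proof -
    have "\<exists>l z. y < z \<and> z < x \<and> ((\<lambda>z. z powr (s - 1)) has_real_derivative l) (at z) \<and>
        x powr (s - 1) - y powr (s - 1) = (x - y) * l"
    proof (rule MVT)
      show "y < x" by fact
      show "continuous_on {y..x} (\<lambda>z. z powr (s - 1))"
        using that s by (intro continuous_on_powr') (auto intro: continuous_intros)
      fix z assume "y < z" "z < x"
      then have "((\<lambda>z. z powr (s - 1)) has_real_derivative (s - 1) * z powr (s - 1 - 1)) (at z)"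
        using that by (intro has_real_derivative_powr) auto
      then show "(\<lambda>z. z powr (s - 1)) differentiable (at z)"
        by (auto simp: real_differentiable_def)
    qed
    then obtain l z where z: "y < z" "z < x" and l: "((\<lambda>z. z powr (s - 1)) has_real_derivative l) (at z)"
      and eq: "x powr (s - 1) - y powr (s - 1) = (x - y) * l"
      by blast
    have "l = (s - 1) * z powr (s - 1 - 1)"
      using l z that by (intro DERIV_unique[OF l has_real_derivative_powr]) auto
    with eq have eq: "x powr (s - 1) - y powr (s - 1) = (x - y) * ((s - 1) * z powr (s - 2))" by simp
    have "z powr (s - 2) \<le> x powr (s - 2)" using z that s by (intro powr_mono2) auto
    then have "(x - y) * ((s - 1) * z powr (s - 2)) \<le> (x - y) * ((s - 1) * x powr (s - 2))"
      using that s by (intro mult_left_mono) auto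
    then show ?thesis using eq that by (simp add: f_pos mult_ac)
  qed
  have pos: "(f x - f y) * (x - y) \<le> (s - 1) * max \<bar>x\<bar> \<bar>y\<bar> powr (s - 2) * (x - y)\<^sup>2" if "0 \<le> y" "y \<le> x" for x y
  proof (cases "y = x")
    case False
    with that have "y < x" by simp
    from mult_right_mono[OF mvt[OF that(1) this], of "x - y"] that show ?thesis
      by (simp add: power2_eq_square mult_ac max_def)
  qed simp
  have opp: "(f x - f y) * (x - y) \<le> (s - 1) * max \<bar>x\<bar> \<bar>y\<bar> powr (s - 2) * (x - y)\<^sup>2" if "y \<le> 0" "0 \<le> x" for x y
  proof -
    let ?M = "max \<bar>x\<bar> \<bar>y\<bar> powr (s - 2)"
    have "\<bar>x\<bar> powr (s - 2) \<le> ?M" "\<bar>y\<bar> powr (s - 2) \<le> ?M"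
      using s by (auto intro!: powr_mono2)
    then have "f x \<le> ?M * x" "- f y \<le> ?M * (- y)"
      using that mult_right_mono[of "\<bar>x\<bar> powr (s - 2)" ?M x] mult_right_mono[of "\<bar>y\<bar> powr (s - 2)" ?M "- y"]
      by (auto simp: f_def)
    then have "f x - f y \<le> ?M * (x - y)" by (simp add: algebra_simps)
    also have "\<dots> \<le> (s - 1) * (?M * (x - y))"
      using s that mult_right_mono[of 1 "s - 1" "?M * (x - y)"] by simp
    finally have "(f x - f y) * (x - y) \<le> (s - 1) * (?M * (x - y)) * (x - y)"
      using that by (intro mult_right_mono) auto
    then show ?thesis by (simp add: power2_eq_square mult_ac)
  qed
  have odd: "f (- z) = - f z" for z by (simp add: f_def)
  have neg: "(f (- x) - f (- y)) * (- x - - y) = (f x - f y) * (x - y)" "(- x - - y)\<^sup>2 = (x - y)\<^sup>2" for x y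
    by (simp_all add: odd algebra_simps power2_eq_square)
  have sym: "(f x - f y) * (x - y) = (f y - f x) * (y - x)" "(x - y)\<^sup>2 = (y - x)\<^sup>2" for x y
    by (simp_all add: algebra_simps power2_eq_square)
  have le: "(f x - f y) * (x - y) \<le> (s - 1) * max \<bar>x\<bar> \<bar>y\<bar> powr (s - 2) * (x - y)\<^sup>2" if "y \<le> x" for x y
  proof -
    consider "0 \<le> y" | "y \<le> 0" "0 \<le> x" | "x \<le> 0" by linarith
    then show ?thesis
    proof cases
      case 3
      then show ?thesis using pos[of "- x" "- y"] that sym[of x y] by (simp add: odd max.commute algebra_simps)
    qed (use that pos opp in auto)
  qed
  show ?thesis
    using le[of y x] le[of x y] sym[of x y] unfolding f_def[symmetric]
    by (cases "y \<le> x") (auto simp: max.commute)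
qed

text \<open>The difference \<open>K 1 - K t\<close> is at most of second order in \<open>t - 1\<close>. Splitting
\<open>u x - t powr m * u (t x) = (u x - u (t x)) - (t powr m - 1) * u (t x)\<close> separates a part that is controlled by the
gradient and the decay of \<open>u\<close> from a part that is controlled by the integral of \<open>\<bar>u\<bar> powr s\<close> alone.\<close>

lemma critical_term_bound:
  fixes u :: "real^'n::finite \<Rightarrow> real"
  defines "s \<equiv> crit_exp CARD('n)"
  assumes u [measurable]: "u \<in> borel_measurable borel" and Gm [measurable]: "G \<in> borel_measurable borel"
    and G: "has_weak_gradient u G" and rad: "radially_symmetric u" and N: "CARD('n) \<ge> 3"
    and ius: "integrable lborel (\<lambda>x. \<bar>u x\<bar> powr s)"
    and finG: "dirichlet G < \<infinity>"
  shows "\<exists>C. \<forall>t\<ge>1. (LBINT x. \<bar>u x\<bar> powr s) - (LBINT x. \<bar>u x\<bar> powr (s - 2) * u x * dil t u x)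
    \<le> C * ((t - 1)\<^sup>2 + (t powr hom_exp TYPE('n) - 1)\<^sup>2)"
proof -
  let ?m = "hom_exp TYPE('n)"
  have s2: "s > 2" unfolding s_def by (rule crit_exp_gt_2[OF N])
  have ms: "?m * (s - 2) = 2"
    using hom_exp_crit[where 'n = 'n, OF N] by (simp add: s_def[symmetric] algebra_simps)
  define K where "K = (LBINT x. \<bar>u x\<bar> powr s)"
  have K0: "K \<ge> 0" unfolding K_def by (intro integral_nonneg_AE) simp
  have nnu: "powr_integral s u = ennreal K"
    unfolding K_def by (rule nn_integral_eq_integral[OF ius]) simp
  obtain g where g: "g \<ge> 0" "dirichlet G = ennreal g"
    using finG by (cases "\<integral>\<^sup>+x. ennreal ((norm (G x))\<^sup>2) \<partial>lborel" rule: ennreal_cases) auto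
  obtain C where C: "C \<ge> 0" "AE x in lborel. \<bar>u x\<bar> \<le> C * norm x powr (- ?m)"
    by (rule radial_bound[OF u Gm G rad N _ finG]) (use nnu in \<open>auto simp: s_def\<close>)
  define c1 where "c1 = 2 * (s - 1) * C powr (s - 2)"
  have c1: "c1 \<ge> 0" using s2 by (simp add: c1_def)
  define c2 where "c2 = 2 * (s - 1)"
  have c2: "c2 \<ge> 0" using s2 by (simp add: c2_def)
  show ?thesis
  proof (intro exI[of _ "max (c1 * g) (c2 * (2 * K))"] allI impI)
    fix t :: real assume t: "t \<ge> 1"
    then have t0: "t > 0" by simp
    define v where "v = dil t u"
    have v [measurable]: "v \<in> borel_measurable borel" by (simp add: v_def)
    let ?f = "\<lambda>y::real. \<bar>y\<bar> powr (s - 2) * y"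
    have nnv: "powr_integral s v = ennreal K"
      unfolding v_def s_def nn_integral_dil_crit[OF u t0 N] using nnu by (simp add: s_def)
    have ivs: "integrable lborel (\<lambda>x. \<bar>v x\<bar> powr s)"
      by (intro integrableI_nonneg) (use nnv in auto)
    have Kv: "(LBINT x. \<bar>v x\<bar> powr s) = K"
      using nnv K0 by (simp add: integral_eq_nn_integral)
    have s1: "s > 1" using s2 by simp
    have i_uv: "integrable lborel (\<lambda>x. ?f (u x) * v x)"
      using weighted_pairing(1)[of "\<lambda>_. 1", OF _ u v _ s1] ius ivs by simp
    have i_vu: "integrable lborel (\<lambda>x. ?f (v x) * u x)"
      and le_vu: "(LBINT x. ?f (v x) * u x) \<le> K"
    proof -
      show "integrable lborel (\<lambda>x. ?f (v x) * u x)"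
        using weighted_pairing(1)[of "\<lambda>_. 1", OF _ v u _ s1] ius ivs by simp
      have "(LBINT x. ?f (v x) * u x) \<le> (1 - 1 / s) * K + (1 / s) * K"
        using weighted_pairing(2)[of "\<lambda>_. 1", OF _ v u _ s1] ius ivs Kv by (simp add: K_def)
      then show "(LBINT x. ?f (v x) * u x) \<le> K" by (simp add: algebra_simps)
    qed
    define d where "d x = (?f (u x) - ?f (v x)) * (u x - v x)" for x
    have d_eq: "d x = \<bar>u x\<bar> powr s - ?f (u x) * v x - (?f (v x) * u x - \<bar>v x\<bar> powr s)" for x
      using powr_diag[of "u x" s] powr_diag[of "v x" s] by (simp add: d_def algebra_simps)
    have id: "integrable lborel d"
      unfolding d_eq[abs_def] using ius ivs i_uv i_vu by (intro Bochner_Integration.integrable_diff)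
    have int_d: "(LBINT x. d x) = K - (LBINT x. ?f (u x) * v x) - ((LBINT x. ?f (v x) * u x) - K)"
      unfolding d_eq using ius ivs i_uv i_vu Kv by (simp add: K_def)
    \<comment> \<open>Subtracting \<open>\<integral> f v * (u - v)\<close>, which is nonpositive by Young's inequality, can only increase
      \<open>\<integral> f u * (u - v)\<close>.\<close>
    have "K - (LBINT x. ?f (u x) * v x) \<le> (LBINT x. d x)"
      using int_d le_vu by simp
    define I where "I x = (\<integral>\<^sup>+r. indicator {1..t} r * ennreal ((norm (G (r *\<^sub>R x)))\<^sup>2) \<partial>lborel)" for x
    have [measurable]: "I \<in> borel_measurable borel" unfolding I_def by measurable
    let ?S = "\<lambda>x. ennreal (\<bar>u x\<bar> powr s) + ennreal (\<bar>v x\<bar> powr s)"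
    let ?a = "c1 * (t - 1)" and ?e = "c2 * (t powr ?m - 1)\<^sup>2"
    let ?g = "\<lambda>r x. norm x * norm (G (r *\<^sub>R x))" and ?g2 = "\<lambda>r x. ennreal ((norm (G (r *\<^sub>R x)))\<^sup>2)"
    have int_I: "(\<integral>\<^sup>+x. I x \<partial>lborel) \<le> ennreal (t - 1) * ennreal g"
    proof -
      have "(\<integral>\<^sup>+x. I x \<partial>lborel) = (\<integral>\<^sup>+r. \<integral>\<^sup>+x. indicator {1..t} r * ?g2 r x \<partial>lborel \<partial>lborel)"
        unfolding I_def by (rule lborel_pair.Fubini') measurable
      also have "\<dots> \<le> (\<integral>\<^sup>+r. ennreal g * indicator {1..t} r \<partial>lborel)"
      proof (rule nn_integral_mono)
        fix r :: real
        show "(\<integral>\<^sup>+x. indicator {1..t} r * ?g2 r x \<partial>lborel) \<le> ennreal g * indicator {1..t} r"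
        proof (cases "r \<in> {1..t}")
          case True
          then have r: "r > 0" "1 \<le> r" by auto
          have "(\<integral>\<^sup>+x. ?g2 r x \<partial>lborel)
            \<le> ennreal (r ^ CARD('n)) * (\<integral>\<^sup>+x. ?g2 r x \<partial>lborel)"
            using r mult_right_mono[of 1 "ennreal (r ^ CARD('n))"] by (auto simp: one_le_power)
          also have "\<dots> = ennreal g"
            using nn_integral_dilate[OF r(1), of "\<lambda>x::real^'n. ennreal ((norm (G x))\<^sup>2)"] g by simp
          finally show ?thesis using True by simp
        qed simp
      qed
      also have "\<dots> = ennreal (t - 1) * ennreal g"
        using t by (subst nn_integral_cmult_indicator) (auto simp: mult.commute)
      finally show ?thesis .
    qed
    have "AE x in lborel. \<bar>u (t *\<^sub>R x)\<bar> \<le> C * norm (t *\<^sub>R x) powr (- ?m)"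
      by (rule AE_dilate[OF t0 C(2)])
    then have pw: "AE x in lborel. ennreal (d x) \<le> ennreal ?a * I x
        + ennreal (?e) * ?S x"
      using C(2) ray_bound[OF u Gm G t] AE_lborel_singleton[of 0]
    proof eventually_elim
      case (elim x)
      define M where "M = max \<bar>u x\<bar> \<bar>v x\<bar>"
      have x: "norm x > 0" using elim(4) by simp
      have "\<bar>v x\<bar> \<le> C * norm x powr (- ?m)"
      proof -
        have "\<bar>v x\<bar> = t powr ?m * \<bar>u (t *\<^sub>R x)\<bar>" by (simp add: v_def dil_def abs_mult)
        also have "\<dots> \<le> t powr ?m * (C * norm (t *\<^sub>R x) powr (- ?m))"
          using elim(1) by (intro mult_left_mono) auto
        also have "\<dots> = C * norm x powr (- ?m)"
          using t0 by (simp add: powr_mult powr_minus)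
        finally show ?thesis .
      qed
      then have M: "M \<le> C * norm x powr (- ?m)" "M \<ge> 0" using elim(2) by (auto simp: M_def)
      have "M powr (s - 2) \<le> (C * norm x powr (- ?m)) powr (s - 2)"
        using M s2 by (intro powr_mono2) auto
      also have "\<dots> = C powr (s - 2) * norm x powr (- (?m * (s - 2)))"
        using C(1) by (simp add: powr_mult powr_powr)
      also have "norm x powr (- (?m * (s - 2))) = 1 / (norm x)\<^sup>2"
        unfolding ms using x by (simp add: powr_minus divide_inverse)
      finally have Ms: "M powr (s - 2) \<le> C powr (s - 2) / (norm x)\<^sup>2" by simp
      define D where "D = u (t *\<^sub>R x) - u x"
      define e where "e = (t powr ?m - 1) * u (t *\<^sub>R x)"
      have uv: "u x - v x = - D - e" by (simp add: D_def e_def v_def dil_def algebra_simps)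
      have sq: "(u x - v x)\<^sup>2 \<le> 2 * D\<^sup>2 + 2 * e\<^sup>2"
        unfolding uv using sum_squares_bound[of D e] by (simp add: power2_eq_square algebra_simps)
      have "d x \<le> (s - 1) * M powr (s - 2) * (u x - v x)\<^sup>2"
        unfolding d_def M_def by (rule powr_monotone_lipschitz[OF s2])
      also have "\<dots> \<le> (s - 1) * M powr (s - 2) * (2 * D\<^sup>2 + 2 * e\<^sup>2)"
        using s2 by (intro mult_left_mono sq) auto
      also have "\<dots> = c2 * (M powr (s - 2) * D\<^sup>2) + c2 * (M powr (s - 2) * e\<^sup>2)"
        by (simp add: c2_def algebra_simps)
      finally have dx: "d x \<le> c2 * (M powr (s - 2) * D\<^sup>2) + c2 * (M powr (s - 2) * e\<^sup>2)" .
      have e_part: "c2 * (M powr (s - 2) * e\<^sup>2) \<le> ?e * (\<bar>u x\<bar> powr s + \<bar>v x\<bar> powr s)"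
      proof -
        have "1 \<le> t powr ?m" using t N by (intro ge_one_powr_ge_zero) auto
        then have "\<bar>u (t *\<^sub>R x)\<bar> \<le> \<bar>v x\<bar>"
          using mult_right_mono[of 1 "t powr ?m" "\<bar>u (t *\<^sub>R x)\<bar>"] by (simp add: v_def dil_def abs_mult)
        then have "\<bar>u (t *\<^sub>R x)\<bar>\<^sup>2 \<le> M\<^sup>2" unfolding M_def by (intro power_mono) auto
        then have "M powr (s - 2) * (u (t *\<^sub>R x))\<^sup>2 \<le> M powr (s - 2) * M\<^sup>2"
          by (intro mult_left_mono) auto
        also have "\<dots> = M powr s"
          using powr_diag[of M s] M(2) by (simp add: power2_eq_square mult.assoc)
        also have "\<dots> \<le> \<bar>u x\<bar> powr s + \<bar>v x\<bar> powr s"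
          by (simp add: M_def max_def)
        finally have "?e * (M powr (s - 2) * (u (t *\<^sub>R x))\<^sup>2)
          \<le> ?e * (\<bar>u x\<bar> powr s + \<bar>v x\<bar> powr s)"
          using c2 by (intro mult_left_mono) auto
        then show ?thesis by (simp add: e_def power_mult_distrib mult_ac)
      qed
      have D_part: "ennreal (c2 * (M powr (s - 2) * D\<^sup>2)) \<le> ennreal ?a * I x"
      proof -
        have "(ennreal \<bar>D\<bar>)\<^sup>2 \<le> (\<integral>\<^sup>+r. indicator {1..t} r * ennreal (?g r x) \<partial>lborel)\<^sup>2"
          using elim(3) by (intro power_mono) (auto simp: D_def)
        also have "\<dots> = (\<integral>\<^sup>+r. indicator {1..t} r * (indicator {1..t} r * ennreal (?g r x)) \<partial>lborel)\<^sup>2"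
          by (intro arg_cong[where f = "\<lambda>x. x\<^sup>2"] nn_integral_cong) (simp split: split_indicator)
        also have "\<dots> \<le> (\<integral>\<^sup>+r. (indicator {1..t} r)\<^sup>2 \<partial>lborel) *
            (\<integral>\<^sup>+r. (indicator {1..t} r * ennreal (?g r x))\<^sup>2 \<partial>lborel)"
          by (rule Cauchy_Schwarz_nn_integral) measurable
        also have "(\<integral>\<^sup>+r. (indicator {1..t} r)\<^sup>2 \<partial>lborel) = (\<integral>\<^sup>+r. indicator {1..t} r \<partial>lborel)"
          by (intro nn_integral_cong) (simp split: split_indicator)
        also have "\<dots> = ennreal (t - 1)" using t by simp
        also have "(\<integral>\<^sup>+r. (indicator {1..t} r * ennreal (?g r x))\<^sup>2 \<partial>lborel)
            = (\<integral>\<^sup>+r. ennreal ((norm x)\<^sup>2) * (indicator {1..t} r * ?g2 r x) \<partial>lborel)"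
          by (intro nn_integral_cong)
            (auto split: split_indicator simp: ennreal_power power_mult_distrib ennreal_mult')
        also have "\<dots> = ennreal ((norm x)\<^sup>2) * I x"
          unfolding I_def by (rule nn_integral_cmult) measurable
        finally have D2: "ennreal (D\<^sup>2) \<le> ennreal (t - 1) * (ennreal ((norm x)\<^sup>2) * I x)"
          by (simp add: ennreal_power)
        have "ennreal (c2 * (M powr (s - 2) * D\<^sup>2)) \<le> ennreal ((c2 * (C powr (s - 2) / (norm x)\<^sup>2)) * D\<^sup>2)"
          unfolding mult.assoc using c2 by (intro ennreal_leI mult_left_mono mult_right_mono Ms) auto
        also have "\<dots> = ennreal (c1 / (norm x)\<^sup>2) * ennreal (D\<^sup>2)"
        proof -
          have "c2 * (C powr (s - 2) / (norm x)\<^sup>2) * D\<^sup>2 = c1 / (norm x)\<^sup>2 * D\<^sup>2"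
            by (simp add: c1_def c2_def)
          then show ?thesis using c1 by (simp only: ennreal_mult' divide_nonneg_nonneg zero_le_power2)
        qed
        also have "\<dots> \<le> ennreal (c1 / (norm x)\<^sup>2) * (ennreal (t - 1) * (ennreal ((norm x)\<^sup>2) * I x))"
          by (intro mult_left_mono D2) auto
        also have "\<dots> = (ennreal (c1 / (norm x)\<^sup>2) * ennreal (t - 1) * ennreal ((norm x)\<^sup>2)) * I x"
          by (simp add: mult.assoc)
        also have "ennreal (c1 / (norm x)\<^sup>2) * ennreal (t - 1) * ennreal ((norm x)\<^sup>2) = ennreal ?a"
        proof -
          have "c1 * (t - 1) = c1 / (norm x)\<^sup>2 * (t - 1) * (norm x)\<^sup>2" using x by simp
          also have "ennreal \<dots> = ennreal (c1 / (norm x)\<^sup>2 * (t - 1)) * ennreal ((norm x)\<^sup>2)"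
            using c1 t by (intro ennreal_mult) auto
          also have "ennreal (c1 / (norm x)\<^sup>2 * (t - 1)) = ennreal (c1 / (norm x)\<^sup>2) * ennreal (t - 1)"
            using c1 t by (intro ennreal_mult) auto
          finally show ?thesis ..
        qed
        finally show ?thesis .
      qed
      have "ennreal (d x) \<le> ennreal (c2 * (M powr (s - 2) * D\<^sup>2) + c2 * (M powr (s - 2) * e\<^sup>2))"
        by (rule ennreal_leI[OF dx])
      also have "\<dots> = ennreal (c2 * (M powr (s - 2) * D\<^sup>2)) + ennreal (c2 * (M powr (s - 2) * e\<^sup>2))"
        using c2 by (intro ennreal_plus mult_nonneg_nonneg) auto
      also have "\<dots> \<le> ennreal ?a * I x + ennreal (?e * (\<bar>u x\<bar> powr s + \<bar>v x\<bar> powr s))"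
        by (intro add_mono D_part ennreal_leI e_part)
      finally show ?case using c2 by (simp add: ennreal_mult')
    qed
    have "ennreal (LBINT x. d x) \<le> (\<integral>\<^sup>+x. ennreal (d x) \<partial>lborel)"
    proof -
      have "(LBINT x. d x) \<le> (LBINT x. max 0 (d x))"
        by (intro integral_mono id integrable_max) auto
      then have "ennreal (LBINT x. d x) \<le> ennreal (LBINT x. max 0 (d x))" by (rule ennreal_leI)
      also have "\<dots> = (\<integral>\<^sup>+x. ennreal (max 0 (d x)) \<partial>lborel)"
        by (intro nn_integral_eq_integral[symmetric] integrable_max id) auto
      also have "\<dots> = (\<integral>\<^sup>+x. ennreal (d x) \<partial>lborel)"
        by (intro nn_integral_cong) (auto simp: max_def ennreal_neg)
      finally show ?thesis .
    qed
    also have "\<dots> \<le> (\<integral>\<^sup>+x. ennreal ?a * I x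
        + ennreal (?e) * ?S x \<partial>lborel)"
      by (rule nn_integral_mono_AE[OF pw])
    also have "\<dots> = (\<integral>\<^sup>+x. ennreal ?a * I x \<partial>lborel)
        + (\<integral>\<^sup>+x. ennreal (?e) * ?S x \<partial>lborel)"
      by (rule nn_integral_add) measurable
    also have "(\<integral>\<^sup>+x. ennreal ?a * I x \<partial>lborel) = ennreal ?a * (\<integral>\<^sup>+x. I x \<partial>lborel)"
      by (rule nn_integral_cmult) measurable
    also have "(\<integral>\<^sup>+x. ennreal (?e) * ?S x \<partial>lborel)
        = ennreal (?e) * (\<integral>\<^sup>+x. ennreal (\<bar>u x\<bar> powr s) + ennreal (\<bar>v x\<bar> powr s) \<partial>lborel)"
      by (rule nn_integral_cmult) measurable
    also have "(\<integral>\<^sup>+x. ennreal (\<bar>u x\<bar> powr s) + ennreal (\<bar>v x\<bar> powr s) \<partial>lborel) = ennreal K + ennreal K"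
      by (subst nn_integral_add) (simp_all only: nnu nnv, measurable)
    also have "ennreal ?a * (\<integral>\<^sup>+x. I x \<partial>lborel)
        + ennreal (?e) * (ennreal K + ennreal K) \<le> ennreal ?a * (ennreal (t - 1) * ennreal g)
        + ennreal (?e) * (ennreal K + ennreal K)"
      by (intro add_right_mono mult_left_mono int_I) auto
    also have "\<dots> = ennreal (c1 * g * (t - 1)\<^sup>2 + c2 * (2 * K) * (t powr ?m - 1)\<^sup>2)"
    proof -
      have "c1 * g * (t - 1)\<^sup>2 + c2 * (2 * K) * (t powr ?m - 1)\<^sup>2
        = (c1 * (t - 1)) * ((t - 1) * g) + (?e) * (K + K)"
        by (simp add: power2_eq_square algebra_simps)
      also have "ennreal \<dots> = ennreal ((c1 * (t - 1)) * ((t - 1) * g)) + ennreal ((?e) * (K + K))"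
        using c1 c2 t g K0 by (intro ennreal_plus mult_nonneg_nonneg) auto
      also have "ennreal ((c1 * (t - 1)) * ((t - 1) * g)) = ennreal ?a * (ennreal (t - 1) * ennreal g)"
        using c1 t g by (subst ennreal_mult') (auto simp: ennreal_mult')
      also have "ennreal ((?e) * (K + K)) = ennreal (?e) * (ennreal K + ennreal K)"
        using c2 K0 by (simp only: ennreal_mult' ennreal_plus mult_nonneg_nonneg zero_le_power2)
      finally show ?thesis by simp
    qed
    finally have "(LBINT x. d x) \<le> c1 * g * (t - 1)\<^sup>2 + c2 * (2 * K) * (t powr ?m - 1)\<^sup>2"
      using c1 c2 g K0 by (subst (asm) ennreal_le_iff) auto
    also have "\<dots> \<le> max (c1 * g) (c2 * (2 * K)) * (t - 1)\<^sup>2 + max (c1 * g) (c2 * (2 * K)) * (t powr ?m - 1)\<^sup>2"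
      by (intro add_mono mult_right_mono) auto
    finally have "(LBINT x. d x) \<le> max (c1 * g) (c2 * (2 * K)) * ((t - 1)\<^sup>2 + (t powr ?m - 1)\<^sup>2)"
      by (simp add: distrib_left)
    then show "(LBINT x. \<bar>u x\<bar> powr s) - (LBINT x. \<bar>u x\<bar> powr (s - 2) * u x * dil t u x)
      \<le> max (c1 * g) (c2 * (2 * K)) * ((t - 1)\<^sup>2 + (t powr ?m - 1)\<^sup>2)"
      using \<open>K - (\<integral>x. ?f (u x) * v x \<partial>lborel) \<le> (\<integral>x. d x \<partial>lborel)\<close> by (simp add: K_def v_def)
  qed
qed

section \<open>Nonexistence\<close>

lemma E_rad_measurable:
  fixes u :: "real^'n::finite \<Rightarrow> real"
  shows "u \<in> E_rad b p q \<Longrightarrow> u \<in> borel_measurable lebesgue"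
  unfolding E_rad_def E_space_def weakly_differentiable_def has_weak_gradient_def
  using locally_integrable_measurable by blast

lemma ball_mass_cong_AE:
  fixes u v :: "real^'n::finite \<Rightarrow> real"
  assumes ae: "AE x in lebesgue. u x = v x"
    and [measurable]: "u \<in> borel_measurable lebesgue" "v \<in> borel_measurable lebesgue"
  shows "ball_mass p u = ball_mass p v"
    and "set_integrable lebesgue (ball 0 \<rho>) (\<lambda>y. \<bar>u y\<bar> powr p) \<longleftrightarrow> set_integrable lebesgue (ball 0 \<rho>) (\<lambda>y. \<bar>v y\<bar> powr p)"
proof -
  have [measurable]: "ball (0::real^'n) \<rho> \<in> sets lebesgue" for \<rho> by simp
  have ae': "AE y in lebesgue. indicator (ball 0 \<rho>) y *\<^sub>R \<bar>u y\<bar> powr p = indicator (ball 0 \<rho>) y *\<^sub>R \<bar>v y\<bar> powr p" for \<rho>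
    using ae by eventually_elim simp
  show "ball_mass p u = ball_mass p v"
    unfolding ball_mass_def[abs_def] set_lebesgue_integral_def
    by (intro ext integral_cong_AE ae') measurable
  show "set_integrable lebesgue (ball 0 \<rho>) (\<lambda>y. \<bar>u y\<bar> powr p) \<longleftrightarrow> set_integrable lebesgue (ball 0 \<rho>) (\<lambda>y. \<bar>v y\<bar> powr p)"
    unfolding set_integrable_def by (intro integrable_cong_AE ae') measurable
qed

text \<open>This allows a solution to be replaced by a Borel representative.\<close>

lemma weak_radial_solution_cong_AE:
  fixes u v :: "real^'n::finite \<Rightarrow> real"
  assumes ae: "AE x in lebesgue. u x = v x" and v: "v \<in> borel_measurable borel"
    and sol: "weak_radial_solution a b p q u"
  shows "weak_radial_solution a b p q v"
proof -
  have E: "u \<in> E_rad b p q"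
    and eq: "\<And>w. w \<in> E_rad b p q \<Longrightarrow>
        (LINT x|lebesgue. weak_grad u x \<bullet> weak_grad w x)
          + (LINT x|lebesgue. potential a b p q u (norm x) * \<bar>u x\<bar> powr (p - 2) * u x * w x)
        = (LINT x|lebesgue. \<bar>u x\<bar> powr (crit_exp CARD('n) - 2) * u x * w x)"
    using sol by (auto simp: weak_radial_solution_def)
  have [measurable]: "u \<in> borel_measurable lebesgue" by (rule E_rad_measurable[OF E])
  have [measurable]: "v \<in> borel_measurable lebesgue"
    using v by (intro measurable_completion) simp
  have bm: "ball_mass p u = ball_mass p v"
    "\<And>\<rho>. set_integrable lebesgue (ball 0 \<rho>) (\<lambda>y. \<bar>u y\<bar> powr p) \<longleftrightarrow> set_integrable lebesgue (ball 0 \<rho>) (\<lambda>y. \<bar>v y\<bar> powr p)"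
    by (rule ball_mass_cong_AE[OF ae]; measurable)+
  have wg: "weak_grad u = weak_grad v" "weakly_differentiable u \<longleftrightarrow> weakly_differentiable v"
    by (rule weak_grad_cong_AE[OF ae]; measurable)+
  have pot: "potential a b p q u = potential a b p q v"
    by (intro ext) (simp add: potential_def bm(1))
  define \<Phi> where "\<Phi> x = potential a b p q v (norm x)" for x :: "real^'n"
  have [measurable]: "\<Phi> \<in> borel_measurable lebesgue"
    unfolding \<Phi>_def[abs_def] using v by (intro measurable_completion) simp
  have "radially_symmetric v"
  proof -
    obtain f :: "real \<Rightarrow> real" where "AE x in lebesgue. u x = f (norm x)"
      using E by (auto simp: E_rad_def radially_symmetric_def)
    with ae have "AE x in lebesgue. v x = f (norm x)" by eventually_elim simp
    then show ?thesis by (auto simp: radially_symmetric_def)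
  qed
  with E have "v \<in> E_rad b p q"
    by (simp add: E_rad_def E_space_def bm wg)
  moreover have "(LINT x|lebesgue. weak_grad v x \<bullet> weak_grad w x)
          + (LINT x|lebesgue. potential a b p q v (norm x) * \<bar>v x\<bar> powr (p - 2) * v x * w x)
        = (LINT x|lebesgue. \<bar>v x\<bar> powr (crit_exp CARD('n) - 2) * v x * w x)" if w: "w \<in> E_rad b p q" for w
  proof -
    have [measurable]: "w \<in> borel_measurable lebesgue" by (rule E_rad_measurable[OF w])
    have "(LINT x|lebesgue. \<Phi> x * \<bar>u x\<bar> powr (p - 2) * u x * w x)
      = (LINT x|lebesgue. \<Phi> x * \<bar>v x\<bar> powr (p - 2) * v x * w x)"
      by (rule integral_cong_AE) (measurable, use ae in eventually_elim, simp)
    moreover have "(LINT x|lebesgue. \<bar>u x\<bar> powr (crit_exp CARD('n) - 2) * u x * w x)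
      = (LINT x|lebesgue. \<bar>v x\<bar> powr (crit_exp CARD('n) - 2) * v x * w x)"
      by (rule integral_cong_AE) (measurable, use ae in eventually_elim, simp)
    ultimately show ?thesis using eq[OF w] by (simp add: wg pot \<Phi>_def)
  qed
  ultimately show ?thesis by (simp add: weak_radial_solution_def)
qed

lemma AE_zero_of_energy_zero:
  fixes u :: "real^'n::finite \<Rightarrow> real"
  assumes u [measurable]: "u \<in> borel_measurable borel"
    and iu: "\<And>\<rho>. \<rho> > 0 \<Longrightarrow> ball_integrable p u \<rho>"
    and e: "energy b p q u = 0"
  shows "AE x in lborel. u x = 0"
proof -
  have ae: "AE \<rho> in lborel. indicator {0<..} \<rho> * ennreal (\<rho> powr (- b) * mass p u \<rho> powr q) = 0"
    using e unfolding energy_def by (subst (asm) nn_integral_0_iff_AE) auto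
  have on_balls: "AE x in lborel. norm x < real n \<longrightarrow> u x = 0" for n :: nat
  proof -
    have "\<exists>\<rho>. \<rho> \<in> {real n<..<real n + 1} \<and> indicator {0<..} \<rho> * ennreal (\<rho> powr (- b) * mass p u \<rho> powr q) = 0"
    proof (rule ccontr)
      assume "\<not> ?thesis"
      then have "\<rho> \<notin> {real n<..<real n + 1}"
        if "indicator {0<..} \<rho> * ennreal (\<rho> powr (- b) * mass p u \<rho> powr q) = 0" for \<rho>
        using that by blast
      with ae have "AE \<rho> in lborel. \<rho> \<notin> {real n<..<real n + 1}"
        by (auto elim!: eventually_mono)
      then have "{real n<..<real n + 1} \<in> null_sets lborel"
        by (subst (asm) AE_iff_null_sets[symmetric]) auto
      then show False by (simp add: null_sets_def)
    qed
    then obtain \<rho> where \<rho>: "\<rho> > real n" "indicator {0<..} \<rho> * ennreal (\<rho> powr (- b) * mass p u \<rho> powr q) = 0"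
      by auto
    have \<rho>0: "\<rho> > 0" using \<rho>(1) by (rule le_less_trans[rotated]) simp
    with \<rho>(2) have "\<rho> powr (- b) * mass p u \<rho> powr q \<le> 0" by (simp add: ennreal_eq_0_iff)
    then have "mass p u \<rho> = 0"
      using \<rho>0 mass_nonneg[of p u \<rho>] by (auto simp: mult_le_0_iff)
    then have "AE y in lborel. indicator {..<\<rho>} (norm y) * \<bar>u y\<bar> powr p = 0"
      unfolding mass_def by (subst (asm) integral_nonneg_eq_0_iff_AE[OF iu[OF \<rho>0]]) auto
    then show ?thesis
      by eventually_elim (use \<rho>(1) in \<open>auto simp: indicator_def split: if_splits\<close>)
  qed
  have "AE x in lborel. \<forall>n::nat. norm x < real n \<longrightarrow> u x = 0"
    unfolding AE_all_countable using on_balls by blast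
  then show ?thesis
    by eventually_elim (use reals_Archimedean2 in blast)
qed

lemma gradient_term_le:
  fixes G :: "real^'n::finite \<Rightarrow> real^'n"
  assumes Gm [measurable]: "G \<in> borel_measurable borel" and t: "t > 0"
    and fin: "dirichlet G < \<infinity>"
  shows "(LBINT x. G x \<bullet> dil_grad t G x) \<le> (LBINT x. (norm (G x))\<^sup>2)"
proof -
  have i: "integrable lborel (\<lambda>x. (norm (G x))\<^sup>2)"
    by (intro integrableI_nonneg) (use fin in auto)
  have it: "integrable lborel (\<lambda>x. (norm (dil_grad t G x))\<^sup>2)"
    by (intro integrableI_nonneg) (use fin in \<open>auto simp: nn_integral_dil_grad[OF Gm t]\<close>)
  have eq: "(LBINT x. (norm (dil_grad t G x))\<^sup>2) = (LBINT x. (norm (G x))\<^sup>2)"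
    by (simp add: integral_eq_nn_integral nn_integral_dil_grad[OF Gm t])
  have le: "\<bar>x \<bullet> y\<bar> \<le> (norm x)\<^sup>2 / 2 + (norm y)\<^sup>2 / 2" for x y :: "real^'n"
    using Cauchy_Schwarz_ineq2[of x y] sum_squares_bound[of "norm x" "norm y"] by linarith
  have "(LBINT x. G x \<bullet> dil_grad t G x) \<le> (LBINT x. (norm (G x))\<^sup>2 / 2 + (norm (dil_grad t G x))\<^sup>2 / 2)"
  proof (rule integral_mono)
    show ib: "integrable lborel (\<lambda>x. (norm (G x))\<^sup>2 / 2 + (norm (dil_grad t G x))\<^sup>2 / 2)"
      using i it by simp
    show "integrable lborel (\<lambda>x. G x \<bullet> dil_grad t G x)"
      by (rule Bochner_Integration.integrable_bound[OF ib]) (use le in auto)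
    show "G x \<bullet> dil_grad t G x \<le> (norm (G x))\<^sup>2 / 2 + (norm (dil_grad t G x))\<^sup>2 / 2" for x
      using le[of "G x" "dil_grad t G x"] by linarith
  qed
  also have "\<dots> = (LBINT x. (norm (G x))\<^sup>2)"
    using i it eq by simp
  finally show ?thesis .
qed

text \<open>The left-hand side of the hypothesis has derivative \<open>A * \<delta>\<close> at \<open>t = 1\<close>, the right-hand side has derivative 0,
and both vanish there.\<close>

lemma linear_le_quadratic_at_1:
  fixes A C \<delta> m :: real
  assumes \<delta>: "\<delta> > 0"
    and le: "\<And>t. t \<ge> 1 \<Longrightarrow> A * (1 - t powr (- \<delta>)) \<le> C * ((t - 1)\<^sup>2 + (t powr m - 1)\<^sup>2)"
  shows "A \<le> 0"
proof (rule ccontr)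
  assume A: "\<not> A \<le> 0"
  define F where "F t = C * ((t - 1)\<^sup>2 + (t powr m - 1)\<^sup>2) - A * (1 - t powr (- \<delta>))" for t
  have "(F has_real_derivative (- (A * \<delta>))) (at 1)"
    unfolding F_def by (auto intro!: derivative_eq_intros)
  moreover have "- (A * \<delta>) < 0" using A \<delta> by simp
  ultimately obtain d where d: "d > 0" "\<And>h. h > 0 \<Longrightarrow> h < d \<Longrightarrow> F (1 + h) < F 1"
    using DERIV_neg_dec_right by blast
  have "F (1 + d / 2) < F 1" using d(1) by (intro d(2)) auto
  moreover have "F 1 = 0" by (simp add: F_def)
  moreover have "F (1 + d / 2) \<ge> 0" using le[of "1 + d / 2"] d(1) by (simp add: F_def)
  ultimately show False by simp
qed

lemma borel_weak_radial_solution_zero: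
  fixes u :: "real^'n::finite \<Rightarrow> real"
  assumes u [measurable]: "u \<in> borel_measurable borel"
    and sol: "weak_radial_solution a b p q u"
    and N: "CARD('n) \<ge> 3" and a: "a > 0" and p: "1 < p" and q: "1 \<le> q" and b: "1 < b"
    and b_star: "b < 1 + real CARD('n) * q * (1 - p / crit_exp CARD('n))"
  shows "AE x in lborel. u x = 0"
proof -
  let ?s = "crit_exp CARD('n)" and ?m = "hom_exp TYPE('n)"
  have E: "u \<in> E_rad b p q"
    and eq: "\<And>w. w \<in> E_rad b p q \<Longrightarrow>
        (LINT x|lebesgue. weak_grad u x \<bullet> weak_grad w x)
          + (LINT x|lebesgue. potential a b p q u (norm x) * \<bar>u x\<bar> powr (p - 2) * u x * w x)
        = (LINT x|lebesgue. \<bar>u x\<bar> powr (?s - 2) * u x * w x)"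
    using sol by (auto simp: weak_radial_solution_def)
  obtain G where Gm [measurable]: "G \<in> borel_measurable borel" and G: "has_weak_gradient u G"
    and wgu: "AE x in lebesgue. weak_grad u x = G x"
    using weak_grad_borel_rep[OF u] E by (auto simp: E_rad_def E_space_def)
  have iu: "\<And>\<rho>. \<rho> > 0 \<Longrightarrow> ball_integrable p u \<rho>"
    and finG: "dirichlet G < \<infinity>" and fine: "energy b p q u < \<infinity>"
    and rad: "radially_symmetric u"
    using E by (auto simp: E_rad_def E_space_borel_iff[OF u Gm G])
  obtain M where M: "energy b p q u = ennreal M" "M \<ge> 0"
    using fine by (cases "energy b p q u" rule: ennreal_cases) auto
  define \<delta> where "\<delta> = 1 + real CARD('n) * q * (1 - p / ?s) - b"
  have \<delta>: "\<delta> > 0" using b_star by (simp add: \<delta>_def)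
  define D where "D v = (LBINT x. potential a b p q u (norm x) * (\<bar>u x\<bar> powr (p - 2) * u x * v x))" for v
  define K where "K v = (LBINT x. \<bar>u x\<bar> powr (?s - 2) * u x * v x)" for v
  have tested: "(LBINT x. G x \<bullet> dil_grad t G x) + D (dil t u) = K (dil t u)" if t: "t > 0" for t
  proof -
    have wgt: "AE x in lebesgue. weak_grad (dil t u) x = dil_grad t G x"
      by (rule weak_grad_AE_eq[OF _ _ has_weak_gradient_dil[OF u Gm G t]]) measurable
    have Et: "dil t u \<in> E_rad b p q" by (rule dil_in_E_rad[OF u Gm G E t])
    have wm: "weak_grad w \<in> borel_measurable lebesgue" if "w \<in> E_rad b p q" for w :: "real^'n \<Rightarrow> real"
      using has_weak_gradient_weak_grad[of w] that
      by (intro locally_integrable_measurable) (auto simp: E_rad_def E_space_def has_weak_gradient_def)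
    have [measurable]: "weak_grad u \<in> borel_measurable lebesgue" "weak_grad (dil t u) \<in> borel_measurable lebesgue"
      using wm[OF E] wm[OF Et] by auto
    have [measurable]: "(\<lambda>x. G x \<bullet> dil_grad t G x) \<in> borel_measurable lebesgue"
      by (intro measurable_completion) simp
    have "(LINT x|lebesgue. weak_grad u x \<bullet> weak_grad (dil t u) x) = (LINT x|lebesgue. G x \<bullet> dil_grad t G x)"
    proof (rule integral_cong_AE)
      show "AE x in lebesgue. weak_grad u x \<bullet> weak_grad (dil t u) x = G x \<bullet> dil_grad t G x"
        using wgu wgt by eventually_elim simp
    qed measurable
    also have "\<dots> = (LBINT x. G x \<bullet> dil_grad t G x)"
      by (rule integral_completion) simp
    finally have 1: "(LINT x|lebesgue. weak_grad u x \<bullet> weak_grad (dil t u) x) = (LBINT x. G x \<bullet> dil_grad t G x)" .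
    have 2: "(LINT x|lebesgue. potential a b p q u (norm x) * \<bar>u x\<bar> powr (p - 2) * u x * dil t u x) = D (dil t u)"
      unfolding D_def mult.assoc by (rule integral_completion) simp
    have 3: "(LINT x|lebesgue. \<bar>u x\<bar> powr (?s - 2) * u x * dil t u x) = K (dil t u)"
      unfolding K_def by (rule integral_completion) simp
    show ?thesis using eq[OF Et] unfolding 1 2 3 .
  qed
  have dil1: "dil 1 u = u" "dil_grad 1 G = G" by (auto simp: dil_def dil_grad_def)
  have D1: "D u = a * M"
    using potential_term_bound(1)[OF u u _ b q p iu iu M M] a by (simp add: D_def powr_diag)
  have K1: "K u = (LBINT x. \<bar>u x\<bar> powr ?s)"
    by (simp add: K_def powr_diag)
  have A1: "(LBINT x. G x \<bullet> G x) = (LBINT x. (norm (G x))\<^sup>2)"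
    by (simp add: power2_norm_eq_inner)
  have nehari: "(LBINT x. (norm (G x))\<^sup>2) + a * M = K u"
    using tested[of 1] by (simp add: dil1 D1 A1)
  have "M = 0"
  proof (cases "integrable lborel (\<lambda>x. \<bar>u x\<bar> powr ?s)")
    \<comment> \<open>The integral of a function that is not integrable is 0.\<close>
    case False
    then have "K u = 0" by (simp add: K1 not_integrable_integral_eq)
    moreover have "(LBINT x. (norm (G x))\<^sup>2) \<ge> 0" by simp
    ultimately have "a * M \<le> 0" using nehari by linarith
    then show ?thesis using a M(2) by (simp add: mult_le_0_iff)
  next
    case True
    from critical_term_bound[OF u Gm G rad N True finG] obtain C where C:
      "\<And>t. t \<ge> 1 \<Longrightarrow> K u - K (dil t u) \<le> C * ((t - 1)\<^sup>2 + (t powr ?m - 1)\<^sup>2)"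
      unfolding K1 unfolding K_def by blast
    have "a / (p * q) * M * (1 - t powr (- \<delta>)) \<le> C * ((t - 1)\<^sup>2 + (t powr ?m - 1)\<^sup>2)" if t: "t \<ge> 1" for t
    proof -
      have t0: "t > 0" using t by simp
      have "b - 1 - q * (real CARD('n) - ?m * p) = - \<delta>"
      proof -
        have mp: "?m * p = real CARD('n) * (p / ?s)"
        proof -
          have "?s \<noteq> 0" using crit_exp_gt_2[OF N] by simp
          moreover have "(m * s) * (p / s) = m * p" if "s \<noteq> 0" for m s :: real using that by simp
          ultimately have "(?m * ?s) * (p / ?s) = ?m * p" by blast
          then show ?thesis by (simp only: hom_exp_crit[where 'n = 'n, OF N])
        qed
        have "b - 1 - q * (n - n * x) = - (1 + n * q * (1 - x) - b)" for n x :: real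
          by (simp add: algebra_simps)
        then show ?thesis unfolding mp \<delta>_def .
      qed
      then have Mt: "energy b p q (dil t u) = ennreal (t powr (- \<delta>) * M)"
        unfolding energy_dil[OF u t0] M(1) using M(2) by (simp add: ennreal_mult')
      have it: "ball_integrable p (dil t u) \<rho>" if "\<rho> > 0" for \<rho>
        using dil_in_E_rad[OF u Gm G E t0] that
        by (simp add: E_rad_def E_space_borel_iff[OF _ _ has_weak_gradient_dil[OF u Gm G t0]])
      have ring: "c * (M - x * M) = c * M * (1 - x)" for c x :: real
        by (simp add: algebra_simps)
      have "D (dil t u) \<le> a * M - a / (p * q) * (M - t powr (- \<delta>) * M)"
        unfolding D_def
        by (rule potential_term_bound(2)[OF u dil_measurable[OF u] _ b q p iu it M Mt]) (use a M(2) in auto)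
      moreover have "(LBINT x. G x \<bullet> dil_grad t G x) \<le> (LBINT x. (norm (G x))\<^sup>2)"
        by (rule gradient_term_le[OF Gm t0 finG])
      ultimately have "a / (p * q) * (M - t powr (- \<delta>) * M) \<le> K u - K (dil t u)"
        using nehari tested[OF t0] by linarith
      then have "a / (p * q) * (M - t powr (- \<delta>) * M) \<le> C * ((t - 1)\<^sup>2 + (t powr ?m - 1)\<^sup>2)"
        using C[OF t] by linarith
      moreover have "a / (p * q) * (M - t powr (- \<delta>) * M) = a / (p * q) * M * (1 - t powr (- \<delta>))"
        using ring[of "a / (p * q)" "t powr (- \<delta>)"] .
      ultimately show ?thesis by (simp only:)
    qed
    then have "a / (p * q) * M \<le> 0" by (rule linear_le_quadratic_at_1[OF \<delta>])
    then show ?thesis using a p q M(2) by (auto simp: mult_le_0_iff divide_le_0_iff zero_less_mult_iff)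
  qed
  then have "energy b p q u = 0" using M by simp
  then show ?thesis using AE_zero_of_energy_zero[OF u iu] by simp
qed

theorem theorem4p8:
  fixes a b p q :: real
  assumes "CARD('n::finite) \<ge> 3"
    and "a > 0"
    and "1 < p" and "p < crit_exp CARD('n)"
    and "1 \<le> q"
    and "2 < p * q" and "p * q < crit_exp CARD('n)"
    and "1 < b" and "b < 1 + real CARD('n) * q * (1 - p / crit_exp CARD('n))"
  shows "\<not> (\<exists>u :: real^'n \<Rightarrow> real.
            weak_radial_solution a b p q u \<and> \<not> (AE x in lebesgue. u x = 0))"
proof
  assume "\<exists>u :: real^'n \<Rightarrow> real. weak_radial_solution a b p q u \<and> \<not> (AE x in lebesgue. u x = 0)"
  then obtain u :: "real^'n \<Rightarrow> real" where sol: "weak_radial_solution a b p q u"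
    and nz: "\<not> (AE x in lebesgue. u x = 0)" by blast
  have "u \<in> borel_measurable lebesgue"
    using sol E_rad_measurable[of u b p q] by (simp add: weak_radial_solution_def)
  then obtain v where v: "v \<in> borel_measurable borel" "AE x in lebesgue. u x = v x"
    by (rule lebesgue_ex_borel_real)
  have "AE x in lborel. v x = 0"
    using assms by (intro borel_weak_radial_solution_zero[OF v(1) weak_radial_solution_cong_AE[OF v(2,1) sol]])
  then have "AE x in lebesgue. v x = 0" by (rule AE_completion)
  with v(2) have "AE x in lebesgue. u x = 0" by eventually_elim simp
  with nz show False by contradiction
qed

end
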